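(* Let $\mathbb F\in\{\mathbb R,\mathbb C,\mathbb H\}$ be fixed. Let $(k_n)_{n\ge1}\subset\mathbb N$ be an increasing sequence (of dimensions $k_n\ge2$) with $\lim_{n\to\infty}n/k_n=0$. Let $\nu$ be a probability measure on $[0,\infty[$ with finite second moment $\int_0^\infty x^2\,d\nu(x)$, and consider the associated radial random walks $(S_n^k)_{n\ge0}$ on $H_k(\mathbb F)$ for $k\in\mathbb N$, $k\ge2$. Then $m_j:=\int_0^\infty(\ln\cosh x)^j\,d\nu(x)<\infty$ exist for $j=1,2$, and $$\frac{\mathrm{dist}(S_n^{k_n},S_0^{k_n})-nm_1}{\sqrt n}$$ tends in distribution for $n\to\infty$ to $N(0,m_2-m_1^2)$.
   Context: Hyperbolic spaces. For $k\ge2$, $H_k(\mathbb F)=G/K$ with $G=SO_o(1,k)$, $K=SO(k)$ for $\mathbb F=\mathbb R$; $G=SU(1,k)$, $K=S(U(1)\times U(k))$ for $\mathbb F=\mathbb C$; $G=Sp(1,k)$, $K=Sp(1)\times Sp(k)$ for $\mathbb F=\mathbb H$. For $t\ge 0$ let $$a_t=\begin{pmatrix}\cosh t&0&\sinh t\\0&I_{k-1}&0\\ \sinh t&0&\cosh t\end{pmatrix}\in G$$ (of size $(k+1)\times(k+1)$). Every double coset in $G//K$ equals $Ka_tK$ for a unique $t\in[0,\infty[$. The hyperbolic distance on $G/K$ is $\mathrm{dist}(xK,yK):=t$ where $Ky^{-1}xK=Ka_tK$. $G$ acts isometrically on $H_k(\mathbb F)$. Radial random walks. A radial random walk on $H_k(\mathbb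 F)$ is a time-homogeneous Markov chain $(S_n^k)_{n\ge0}$ on $H_k(\mathbb F)$ started at $eK$ whose transition kernel $K_k$ is $G$-invariant: $K_k(g(x),g(A))=K_k(x,A)$ for all $g\in G$, $x\in H_k(\mathbb F)$ and Borel sets $A\subset H_k(\mathbb F)$. The distribution $\nu$ on $[0,\infty[$ of $\mathrm{dist}(S_n^k,S_{n+1}^k)$ does not depend on $n$, and each probability measure $\nu$ on $[0,\infty[$ determines a unique such kernel; the walk is called associated with $\nu$. $N(0,\sigma^2)$ is the normal distribution with mean $0$ and variance $\sigma^2$ (the point mass $\delta_0$ if $\sigma^2=0$). *)

theory Defs
  imports "HOL-Probability.Probability" "Jordan_Normal_Form.Determinant" "HOL-Algebra.Left_Coset"
begin

text \<open>
  The quaternions. Real and complex matrices are embedded into quaternionic ones below, so that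
  \<open>H_k(F)\<close> has the same type for all three choices of \<open>F\<close>.
\<close>

datatype quat = Quat (qre: real) (qi: real) (qj: real) (qk: real)

lemma quat_eq_iff: "x = y \<longleftrightarrow> qre x = qre y \<and> qi x = qi y \<and> qj x = qj y \<and> qk x = qk y"
  by (cases x; cases y) auto

instantiation quat :: real_normed_div_algebra
begin

definition "0 = Quat 0 0 0 0"
definition "1 = Quat 1 0 0 0"
definition "x + y = Quat (qre x + qre y) (qi x + qi y) (qj x + qj y) (qk x + qk y)"
definition "- x = Quat (- qre x) (- qi x) (- qj x) (- qk x)"
definition "x - y = Quat (qre x - qre y) (qi x - qi y) (qj x - qj y) (qk x - qk y)"
definition "r *\<^sub>R x = Quat (r * qre x) (r * qi x) (r * qj x) (r * qk x)"
definition "x * y = Quat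
  (qre x * qre y - qi x * qi y - qj x * qj y - qk x * qk y)
  (qre x * qi y + qi x * qre y + qj x * qk y - qk x * qj y)
  (qre x * qj y - qi x * qk y + qj x * qre y + qk x * qi y)
  (qre x * qk y + qi x * qj y - qj x * qi y + qk x * qre y)"
definition "norm x = sqrt ((qre x)\<^sup>2 + (qi x)\<^sup>2 + (qj x)\<^sup>2 + (qk x)\<^sup>2)"
definition "inverse x = (let s = (qre x)\<^sup>2 + (qi x)\<^sup>2 + (qj x)\<^sup>2 + (qk x)\<^sup>2
  in Quat (qre x / s) (- qi x / s) (- qj x / s) (- qk x / s))"
definition "divide x y = x * inverse (y::quat)"
definition "sgn x = inverse (norm x) *\<^sub>R (x::quat)"
definition "dist x y = norm (x - y :: quat)"
definition [code del]: "(uniformity :: (quat \<times> quat) filter) = (INF e\<in>{0 <..}. principal {(x, y). dist x y < e})"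
definition [code del]: "open (U :: quat set) \<longleftrightarrow> (\<forall>x\<in>U. eventually (\<lambda>(x', y). x' = x \<longrightarrow> y \<in> U) uniformity)"

lemmas quat_ops = zero_quat_def one_quat_def plus_quat_def uminus_quat_def minus_quat_def
  scaleR_quat_def times_quat_def

lemma norm_quat_prod: "norm x = norm ((qre x, qi x), (qj x, qk x))"
  by (simp add: norm_quat_def norm_Pair add.assoc)

lemma quat_inverse:
  assumes "x \<noteq> (0::quat)"
  shows "inverse x * x = 1" "x * inverse x = 1"
proof -
  define s where "s = (qre x)\<^sup>2 + (qi x)\<^sup>2 + (qj x)\<^sup>2 + (qk x)\<^sup>2"
  have "s \<noteq> 0" using assms
    by (auto simp: s_def quat_eq_iff zero_quat_def add_nonneg_eq_0_iff)
  have inv: "inverse x = Quat (qre x / s) (- qi x / s) (- qj x / s) (- qk x / s)"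
    by (simp add: inverse_quat_def Let_def s_def)
  have sum: "qre x * qre x + (qi x * qi x + (qj x * qj x + qk x * qk x)) = s"
    by (simp add: s_def power2_eq_square)
  show "inverse x * x = 1" "x * inverse x = 1"
    unfolding inv using \<open>s \<noteq> 0\<close> by (simp_all add: quat_ops field_simps) (simp_all add: sum[symmetric])
qed

instance
proof
  fix x y z :: quat and a b :: real
  show "norm (x + y) \<le> norm x + norm y"
    using norm_triangle_ineq[of "((qre x, qi x), (qj x, qk x))" "((qre y, qi y), (qj y, qk y))"]
    by (simp add: norm_quat_prod plus_quat_def)
  show "norm (a *\<^sub>R x) = \<bar>a\<bar> * norm x"
    using norm_scaleR[of a "((qre x, qi x), (qj x, qk x))"]
    by (simp add: norm_quat_prod scaleR_quat_def)
  show "norm x = 0 \<longleftrightarrow> x = 0"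
    using norm_eq_zero[of "((qre x, qi x), (qj x, qk x))"]
    by (simp add: norm_quat_prod zero_quat_def quat_eq_iff zero_prod_def)
  show "norm (x * y) = norm x * norm y"
    by (simp add: norm_quat_def times_quat_def real_sqrt_mult[symmetric])
      (simp add: algebra_simps power2_eq_square)
  show "x \<noteq> 0 \<Longrightarrow> inverse x * x = 1" "x \<noteq> 0 \<Longrightarrow> x * inverse x = 1"
    by (rule quat_inverse, simp)+
  show "inverse 0 = (0::quat)"
    by (simp add: inverse_quat_def zero_quat_def)
qed (auto simp: quat_ops quat_eq_iff algebra_simps divide_quat_def sgn_quat_def dist_quat_def
      uniformity_quat_def open_quat_def)

end

definition qcnj :: "quat \<Rightarrow> quat" where
  "qcnj x = Quat (qre x) (- qi x) (- qj x) (- qk x)"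

definition quat_of_complex :: "complex \<Rightarrow> quat" where
  "quat_of_complex z = Quat (Re z) (Im z) 0 0"

text \<open>
  The argument \<open>cj\<close> is the conjugation of the scalars: the identity, \<^const>\<open>cnj\<close>
  or \<^const>\<open>qcnj\<close>.
\<close>

definition adjoint_mat :: "('a \<Rightarrow> 'a) \<Rightarrow> 'a mat \<Rightarrow> 'a mat" where
  "adjoint_mat cj A = map_mat cj (transpose_mat A)"

definition unitary_mats :: "('a::ring_1 \<Rightarrow> 'a) \<Rightarrow> nat \<Rightarrow> 'a mat set" where
  "unitary_mats cj n = {A \<in> carrier_mat n n. adjoint_mat cj A * A = 1\<^sub>m n}"

definition lorentz_form :: "nat \<Rightarrow> 'a::ring_1 mat" where
  "lorentz_form k = Matrix.mat (k + 1) (k + 1) (\<lambda>(i, j). if i = j then (if i = 0 then 1 else - 1) else 0)"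

definition lorentz_mats :: "('a::ring_1 \<Rightarrow> 'a) \<Rightarrow> nat \<Rightarrow> 'a mat set" where
  "lorentz_mats cj k = {A \<in> carrier_mat (k + 1) (k + 1).
     adjoint_mat cj A * lorentz_form k * A = lorentz_form k}"

definition block_diag :: "'a::zero mat \<Rightarrow> 'a mat \<Rightarrow> 'a mat" where
  "block_diag A B = four_block_mat A (0\<^sub>m (dim_row A) (dim_col B)) (0\<^sub>m (dim_row B) (dim_col A)) B"

definition mat_topology :: "nat \<Rightarrow> 'a::topological_space mat topology" where
  "mat_topology n = pullback_topology (carrier_mat n n)
     (\<lambda>A. restrict (\<lambda>ij. A $$ ij) ({..<n} \<times> {..<n}))
     (product_topology (\<lambda>_. euclidean) ({..<n} \<times> {..<n}))"

definition SO_1 :: "nat \<Rightarrow> real mat set" where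
  "SO_1 k = {A \<in> lorentz_mats id k. Determinant.det A = 1}"

text \<open>The identity component of \<open>SO(1,k)\<close>.\<close>

definition SOo_1 :: "nat \<Rightarrow> real mat set" where
  "SOo_1 k = connected_component_of_set (subtopology (mat_topology (k + 1)) (SO_1 k)) (1\<^sub>m (k + 1))"

definition SU_1 :: "nat \<Rightarrow> complex mat set" where
  "SU_1 k = {A \<in> lorentz_mats cnj k. Determinant.det A = 1}"

definition Sp_1 :: "nat \<Rightarrow> quat mat set" where
  "Sp_1 k = lorentz_mats qcnj k"

datatype hscalar = RR | CC | HH

fun hyp_G :: "hscalar \<Rightarrow> nat \<Rightarrow> quat mat set" where
  "hyp_G RR k = map_mat of_real ` SOo_1 k"
| "hyp_G CC k = map_mat quat_of_complex ` SU_1 k"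
| "hyp_G HH k = Sp_1 k"

fun hyp_K :: "hscalar \<Rightarrow> nat \<Rightarrow> quat mat set" where
  "hyp_K RR k = map_mat of_real ` {block_diag (1\<^sub>m 1) B | B. B \<in> unitary_mats id k \<and> Determinant.det B = 1}"
| "hyp_K CC k = map_mat quat_of_complex ` {block_diag A B | A B. A \<in> unitary_mats cnj 1 \<and>
     B \<in> unitary_mats cnj k \<and> Determinant.det (block_diag A B) = 1}"
| "hyp_K HH k = {block_diag A B | A B. A \<in> unitary_mats qcnj 1 \<and> B \<in> unitary_mats qcnj k}"

definition hyp_group :: "hscalar \<Rightarrow> nat \<Rightarrow> quat mat monoid" where
  "hyp_group F k = \<lparr>carrier = hyp_G F k, mult = (*), one = 1\<^sub>m (k + 1)\<rparr>"

definition hyp_a :: "nat \<Rightarrow> real \<Rightarrow> quat mat" where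
  "hyp_a k t = Matrix.mat (k + 1) (k + 1) (\<lambda>(i, j).
     if (i, j) \<in> {(0, 0), (k, k)} then of_real (cosh t)
     else if (i, j) \<in> {(0, k), (k, 0)} then of_real (sinh t)
     else if i = j then 1 else 0)"

text \<open>Points of \<open>H_k(F) = G/K\<close> are the cosets \<open>xK\<close>, as sets of matrices.\<close>

definition hyp_space :: "hscalar \<Rightarrow> nat \<Rightarrow> quat mat set set" where
  "hyp_space F k = lcosets\<^bsub>hyp_group F k\<^esub> (hyp_K F k)"

text \<open>The Borel sets of the quotient topology on \<open>G/K\<close>.\<close>

definition hyp_borel :: "hscalar \<Rightarrow> nat \<Rightarrow> quat mat set measure" where
  "hyp_borel F k = sigma (hyp_space F k) {U. U \<subseteq> hyp_space F k \<and>
     openin (subtopology (mat_topology (k + 1)) (hyp_G F k))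
       {x \<in> hyp_G F k. x <#\<^bsub>hyp_group F k\<^esub> hyp_K F k \<in> U}}"

definition dbl_coset :: "hscalar \<Rightarrow> nat \<Rightarrow> quat mat \<Rightarrow> quat mat set" where
  "dbl_coset F k g = hyp_K F k <#>\<^bsub>hyp_group F k\<^esub> (g <#\<^bsub>hyp_group F k\<^esub> hyp_K F k)"

definition hyp_dist :: "hscalar \<Rightarrow> nat \<Rightarrow> quat mat set \<Rightarrow> quat mat set \<Rightarrow> real" where
  "hyp_dist F k X Y = (THE t. t \<ge> 0 \<and> (\<exists>x\<in>hyp_G F k. \<exists>y\<in>hyp_G F k.
     X = x <#\<^bsub>hyp_group F k\<^esub> hyp_K F k \<and> Y = y <#\<^bsub>hyp_group F k\<^esub> hyp_K F k \<and>
     dbl_coset F k (inv\<^bsub>hyp_group F k\<^esub> y \<otimes>\<^bsub>hyp_group F k\<^esub> x) = dbl_coset F k (hyp_a k t)))"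

definition invariant_kernel :: "hscalar \<Rightarrow> nat \<Rightarrow> (quat mat set \<Rightarrow> quat mat set measure) \<Rightarrow> bool" where
  "invariant_kernel F k \<kappa> \<longleftrightarrow>
     (\<forall>g\<in>hyp_G F k. \<forall>X\<in>hyp_space F k. \<forall>A\<in>sets (hyp_borel F k).
        emeasure (\<kappa> (g <#\<^bsub>hyp_group F k\<^esub> X)) ((\<lambda>Y. g <#\<^bsub>hyp_group F k\<^esub> Y) ` A) = emeasure (\<kappa> X) A)"

definition past :: "'w measure \<Rightarrow> 's measure \<Rightarrow> (nat \<Rightarrow> 'w \<Rightarrow> 's) \<Rightarrow> nat \<Rightarrow> 'w measure" where
  "past M E S n = sigma (space M) {S i -` A \<inter> space M | i A. i \<le> n \<and> A \<in> sets E}"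

definition markov_chain ::
  "'w measure \<Rightarrow> 's measure \<Rightarrow> ('s \<Rightarrow> 's measure) \<Rightarrow> (nat \<Rightarrow> 'w \<Rightarrow> 's) \<Rightarrow> bool" where
  "markov_chain M E \<kappa> S \<longleftrightarrow>
     prob_space M \<and> \<kappa> \<in> E \<rightarrow>\<^sub>M prob_algebra E \<and> (\<forall>n. S n \<in> M \<rightarrow>\<^sub>M E) \<and>
     (\<forall>n. \<forall>A\<in>sets E. AE \<omega> in M.
        real_cond_exp M (past M E S n) (indicator (S (Suc n) -` A \<inter> space M)) \<omega>
          = measure (\<kappa> (S n \<omega>)) A)"

definition radial_random_walk ::
  "hscalar \<Rightarrow> nat \<Rightarrow> 'w measure \<Rightarrow> (nat \<Rightarrow> 'w \<Rightarrow> quat mat set) \<Rightarrow> bool" where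
  "radial_random_walk F k M S \<longleftrightarrow>
     (\<exists>\<kappa>. invariant_kernel F k \<kappa> \<and> markov_chain M (hyp_borel F k) \<kappa> S) \<and>
     (\<forall>\<omega>\<in>space M. S 0 \<omega> = 1\<^sub>m (k + 1) <#\<^bsub>hyp_group F k\<^esub> hyp_K F k)"

definition walk_associated_with ::
  "hscalar \<Rightarrow> nat \<Rightarrow> 'w measure \<Rightarrow> (nat \<Rightarrow> 'w \<Rightarrow> quat mat set) \<Rightarrow> real measure \<Rightarrow> bool" where
  "walk_associated_with F k M S \<nu> \<longleftrightarrow>
     radial_random_walk F k M S \<and>
     (\<forall>n. distr M borel (\<lambda>\<omega>. hyp_dist F k (S n \<omega>) (S (Suc n) \<omega>)) = \<nu>)"

definition lncosh_moment :: "real measure \<Rightarrow> nat \<Rightarrow> real" where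
  "lncosh_moment \<nu> j = integral\<^sup>L \<nu> (\<lambda>x. ln (cosh x) ^ j)"

text \<open>\<open>N(0, v)\<close>, parametrized by the variance \<open>v\<close>.\<close>

definition centered_normal :: "real \<Rightarrow> real measure" where
  "centered_normal v = (if v = 0 then return borel 0
     else density lborel (\<lambda>x. ennreal (normal_density 0 (sqrt v) x)))"

end

theory Submission
  imports Defs
begin

text \<open>
  Let \<open>o = eK\<close>, \<open>T\<^sub>i = dist(S\<^sub>i, S\<^sub>i\<^sub>+\<^sub>1)\<close> and
  \<open>r\<^sub>i = cosh dist(o, S\<^sub>i\<^sub>+\<^sub>1) / (cosh dist(o, S\<^sub>i) \<cdot> cosh T\<^sub>i)\<close>. The product of the \<open>r\<^sub>i\<close> telescopes to
  \<open>ln cosh dist(o, S\<^sub>n) = \<Sum> ln cosh T\<^sub>i + \<Sum> ln r\<^sub>i\<close>, and a distance differs from its \<open>ln cosh\<close> by at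
  most \<open>ln 2\<close>. The theorem says that the first sum obeys the classical central limit theorem
  and that the second one is negligible.

  The first sum: the law of \<open>dist(x, \<cdot>)\<close> under the kernel at \<open>x\<close> is the same for all \<open>x\<close>, because
  \<open>G\<close> acts transitively and isometrically. Hence \<open>T\<^sub>n\<close> is independent of \<open>S\<^sub>0, \<dots>, S\<^sub>n\<close>
  (\<open>indep_past_step\<close>), the characteristic function of the sum is an \<open>n\<close>-th power
  (\<open>char_sum_steps\<close>), and the usual Taylor estimate identifies its limit
  (\<open>char_power_tendsto_gaussian\<close>).

  The second sum: let \<open>g\<close> represent \<open>S\<^sub>i\<close> and let the step lead to \<open>gyK\<close>, so that \<open>yK\<close> is distributed
  by the kernel at \<open>o\<close>, which is invariant under \<open>K\<close>. Since the distance of \<open>xK\<close> from \<open>o\<close> is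
  determined by \<open>cosh dist = \<bar>x\<^sub>0\<^sub>0\<bar>\<close> (\<open>hyp_dist_coset\<close>), we have
  \<open>r\<^sub>i = \<bar>g\<^sub>0\<^sub>0 y\<^sub>0\<^sub>0 + \<Sum>\<^sub>l g\<^sub>0\<^sub>l y\<^sub>l\<^sub>0\<bar> / (\<bar>g\<^sub>0\<^sub>0\<bar> \<bar>y\<^sub>0\<^sub>0\<bar>)\<close>. Thus \<open>\<bar>r\<^sub>i - 1\<bar>\<close> is at most the modulus of the product of
  a fixed vector of length at most 1 in \<open>F\<^sup>k\<close> with an isotropic random vector of length at most 1,
  and \<open>E(r\<^sub>i - 1)\<^sup>2 \<le> 1/k\<close> (\<open>step_ratio_second_moment\<close>). So \<open>\<Sum> \<bar>ln r\<^sub>i\<bar>\<close> has the order \<open>n/\<surd>k\<close>, which is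
  small compared with \<open>\<surd>n\<close> precisely when \<open>n/k\<close> is small.

  Both parts are combined on the level of characteristic functions
  (\<open>char_radius_approximation\<close>), and Levy's continuity theorem concludes.

  The distance is defined through double cosets, so its computation rests on the Cartan
  decomposition \<open>G = K {a\<^sub>t} K\<close> (\<open>hyp_cartan_decomposition\<close>). It is proved for the three
  fields at once, in a locale of scalars that embed into the quaternions; the block of the left
  factor comes from a reflection that moves a basis vector to a given unit vector.
  Isotropy of the step is only used through rotations by \<open>\<pi>/2\<close> and \<open>\<pi>\<close> in coordinate planes. They lie
  in \<open>G\<close> also for \<open>F = \<real>\<close>, where \<open>G\<close> is an identity component, because the angle is a path to \<open>1\<close>.
\<close>

section \<open>Quaternionic matrices\<close>

lemma mat_mult_index:
  assumes "A \<in> carrier_mat n m" "B \<in> carrier_mat m l" "i < n" "j < l"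
  shows "(A * B) $$ (i, j) = (\<Sum>x<m. A $$ (i, x) * B $$ (x, j))"
  using assms by (auto simp: scalar_prod_def lessThan_atLeast0 intro!: sum.cong)

lemma square_mult_carrier: "X \<in> carrier_mat n n \<Longrightarrow> Y \<in> carrier_mat n n \<Longrightarrow> X * Y \<in> carrier_mat n n"
  by auto

lemma mat_eqI:
  assumes "A \<in> carrier_mat n m" "B \<in> carrier_mat n m"
    and "\<And>i j. i < n \<Longrightarrow> j < m \<Longrightarrow> A $$ (i, j) = B $$ (i, j)"
  shows "A = B"
  by (rule eq_matI) (use assms in auto)

lemma qcnj_sel [simp]: "qre (qcnj x) = qre x" "qi (qcnj x) = - qi x" "qj (qcnj x) = - qj x" "qk (qcnj x) = - qk x"
  by (simp_all add: qcnj_def)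

lemma quat_sel [simp]:
  "qre 0 = 0" "qi 0 = 0" "qj 0 = 0" "qk 0 = 0"
  "qre 1 = 1" "qi 1 = 0" "qj 1 = 0" "qk 1 = 0"
  "qre (x + y) = qre x + qre y" "qi (x + y) = qi x + qi y" "qj (x + y) = qj x + qj y" "qk (x + y) = qk x + qk y"
  "qre (x - y) = qre x - qre y" "qi (x - y) = qi x - qi y" "qj (x - y) = qj x - qj y" "qk (x - y) = qk x - qk y"
  "qre (- x) = - qre x" "qi (- x) = - qi x" "qj (- x) = - qj x" "qk (- x) = - qk x"
  "qre (of_real r) = r" "qi (of_real r) = 0" "qj (of_real r) = 0" "qk (of_real r) = 0"
  by (simp_all add: quat_ops of_real_def)

lemma quat_sel_mult:
  "qre (x * y) = qre x * qre y - qi x * qi y - qj x * qj y - qk x * qk y"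
  "qi (x * y) = qre x * qi y + qi x * qre y + qj x * qk y - qk x * qj y"
  "qj (x * y) = qre x * qj y - qi x * qk y + qj x * qre y + qk x * qi y"
  "qk (x * y) = qre x * qk y + qi x * qj y - qj x * qi y + qk x * qre y"
  by (simp_all add: times_quat_def)

lemma quat_sel_sum:
  "qre (sum f A) = (\<Sum>x\<in>A. qre (f x))" "qi (sum f A) = (\<Sum>x\<in>A. qi (f x))"
  "qj (sum f A) = (\<Sum>x\<in>A. qj (f x))" "qk (sum f A) = (\<Sum>x\<in>A. qk (f x))"
  by (induction A rule: infinite_finite_induct; simp)+

lemma qre_mult_commute: "qre (x * y) = qre (y * x)"
  by (simp add: quat_sel_mult)

lemma norm_quat_square: "(norm x)\<^sup>2 = (qre x)\<^sup>2 + (qi x)\<^sup>2 + (qj x)\<^sup>2 + (qk x)\<^sup>2"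
  by (simp add: norm_quat_def)

lemma abs_qre_le_norm: "\<bar>qre x\<bar> \<le> norm x"
  unfolding norm_quat_def by (rule real_le_rsqrt) simp

lemma qcnj_mult_self: "qcnj x * x = of_real ((norm x)\<^sup>2)" "x * qcnj x = of_real ((norm x)\<^sup>2)"
  unfolding norm_quat_square quat_eq_iff by (simp_all add: quat_sel_mult power2_eq_square del: of_real_add of_real_mult)

text \<open>
  Writing a quaternion as \<open>a + b j\<close> with complex \<open>a\<close>, \<open>b\<close> turns an \<open>n \<times> n\<close> quaternionic matrix into
  a \<open>2n \<times> 2n\<close> complex one, multiplicatively. Determinants are thus available, and one-sided
  inverses of quaternionic matrices are two-sided.
\<close>

definition qc1 :: "quat \<Rightarrow> complex" where "qc1 x = Complex (qre x) (qi x)"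
definition qc2 :: "quat \<Rightarrow> complex" where "qc2 x = Complex (qj x) (qk x)"

definition complex_blocks :: "quat mat \<Rightarrow> complex mat" where
  "complex_blocks A = four_block_mat (map_mat qc1 A) (map_mat qc2 A)
     (map_mat (\<lambda>x. - cnj (qc2 x)) A) (map_mat (\<lambda>x. cnj (qc1 x)) A)"

lemma qc_sum: "qc1 (sum f A) = (\<Sum>x\<in>A. qc1 (f x))" "qc2 (sum f A) = (\<Sum>x\<in>A. qc2 (f x))"
  by (simp_all add: qc1_def qc2_def complex_eq_iff quat_sel_sum)

lemma qc_mult:
  "qc1 (x * y) = qc1 x * qc1 y + qc2 x * - cnj (qc2 y)"
  "qc2 (x * y) = qc1 x * qc2 y + qc2 x * cnj (qc1 y)"
  by (simp_all add: qc1_def qc2_def complex_eq_iff quat_sel_mult)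

lemma complex_blocks_mult:
  assumes A: "A \<in> carrier_mat n n" and B: "B \<in> carrier_mat n n"
  shows "complex_blocks (A * B) = complex_blocks A * complex_blocks B"
proof -
  have eq: "map_mat f (A * B) = map_mat g1 A * map_mat h1 B + map_mat g2 A * map_mat h2 B"
    if f: "\<And>x y. f (x * y) = g1 x * h1 y + g2 x * h2 y" and s: "\<And>u. f (sum u {..<n}) = (\<Sum>x<n. f (u x))"
    for f g1 h1 g2 h2 :: "quat \<Rightarrow> complex"
  proof (rule mat_eqI[where n="n" and m="n"])
    fix i j assume ij: "i < n" "j < n"
    have "map_mat f (A * B) $$ (i, j) = f (\<Sum>x<n. A $$ (i, x) * B $$ (x, j))"
      using mat_mult_index[OF A B ij] A B ij by simp
    also have "\<dots> = (\<Sum>x<n. g1 (A $$ (i, x)) * h1 (B $$ (x, j))) + (\<Sum>x<n. g2 (A $$ (i, x)) * h2 (B $$ (x, j)))"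
      by (simp add: s f sum.distrib)
    also have "\<dots> = (map_mat g1 A * map_mat h1 B + map_mat g2 A * map_mat h2 B) $$ (i, j)"
      using A B ij by (simp add: mat_mult_index[where n=n and m=n and l=n] del: index_mult_mat(1))
    finally show "map_mat f (A * B) $$ (i, j) = \<dots>" .
  qed (use A B in auto)
  have blocks:
    "map_mat qc1 (A * B) = map_mat qc1 A * map_mat qc1 B + map_mat qc2 A * map_mat (\<lambda>x. - cnj (qc2 x)) B"
    "map_mat qc2 (A * B) = map_mat qc1 A * map_mat qc2 B + map_mat qc2 A * map_mat (\<lambda>x. cnj (qc1 x)) B"
    "map_mat (\<lambda>x. - cnj (qc2 x)) (A * B) =
      map_mat (\<lambda>x. - cnj (qc2 x)) A * map_mat qc1 B + map_mat (\<lambda>x. cnj (qc1 x)) A * map_mat (\<lambda>x. - cnj (qc2 x)) B"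
    "map_mat (\<lambda>x. cnj (qc1 x)) (A * B) =
      map_mat (\<lambda>x. - cnj (qc2 x)) A * map_mat qc2 B + map_mat (\<lambda>x. cnj (qc1 x)) A * map_mat (\<lambda>x. cnj (qc1 x)) B"
    by (rule eq, simp add: qc_mult, simp add: qc_sum sum_negf)+
  show ?thesis
    unfolding complex_blocks_def blocks
    by (rule mult_four_block_mat[symmetric]) (use A B in auto)
qed

lemma complex_blocks_one: "complex_blocks (1\<^sub>m n) = 1\<^sub>m (n + n)"
  unfolding complex_blocks_def
  by (rule eq_matI) (auto simp: four_block_mat_def Let_def qc1_def qc2_def complex_eq_iff)

lemma complex_blocks_inject:
  assumes A: "A \<in> carrier_mat n n" and B: "B \<in> carrier_mat n n" and eq: "complex_blocks A = complex_blocks B"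
  shows "A = B"
proof (rule mat_eqI[where n="n" and m="n"])
  fix i j assume ij: "i < n" "j < n"
  have "complex_blocks A $$ (i, j) = complex_blocks B $$ (i, j)"
       "complex_blocks A $$ (i, j + n) = complex_blocks B $$ (i, j + n)"
    using eq by simp_all
  then show "A $$ (i, j) = B $$ (i, j)"
    using A B ij by (simp add: complex_blocks_def four_block_mat_def Let_def qc1_def qc2_def quat_eq_iff)
qed (use A B in auto)

lemma quat_mat_left_right_inverse:
  fixes A B :: "quat mat"
  assumes A: "A \<in> carrier_mat n n" and B: "B \<in> carrier_mat n n" and AB: "A * B = 1\<^sub>m n"
  shows "B * A = 1\<^sub>m n"
proof -
  have c: "complex_blocks X \<in> carrier_mat (n + n) (n + n)" if "X \<in> carrier_mat n n" for X
    using that by (auto simp: complex_blocks_def)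
  have "complex_blocks B * complex_blocks A = 1\<^sub>m (n + n)"
    using AB complex_blocks_mult[OF A B] complex_blocks_one[of n]
    by - (rule mat_mult_left_right_inverse[OF c[OF A] c[OF B]], simp)
  then have "complex_blocks (B * A) = complex_blocks (1\<^sub>m n)"
    by (simp add: complex_blocks_mult[OF B A] complex_blocks_one)
  then show ?thesis
    by (rule complex_blocks_inject[rotated 2]) (use A B in auto)
qed

section \<open>Scalars, adjoints and the Lorentz form\<close>

text \<open>
  The real numbers, the complex numbers and the quaternions are treated at once, as division algebras
  embedded into the quaternions by \<open>\<phi>\<close>. All rules for the conjugation \<open>cj\<close> are inherited along the
  embedding.
\<close>

locale quat_subfield =
  fixes cj :: "'a::real_normed_div_algebra \<Rightarrow> 'a" and \<phi> :: "'a \<Rightarrow> quat"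
  assumes \<phi>_add: "\<phi> (x + y) = \<phi> x + \<phi> y"
    and \<phi>_mult: "\<phi> (x * y) = \<phi> x * \<phi> y"
    and \<phi>_of_real: "\<phi> (of_real r) = of_real r"
    and \<phi>_norm: "norm (\<phi> x) = norm x"
    and \<phi>_cj: "\<phi> (cj x) = qcnj (\<phi> x)"
begin

lemma \<phi>_0 [simp]: "\<phi> 0 = 0" using \<phi>_of_real[of 0] by simp
lemma \<phi>_1 [simp]: "\<phi> 1 = 1" using \<phi>_of_real[of 1] by simp
lemma \<phi>_minus: "\<phi> (- x) = - \<phi> x"
  using \<phi>_add[of x "- x"] by (simp add: eq_neg_iff_add_eq_0 add.commute)
lemma \<phi>_diff: "\<phi> (x - y) = \<phi> x - \<phi> y"
  using \<phi>_add[of x "- y"] by (simp add: \<phi>_minus)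
lemma \<phi>_sum: "\<phi> (sum f A) = (\<Sum>x\<in>A. \<phi> (f x))"
  by (induction A rule: infinite_finite_induct) (auto simp: \<phi>_add)
lemma \<phi>_eq_iff [simp]: "\<phi> x = \<phi> y \<longleftrightarrow> x = y"
proof
  assume "\<phi> x = \<phi> y"
  then have "norm (\<phi> (x - y)) = 0" by (simp add: \<phi>_diff)
  then show "x = y" by (simp add: \<phi>_norm)
qed simp

lemma cj_add: "cj (x + y) = cj x + cj y"
  and cj_mult: "cj (x * y) = cj y * cj x"
  and cj_cj [simp]: "cj (cj x) = x"
  and cj_of_real [simp]: "cj (of_real r) = of_real r"
  and cj_0 [simp]: "cj 0 = 0"
  and cj_1 [simp]: "cj 1 = 1"
  and cj_minus: "cj (- x) = - cj x"
  and cj_diff: "cj (x - y) = cj x - cj y"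
  unfolding \<phi>_eq_iff[symmetric]
  by (simp_all add: \<phi>_cj \<phi>_add \<phi>_mult \<phi>_minus \<phi>_diff \<phi>_of_real quat_eq_iff quat_sel_mult)
lemma norm_cj [simp]: "norm (cj x) = norm x"
  by (simp add: \<phi>_norm[symmetric] \<phi>_cj norm_quat_def)
lemma cj_mult_self: "cj x * x = of_real ((norm x)\<^sup>2)" "x * cj x = of_real ((norm x)\<^sup>2)"
  unfolding \<phi>_eq_iff[symmetric] \<phi>_mult \<phi>_cj \<phi>_of_real \<phi>_norm[symmetric] qcnj_mult_self by simp_all
lemma cj_sum: "cj (sum f A) = (\<Sum>x\<in>A. cj (f x))"
  by (induction A rule: infinite_finite_induct) (auto simp: cj_add)

lemma map_\<phi>_mult:
  assumes A: "A \<in> carrier_mat n m" and B: "B \<in> carrier_mat m l"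
  shows "map_mat \<phi> (A * B) = map_mat \<phi> A * map_mat \<phi> B"
proof (rule mat_eqI[where n="n" and m="l"])
  fix i j assume ij: "i < n" "j < l"
  show "map_mat \<phi> (A * B) $$ (i, j) = (map_mat \<phi> A * map_mat \<phi> B) $$ (i, j)"
    using A B ij mat_mult_index[OF A B ij] mat_mult_index[OF map_carrier_mat[THEN iffD2, OF A, of \<phi>] map_carrier_mat[THEN iffD2, OF B, of \<phi>] ij]
    by (simp add: \<phi>_sum \<phi>_mult)
qed (use A B in auto)

lemma map_\<phi>_one [simp]: "map_mat \<phi> (1\<^sub>m n) = 1\<^sub>m n"
  by (rule eq_matI) auto

lemma map_\<phi>_eq_iff: "map_mat \<phi> A = map_mat \<phi> B \<longleftrightarrow> A = B"
proof
  assume eq: "map_mat \<phi> A = map_mat \<phi> B"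
  have dims: "dim_row A = dim_row B" "dim_col A = dim_col B"
    using arg_cong[OF eq, of dim_row] arg_cong[OF eq, of dim_col] by auto
  show "A = B"
  proof (rule eq_matI)
    fix i j assume "i < dim_row B" "j < dim_col B"
    then show "A $$ (i, j) = B $$ (i, j)"
      using arg_cong[OF eq, of "\<lambda>M. M $$ (i, j)"] dims by simp
  qed (use dims in auto)
qed simp

lemma map_\<phi>_lorentz_form [simp]: "map_mat \<phi> (lorentz_form k) = lorentz_form k"
  by (rule eq_matI) (auto simp: lorentz_form_def \<phi>_minus)

lemma map_\<phi>_adjoint: "map_mat \<phi> (adjoint_mat cj A) = adjoint_mat qcnj (map_mat \<phi> A)"
  by (rule eq_matI) (auto simp: adjoint_mat_def \<phi>_cj)

lemma left_right_inverse:
  fixes A B :: "'a mat"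
  assumes A: "A \<in> carrier_mat n n" and B: "B \<in> carrier_mat n n" and AB: "A * B = 1\<^sub>m n"
  shows "B * A = 1\<^sub>m n"
proof -
  have "map_mat \<phi> B * map_mat \<phi> A = 1\<^sub>m n"
    using A B AB by - (rule quat_mat_left_right_inverse, auto simp: map_\<phi>_mult[OF A B, symmetric])
  then show ?thesis
    using map_\<phi>_mult[OF B A] map_\<phi>_eq_iff[of "B * A" "1\<^sub>m n"] by simp
qed

lemma adjoint_carrier [simp]: "adjoint_mat cj A \<in> carrier_mat n m \<longleftrightarrow> A \<in> carrier_mat m n"
  by (auto simp: adjoint_mat_def)

lemma adjoint_index: "A \<in> carrier_mat n m \<Longrightarrow> i < m \<Longrightarrow> j < n \<Longrightarrow> adjoint_mat cj A $$ (i, j) = cj (A $$ (j, i))"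
  by (simp add: adjoint_mat_def)

lemma adjoint_adjoint [simp]: "adjoint_mat cj (adjoint_mat cj A) = A"
  by (rule eq_matI) (auto simp: adjoint_mat_def)

lemma adjoint_mult:
  assumes A: "A \<in> carrier_mat n m" and B: "B \<in> carrier_mat m l"
  shows "adjoint_mat cj (A * B) = adjoint_mat cj B * adjoint_mat cj A"
proof (rule mat_eqI[where n="l" and m="n"])
  fix i j assume ij: "i < l" "j < n"
  have AB: "A * B \<in> carrier_mat n l" using A B by auto
  have "adjoint_mat cj (A * B) $$ (i, j) = (\<Sum>x<m. cj (B $$ (x, i)) * cj (A $$ (j, x)))"
    using adjoint_index[OF AB ij] mat_mult_index[OF A B ij(2,1)] by (simp add: cj_sum cj_mult)
  also have "\<dots> = (adjoint_mat cj B * adjoint_mat cj A) $$ (i, j)"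
    using ij by (subst mat_mult_index[where n=l and m=m and l=n])
      (auto simp: A B adjoint_index[OF A] adjoint_index[OF B])
  finally show "adjoint_mat cj (A * B) $$ (i, j) = \<dots>" .
qed (use A B in \<open>auto simp: adjoint_mat_def\<close>)

lemma adjoint_one [simp]: "adjoint_mat cj (1\<^sub>m n) = 1\<^sub>m n"
  by (rule eq_matI) (auto simp: adjoint_mat_def)

lemma adjoint_lorentz_form [simp]: "adjoint_mat cj (lorentz_form k) = lorentz_form k"
  by (rule eq_matI) (auto simp: adjoint_mat_def lorentz_form_def cj_minus)

end

lemma lorentz_form_carrier [simp]: "lorentz_form k \<in> carrier_mat (k + 1) (k + 1)"
  "lorentz_form k \<in> carrier_mat (Suc k) (Suc k)"
  by (auto simp: lorentz_form_def)

lemma lorentz_form_mult_index: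
  fixes A :: "'a::ring_1 mat"
  assumes "A \<in> carrier_mat (k + 1) m" "i < k + 1" "j < m"
  shows "(lorentz_form k * A) $$ (i, j) = (if i = 0 then A $$ (i, j) else - A $$ (i, j))"
  using assms by (subst mat_mult_index[where n="k+1" and m="k+1" and l=m])
    (auto simp: lorentz_form_def if_distrib[where f="\<lambda>u. u * _"] cong: if_cong)

lemma mult_lorentz_form_index:
  fixes A :: "'a::ring_1 mat"
  assumes "A \<in> carrier_mat m (k + 1)" "i < m" "j < k + 1"
  shows "(A * lorentz_form k) $$ (i, j) = (if j = 0 then A $$ (i, j) else - A $$ (i, j))"
  using assms by (subst mat_mult_index[where n=m and m="k+1" and l="k+1"])
    (auto simp: lorentz_form_def if_distrib[where f="\<lambda>u. _ * u"] cong: if_cong)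

lemma lorentz_form_square: "lorentz_form k * lorentz_form k = (1\<^sub>m (k + 1) :: 'a::ring_1 mat)"
proof (rule mat_eqI[where n="k + 1" and m="k + 1"])
  fix i j assume ij: "i < k + 1" "j < k + 1"
  show "(lorentz_form k * lorentz_form k) $$ (i, j) = (1\<^sub>m (k+1) :: 'a mat) $$ (i, j)"
    unfolding lorentz_form_mult_index[OF lorentz_form_carrier(1) ij]
    using ij by (simp add: lorentz_form_def)
qed (simp_all add: square_mult_carrier)

section \<open>Elementary matrices and block matrices\<close>

text \<open>
  The identity except in the coordinates \<open>p\<close> and \<open>q\<close>, where it acts by the \<open>2 \<times> 2\<close> matrix with rows
  \<open>(a, b)\<close> and \<open>(c, d)\<close>. Boosts \<open>a\<^sub>t\<close> and rotations in coordinate planes both have this form.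
\<close>

definition plane_mat :: "nat \<Rightarrow> nat \<Rightarrow> nat \<Rightarrow> 'a \<Rightarrow> 'a \<Rightarrow> 'a \<Rightarrow> 'a \<Rightarrow> 'a::ring_1 mat" where
  "plane_mat n p q a b c d = Matrix.mat n n (\<lambda>(i, j).
     if i = p then (if j = p then a else if j = q then b else 0)
     else if i = q then (if j = p then c else if j = q then d else 0)
     else if i = j then 1 else 0)"

lemma plane_mat_carrier [simp]: "plane_mat n p q a b c d \<in> carrier_mat n n"
  by (simp add: plane_mat_def)

lemma plane_mat_mult_index:
  assumes A: "A \<in> carrier_mat n m" and pq: "p \<noteq> q" "p < n" "q < n" and ij: "i < n" "j < m"
  shows "(plane_mat n p q a b c d * A) $$ (i, j) =
    (if i = p then a * A $$ (p, j) + b * A $$ (q, j)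
     else if i = q then c * A $$ (p, j) + d * A $$ (q, j) else A $$ (i, j))"
proof -
  have two: "(\<Sum>x<n. (if x = p then u else if x = q then v else 0) * A $$ (x, j)) = u * A $$ (p, j) + v * A $$ (q, j)" for u v
  proof -
    have "(\<Sum>x<n. (if x = p then u else if x = q then v else 0) * A $$ (x, j)) =
      (\<Sum>x<n. (if x = p then u * A $$ (p, j) else 0) + (if x = q then v * A $$ (q, j) else 0))"
      by (rule sum.cong) (use pq in auto)
    then show ?thesis using pq by (simp add: sum.distrib)
  qed
  have one: "(\<Sum>x<n. (if x = i then 1 else 0) * A $$ (x, j)) = A $$ (i, j)"
  proof -
    have "(\<Sum>x<n. (if x = i then 1 else 0) * A $$ (x, j)) = (\<Sum>x<n. if x = i then A $$ (i, j) else 0)"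
      by (rule sum.cong) auto
    then show ?thesis using ij by simp
  qed
  have "(plane_mat n p q a b c d * A) $$ (i, j) = (\<Sum>x<n. plane_mat n p q a b c d $$ (i, x) * A $$ (x, j))"
    by (rule mat_mult_index[OF plane_mat_carrier A ij])
  also have "\<dots> = (if i = p then (\<Sum>x<n. (if x = p then a else if x = q then b else 0) * A $$ (x, j))
     else if i = q then (\<Sum>x<n. (if x = p then c else if x = q then d else 0) * A $$ (x, j))
     else (\<Sum>x<n. (if x = i then 1 else 0) * A $$ (x, j)))"
    using pq ij by (auto simp: plane_mat_def intro!: sum.cong)
  finally show ?thesis by (simp add: two one)
qed

lemma plane_mat_mult:
  assumes pq: "p \<noteq> q" "p < n" "q < n"
  shows "plane_mat n p q a b c d * plane_mat n p q a' b' c' d' =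
    plane_mat n p q (a * a' + b * c') (a * b' + b * d') (c * a' + d * c') (c * b' + d * d')"
proof (rule mat_eqI[where n="n" and m="n"])
  fix i j assume ij: "i < n" "j < n"
  show "(plane_mat n p q a b c d * plane_mat n p q a' b' c' d') $$ (i, j) =
    plane_mat n p q (a * a' + b * c') (a * b' + b * d') (c * a' + d * c') (c * b' + d * d') $$ (i, j)"
    unfolding plane_mat_mult_index[OF plane_mat_carrier pq ij]
    using pq ij by (simp add: plane_mat_def)
qed (simp_all add: square_mult_carrier)

lemma plane_mat_one:
  assumes "p \<noteq> q"
  shows "plane_mat n p q 1 0 0 1 = (1\<^sub>m n :: 'a::ring_1 mat)"
proof (rule eq_matI)
  fix i j assume "i < dim_row (1\<^sub>m n :: 'a mat)" "j < dim_col (1\<^sub>m n :: 'a mat)"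
  then show "plane_mat n p q 1 0 0 1 $$ (i, j) = (1\<^sub>m n :: 'a mat) $$ (i, j)"
    using assms by (simp add: plane_mat_def)
qed (simp_all add: plane_mat_def)

definition boost :: "nat \<Rightarrow> real \<Rightarrow> 'a::real_normed_div_algebra mat" where
  "boost k t = plane_mat (k + 1) 0 k (of_real (cosh t)) (of_real (sinh t)) (of_real (sinh t)) (of_real (cosh t))"

lemma boost_carrier [simp]: "boost k t \<in> carrier_mat (k + 1) (k + 1)"
  by (simp add: boost_def)

lemma hyp_a_boost: "k \<ge> 1 \<Longrightarrow> hyp_a k t = boost k t"
  by (rule eq_matI) (auto simp: hyp_a_def boost_def plane_mat_def)

lemma boost_add:
  assumes "k \<ge> 1"
  shows "boost k (s + t) = (boost k s * boost k t :: 'a::real_normed_div_algebra mat)"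
proof -
  have "(boost k s * boost k t :: 'a mat) = plane_mat (k + 1) 0 k (of_real (cosh (s + t))) (of_real (sinh (s + t)))
      (of_real (sinh (s + t))) (of_real (cosh (s + t)))"
    unfolding boost_def using assms
    by (subst plane_mat_mult) (simp_all add: cosh_add sinh_add algebra_simps of_real_mult[symmetric] of_real_add[symmetric] del: of_real_mult of_real_add)
  then show ?thesis by (simp add: boost_def)
qed

lemma boost_0: "k \<ge> 1 \<Longrightarrow> boost k 0 = 1\<^sub>m (k + 1)"
  by (simp add: boost_def plane_mat_one)

definition rotation :: "nat \<Rightarrow> nat \<Rightarrow> nat \<Rightarrow> real \<Rightarrow> 'a::real_normed_div_algebra mat" where
  "rotation k p q \<theta> = plane_mat (k + 1) p q (of_real (cos \<theta>)) (- of_real (sin \<theta>)) (of_real (sin \<theta>)) (of_real (cos \<theta>))"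

lemma rotation_carrier [simp]: "rotation k p q \<theta> \<in> carrier_mat (k + 1) (k + 1)"
  by (simp add: rotation_def)

lemma rotation_add:
  assumes "p \<noteq> q" "p \<le> k" "q \<le> k"
  shows "rotation k p q (s + t) = (rotation k p q s * rotation k p q t :: 'a::real_normed_div_algebra mat)"
proof -
  have "(rotation k p q s * rotation k p q t :: 'a mat) = plane_mat (k + 1) p q (of_real (cos (s + t))) (- of_real (sin (s + t)))
      (of_real (sin (s + t))) (of_real (cos (s + t)))"
    unfolding rotation_def using assms
    by (subst plane_mat_mult) (simp_all add: cos_add sin_add algebra_simps of_real_mult[symmetric] of_real_add[symmetric] of_real_minus[symmetric] of_real_diff[symmetric] del: of_real_mult of_real_add of_real_minus of_real_diff)
  then show ?thesis by (simp add: rotation_def)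
qed

lemma rotation_0: "p \<noteq> q \<Longrightarrow> rotation k p q 0 = 1\<^sub>m (k + 1)"
  by (simp add: rotation_def plane_mat_one)

definition phase_diag :: "nat \<Rightarrow> nat \<Rightarrow> 'a \<Rightarrow> 'a::ring_1 mat" where
  "phase_diag n m c = Matrix.mat n n (\<lambda>(i, j). if i = j then (if i = m then c else 1) else 0)"

lemma phase_diag_carrier [simp]: "phase_diag n m c \<in> carrier_mat n n"
  by (simp add: phase_diag_def)

lemma mult_phase_diag_index:
  assumes A: "A \<in> carrier_mat l n" and ij: "i < l" "j < n"
  shows "(A * phase_diag n m c) $$ (i, j) = A $$ (i, j) * (if j = m then c else 1)"
proof -
  have "(A * phase_diag n m c) $$ (i, j) = (\<Sum>x<n. A $$ (i, x) * phase_diag n m c $$ (x, j))"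
    by (rule mat_mult_index[OF A phase_diag_carrier ij])
  also have "\<dots> = (\<Sum>x<n. if x = j then A $$ (i, j) * (if j = m then c else 1) else 0)"
    by (rule sum.cong) (use ij in \<open>auto simp: phase_diag_def\<close>)
  finally show ?thesis using ij by simp
qed

lemma block_diag_index:
  assumes "A \<in> carrier_mat 1 1" "B \<in> carrier_mat k k"
  shows "block_diag A B $$ (0, 0) = A $$ (0, 0)"
    "i < k \<Longrightarrow> block_diag A B $$ (Suc i, 0) = 0"
    "j < k \<Longrightarrow> block_diag A B $$ (0, Suc j) = 0"
    "i < k \<Longrightarrow> j < k \<Longrightarrow> block_diag A B $$ (Suc i, Suc j) = B $$ (i, j)"
  using assms by (auto simp: block_diag_def four_block_mat_def Let_def)

lemma block_diag_carrier: "A \<in> carrier_mat 1 1 \<Longrightarrow> B \<in> carrier_mat k k \<Longrightarrow> block_diag A B \<in> carrier_mat (k + 1) (k + 1)"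
  by (auto simp: block_diag_def)

context quat_subfield
begin

lemma adjoint_mult_index:
  assumes "A \<in> carrier_mat n n" "B \<in> carrier_mat n n" "i < n" "j < n"
  shows "(adjoint_mat cj A * B) $$ (i, j) = (\<Sum>x<n. cj (A $$ (x, i)) * B $$ (x, j))"
  using assms by (subst mat_mult_index[where n=n and m=n and l=n]) (auto simp: adjoint_index[where n=n and m=n])

lemma unitary_mats_iff:
  "A \<in> unitary_mats cj n \<longleftrightarrow> A \<in> carrier_mat n n \<and>
    (\<forall>i<n. \<forall>j<n. (\<Sum>x<n. cj (A $$ (x, i)) * A $$ (x, j)) = (if i = j then 1 else 0))"
proof (cases "A \<in> carrier_mat n n")
  case True
  have "A \<in> unitary_mats cj n \<longleftrightarrow> (\<forall>i<n. \<forall>j<n. (adjoint_mat cj A * A) $$ (i, j) = 1\<^sub>m n $$ (i, j))"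
  proof
    assume "\<forall>i<n. \<forall>j<n. (adjoint_mat cj A * A) $$ (i, j) = 1\<^sub>m n $$ (i, j)"
    then have "adjoint_mat cj A * A = 1\<^sub>m n"
      using True by (intro eq_matI) (auto simp: adjoint_mat_def)
    then show "A \<in> unitary_mats cj n" using True by (simp add: unitary_mats_def)
  qed (auto simp: unitary_mats_def)
  then show ?thesis using True by (simp add: adjoint_mult_index[OF True True] del: index_mult_mat(1))
qed (auto simp: unitary_mats_def)

lemma lorentz_form_entry:
  assumes A: "A \<in> carrier_mat (k + 1) (k + 1)" and B: "B \<in> carrier_mat (k + 1) (k + 1)" and ij: "i < k + 1" "j < k + 1"
  shows "(adjoint_mat cj A * lorentz_form k * B) $$ (i, j) =
    cj (A $$ (0, i)) * B $$ (0, j) - (\<Sum>l<k. cj (A $$ (Suc l, i)) * B $$ (Suc l, j))"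
proof -
  have J: "lorentz_form k * B \<in> carrier_mat (k + 1) (k + 1)" using B lorentz_form_carrier(1) by (rule square_mult_carrier[rotated])
  have "(adjoint_mat cj A * lorentz_form k * B) $$ (i, j) = (adjoint_mat cj A * (lorentz_form k * B)) $$ (i, j)"
    by (subst assoc_mult_mat[where ?n\<^sub>1="k+1" and ?n\<^sub>2="k+1" and ?n\<^sub>3="k+1" and ?n\<^sub>4="k+1"]) (use A B in simp_all)
  also have "\<dots> = (\<Sum>x<k+1. cj (A $$ (x, i)) * (lorentz_form k * B) $$ (x, j))"
    by (rule adjoint_mult_index[OF A J ij])
  also have "\<dots> = (\<Sum>x<k+1. cj (A $$ (x, i)) * (if x = 0 then B $$ (x, j) else - B $$ (x, j)))"
    by (rule sum.cong) (use lorentz_form_mult_index[OF B _ ij(2)] in auto)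
  finally show ?thesis by (simp add: sum.lessThan_Suc_shift sum_negf del: sum.lessThan_Suc)
qed

lemma lorentz_mats_iff:
  "A \<in> lorentz_mats cj k \<longleftrightarrow> A \<in> carrier_mat (k + 1) (k + 1) \<and>
    (\<forall>i<k+1. \<forall>j<k+1. cj (A $$ (0, i)) * A $$ (0, j) - (\<Sum>l<k. cj (A $$ (Suc l, i)) * A $$ (Suc l, j))
      = (if i = j then (if i = 0 then 1 else - 1) else 0))"
proof (cases "A \<in> carrier_mat (k + 1) (k + 1)")
  case True
  have "A \<in> lorentz_mats cj k \<longleftrightarrow> (\<forall>i<k+1. \<forall>j<k+1. (adjoint_mat cj A * lorentz_form k * A) $$ (i, j) = lorentz_form k $$ (i, j))"
  proof
    assume "\<forall>i<k+1. \<forall>j<k+1. (adjoint_mat cj A * lorentz_form k * A) $$ (i, j) = lorentz_form k $$ (i, j)"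
    then have "adjoint_mat cj A * lorentz_form k * A = lorentz_form k"
      using True by (intro eq_matI) (auto simp: adjoint_mat_def lorentz_form_def)
    then show "A \<in> lorentz_mats cj k" using True by (simp add: lorentz_mats_def)
  qed (auto simp: lorentz_mats_def)
  also have "\<dots> \<longleftrightarrow> (\<forall>i<k+1. \<forall>j<k+1. cj (A $$ (0, i)) * A $$ (0, j) - (\<Sum>l<k. cj (A $$ (Suc l, i)) * A $$ (Suc l, j))
      = (if i = j then (if i = 0 then 1 else - 1) else 0))"
    by (intro all_cong) (simp only: lorentz_form_entry[OF True True], simp add: lorentz_form_def)
  finally show ?thesis using True by blast
qed (auto simp: lorentz_mats_def)

lemma unitary_matsD:
  assumes "A \<in> unitary_mats cj n"
  shows "A \<in> carrier_mat n n" "adjoint_mat cj A * A = 1\<^sub>m n" "A * adjoint_mat cj A = 1\<^sub>m n"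
proof -
  show *: "A \<in> carrier_mat n n" "adjoint_mat cj A * A = 1\<^sub>m n" using assms by (auto simp: unitary_mats_def)
  show "A * adjoint_mat cj A = 1\<^sub>m n" by (rule left_right_inverse[OF _ _ *(2)]) (use * in auto)
qed

lemma adjoint_form_mult:
  assumes g: "g \<in> carrier_mat n n" and y: "y \<in> carrier_mat n n" and x: "x \<in> carrier_mat n n"
    and J: "J \<in> carrier_mat n n" and J': "adjoint_mat cj g * J * g = J'"
  shows "adjoint_mat cj (g * y) * J * (g * x) = adjoint_mat cj y * J' * x"
proof -
  note s = square_mult_carrier
  have a: "adjoint_mat cj y \<in> carrier_mat n n" "adjoint_mat cj g \<in> carrier_mat n n" using y g by auto
  note gJ = s[OF a(2) J]
  have "adjoint_mat cj (g * y) * J * (g * x) = adjoint_mat cj y * (adjoint_mat cj g * J * (g * x))"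
    unfolding adjoint_mult[OF g y] assoc_mult_mat[OF a J] by (rule assoc_mult_mat[OF a(1) gJ s[OF g x]])
  also have "\<dots> = adjoint_mat cj y * (J' * x)"
    unfolding J'[symmetric] assoc_mult_mat[OF gJ g x] ..
  also have "\<dots> = adjoint_mat cj y * J' * x"
    unfolding J'[symmetric] by (rule assoc_mult_mat[OF a(1) s[OF gJ g] x, symmetric])
  finally show ?thesis .
qed

lemma unitary_mult:
  assumes A: "A \<in> unitary_mats cj n" and B: "B \<in> unitary_mats cj n"
  shows "A * B \<in> unitary_mats cj n"
proof -
  note c = unitary_matsD(1)[OF A] unitary_matsD(1)[OF B]
  have one: "adjoint_mat cj X * 1\<^sub>m n = adjoint_mat cj X" if "X \<in> carrier_mat n n" for X
    by (rule right_mult_one_mat) (use that in simp)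
  show ?thesis
    using adjoint_form_mult[OF c c(2) one_carrier_mat, of "1\<^sub>m n"] unitary_matsD(2)[OF A] unitary_matsD(2)[OF B]
      square_mult_carrier[OF c] by (simp add: unitary_mats_def one c)
qed

lemma unitary_adjoint:
  assumes A: "A \<in> unitary_mats cj n"
  shows "adjoint_mat cj A \<in> unitary_mats cj n"
  using unitary_matsD(1,3)[OF A] by (simp add: unitary_mats_def)

lemma unitary_one: "1\<^sub>m n \<in> unitary_mats cj n"
  by (simp add: unitary_mats_def)

text \<open>
  If \<open>A\<close> preserves the form \<open>J\<close>, then \<open>J A\<^sup>* J\<close> is its inverse.
\<close>

definition lorentz_inv :: "nat \<Rightarrow> 'a mat \<Rightarrow> 'a mat" where
  "lorentz_inv k A = lorentz_form k * adjoint_mat cj A * lorentz_form k"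

lemma lorentz_matsD:
  assumes "A \<in> lorentz_mats cj k"
  shows "A \<in> carrier_mat (k + 1) (k + 1)" "adjoint_mat cj A * lorentz_form k * A = lorentz_form k"
  using assms by (auto simp: lorentz_mats_def)

lemma lorentz_mult:
  assumes A: "A \<in> lorentz_mats cj k" and B: "B \<in> lorentz_mats cj k"
  shows "A * B \<in> lorentz_mats cj k"
proof -
  note c = lorentz_matsD(1)[OF A] lorentz_matsD(1)[OF B]
  show ?thesis
    using adjoint_form_mult[OF c c(2) lorentz_form_carrier(1) lorentz_matsD(2)[OF A]] lorentz_matsD(2)[OF B]
      square_mult_carrier[OF c] by (simp add: lorentz_mats_def)
qed

lemma lorentz_one: "1\<^sub>m (k + 1) \<in> lorentz_mats cj k"
  by (simp add: lorentz_mats_def right_mult_one_mat[OF lorentz_form_carrier(1)] left_mult_one_mat[OF lorentz_form_carrier(1)] del: One_nat_def)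

lemma lorentz_inv_mult:
  assumes A: "A \<in> lorentz_mats cj k"
  shows "lorentz_inv k A \<in> carrier_mat (k + 1) (k + 1)" "lorentz_inv k A * A = 1\<^sub>m (k + 1)" "A * lorentz_inv k A = 1\<^sub>m (k + 1)"
proof -
  let ?J = "lorentz_form k :: 'a mat" and ?n = "k + 1"
  note c = lorentz_matsD(1)[OF A]
  note s = square_mult_carrier
  have a: "adjoint_mat cj A \<in> carrier_mat ?n ?n" "?J \<in> carrier_mat ?n ?n" using c by auto
  show i: "lorentz_inv k A \<in> carrier_mat ?n ?n" unfolding lorentz_inv_def by (intro s a)
  have "lorentz_inv k A * A = ?J * (adjoint_mat cj A * ?J) * A"
    unfolding lorentz_inv_def by (simp add: assoc_mult_mat[OF a(2,1,2)])
  also have "\<dots> = ?J * (adjoint_mat cj A * ?J * A)" by (rule assoc_mult_mat[OF a(2) s[OF a] c])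
  also have "\<dots> = 1\<^sub>m ?n" using lorentz_matsD(2)[OF A] lorentz_form_square[of k] by simp
  finally show l: "lorentz_inv k A * A = 1\<^sub>m ?n" .
  show "A * lorentz_inv k A = 1\<^sub>m ?n" by (rule left_right_inverse[OF i c l])
qed

text \<open>
  The right inverse \<open>A J A\<^sup>* J = 1\<close> says that \<open>A\<^sup>*\<close> preserves \<open>J\<close>; this turns statements about columns
  into statements about rows.
\<close>

lemma lorentz_adjoint:
  assumes A: "A \<in> lorentz_mats cj k"
  shows "adjoint_mat cj A \<in> lorentz_mats cj k"
proof -
  let ?J = "lorentz_form k :: 'a mat" and ?n = "k + 1"
  note c = lorentz_matsD(1)[OF A]
  note s = square_mult_carrier
  have a: "adjoint_mat cj A \<in> carrier_mat ?n ?n" "?J \<in> carrier_mat ?n ?n" using c by auto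
  have "A * ?J * adjoint_mat cj A = A * (?J * adjoint_mat cj A)" by (rule assoc_mult_mat[OF c a(2,1)])
  also have "\<dots> = A * (?J * adjoint_mat cj A * (?J * ?J))"
    using right_mult_one_mat[OF s[OF a(2,1)]] lorentz_form_square[of k, where ?'a='a] by simp
  also have "?J * adjoint_mat cj A * (?J * ?J) = lorentz_inv k A * ?J"
    unfolding lorentz_inv_def by (rule assoc_mult_mat[OF s[OF a(2,1)] a(2) a(2), symmetric])
  also have "A * (lorentz_inv k A * ?J) = A * lorentz_inv k A * ?J"
    by (rule assoc_mult_mat[OF c lorentz_inv_mult(1)[OF A] a(2), symmetric])
  also have "\<dots> = ?J" using lorentz_inv_mult(3)[OF A] left_mult_one_mat[OF a(2)] by simp
  finally show ?thesis using a by (simp add: lorentz_mats_def)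
qed

lemma lorentz_form_in_lorentz: "lorentz_form k \<in> lorentz_mats cj k"
  by (simp add: lorentz_mats_def lorentz_form_square left_mult_one_mat[OF lorentz_form_carrier(1)] del: One_nat_def)

lemma lorentz_inv_in_lorentz: "A \<in> lorentz_mats cj k \<Longrightarrow> lorentz_inv k A \<in> lorentz_mats cj k"
  unfolding lorentz_inv_def by (intro lorentz_mult lorentz_form_in_lorentz lorentz_adjoint)

text \<open>
  \<open>U(1) \<times> U(k)\<close> inside \<open>U(1,k)\<close>: a unitary matrix is block diagonal precisely if it preserves the
  Lorentz form as well. In this form closure under products and adjoints is immediate.
\<close>

definition stabilizer :: "nat \<Rightarrow> 'a mat set" where
  "stabilizer k = unitary_mats cj (k + 1) \<inter> lorentz_mats cj k"

lemma stabilizer_mult: "A \<in> stabilizer k \<Longrightarrow> B \<in> stabilizer k \<Longrightarrow> A * B \<in> stabilizer k"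
  and stabilizer_adjoint: "A \<in> stabilizer k \<Longrightarrow> adjoint_mat cj A \<in> stabilizer k"
  and stabilizer_one: "1\<^sub>m (k + 1) \<in> stabilizer k"
  unfolding stabilizer_def by (blast intro: unitary_mult lorentz_mult unitary_adjoint lorentz_adjoint unitary_one lorentz_one)+

text \<open>
  Adding and subtracting the unitary and the Lorentz relation of a column isolates its entry of
  index 0 and the norm of the rest.
\<close>

lemma stabilizer_entries:
  assumes M: "M \<in> stabilizer k"
  shows "norm (M $$ (0, 0)) = 1" "\<And>i. i < k \<Longrightarrow> M $$ (Suc i, 0) = 0" "\<And>i. i < k \<Longrightarrow> M $$ (0, Suc i) = 0"
proof -
  have U: "cj (M $$ (0, i)) * M $$ (0, i) + (\<Sum>l<k. cj (M $$ (Suc l, i)) * M $$ (Suc l, i)) = 1" if "i < k + 1" for i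
    using M that by (simp add: stabilizer_def unitary_mats_iff sum.lessThan_Suc_shift del: sum.lessThan_Suc)
  have L: "cj (M $$ (0, i)) * M $$ (0, i) - (\<Sum>l<k. cj (M $$ (Suc l, i)) * M $$ (Suc l, i)) = (if i = 0 then 1 else -1)" if "i < k + 1" for i
    using M that by (simp add: stabilizer_def lorentz_mats_iff)
  have U': "(norm (M $$ (0, i)))\<^sup>2 + (\<Sum>l<k. (norm (M $$ (Suc l, i)))\<^sup>2) = 1" if "i < k + 1" for i
    using U[OF that] unfolding cj_mult_self of_real_sum[symmetric] of_real_add[symmetric] of_real_eq_1_iff .
  have L': "(norm (M $$ (0, i)))\<^sup>2 - (\<Sum>l<k. (norm (M $$ (Suc l, i)))\<^sup>2) = (if i = 0 then 1 else -1)" if "i < k + 1" for i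
  proof -
    have "(of_real ((norm (M $$ (0, i)))\<^sup>2 - (\<Sum>l<k. (norm (M $$ (Suc l, i)))\<^sup>2)) :: 'a) = of_real (if i = 0 then 1 else -1)"
      using L[OF that] unfolding cj_mult_self of_real_sum[symmetric] of_real_diff[symmetric] by simp
    then show ?thesis by (simp only: of_real_eq_iff)
  qed
  have 0: "(norm (M $$ (0, 0)))\<^sup>2 = 1" "(\<Sum>l<k. (norm (M $$ (Suc l, 0)))\<^sup>2) = 0"
    using U'[of 0] L'[of 0] by auto
  show "norm (M $$ (0, 0)) = 1" using 0(1) norm_ge_zero[of "M $$ (0,0)"] by (simp add: power2_eq_1_iff)
  show "M $$ (Suc i, 0) = 0" if "i < k" for i
    using 0(2) that by (simp add: sum_nonneg_eq_0_iff)
  show "M $$ (0, Suc i) = 0" if "i < k" for i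
  proof -
    have i: "Suc i < k + 1" using that by simp
    have "(norm (M $$ (0, Suc i)))\<^sup>2 - (\<Sum>l<k. (norm (M $$ (Suc l, Suc i)))\<^sup>2) = -1"
      using L'[OF i] by simp
    with U'[OF i] have "(norm (M $$ (0, Suc i)))\<^sup>2 = 0" by linarith
    then show ?thesis by simp
  qed
qed

lemma block_diag_stabilizer:
  assumes A: "A \<in> unitary_mats cj 1" and B: "B \<in> unitary_mats cj k"
  shows "block_diag A B \<in> stabilizer k"
proof -
  note c = unitary_matsD(1)[OF A] unitary_matsD(1)[OF B]
  note ix = block_diag_index[OF c]
  have a: "cj (A $$ (0, 0)) * A $$ (0, 0) = 1" using A by (simp add: unitary_mats_iff)
  have b: "(\<Sum>x<k. cj (B $$ (x, i)) * B $$ (x, j)) = (if i = j then 1 else 0)" if "i < k" "j < k" for i j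
    using B that by (simp add: unitary_mats_iff)
  let ?M = "block_diag A B"
  have entries: "cj (?M $$ (0, i)) * ?M $$ (0, j) = (if i = 0 \<and> j = 0 then 1 else 0)"
    "(\<Sum>l<k. cj (?M $$ (Suc l, i)) * ?M $$ (Suc l, j)) = (if i = 0 \<or> j = 0 then 0 else if i = j then 1 else 0)"
    if "i < k + 1" "j < k + 1" for i j
    using that by (cases i; cases j; simp add: ix a b)+
  show ?thesis
    unfolding stabilizer_def Int_iff unitary_mats_iff lorentz_mats_iff
  proof (intro conjI allI impI block_diag_carrier[OF c])
    fix i j assume ij: "i < k + 1" "j < k + 1"
    show "(\<Sum>x<k+1. cj (?M $$ (x, i)) * ?M $$ (x, j)) = (if i = j then 1 else 0)"
      using entries[OF ij] by (simp add: sum.lessThan_Suc_shift del: sum.lessThan_Suc)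
    show "cj (?M $$ (0, i)) * ?M $$ (0, j) - (\<Sum>l<k. cj (?M $$ (Suc l, i)) * ?M $$ (Suc l, j))
      = (if i = j then if i = 0 then 1 else - 1 else 0)"
      using entries[OF ij] by simp
  qed
qed

lemma stabilizer_block_diag:
  assumes M: "M \<in> stabilizer k"
  obtains A B where "A \<in> unitary_mats cj 1" "B \<in> unitary_mats cj k" "M = block_diag A B" "A $$ (0, 0) = M $$ (0, 0)"
proof
  define A where "A = Matrix.mat 1 1 (\<lambda>_. M $$ (0, 0))"
  define B where "B = Matrix.mat k k (\<lambda>(i, j). M $$ (Suc i, Suc j))"
  note e = stabilizer_entries[OF M]
  have U: "M \<in> carrier_mat (k + 1) (k + 1)"
    "\<And>i j. i < k + 1 \<Longrightarrow> j < k + 1 \<Longrightarrow> (\<Sum>x<k+1. cj (M $$ (x, i)) * M $$ (x, j)) = (if i = j then 1 else 0)"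
    using M unfolding stabilizer_def Int_iff unitary_mats_iff by blast+
  show "A $$ (0, 0) = M $$ (0, 0)" by (simp add: A_def)
  show "A \<in> unitary_mats cj 1"
    using e(1) by (simp add: A_def unitary_mats_iff cj_mult_self)
  show "B \<in> unitary_mats cj k"
    unfolding unitary_mats_iff
  proof (intro conjI allI impI)
    fix i j assume ij: "i < k" "j < k"
    then show "(\<Sum>x<k. cj (B $$ (x, i)) * B $$ (x, j)) = (if i = j then 1 else 0)"
      using U(2)[of "Suc i" "Suc j"] e(3)[OF ij(1)] e(3)[OF ij(2)]
      by (simp add: B_def sum.lessThan_Suc_shift del: sum.lessThan_Suc)
  qed (simp add: B_def)
  have c: "A \<in> carrier_mat 1 1" "B \<in> carrier_mat k k" by (simp_all add: A_def B_def)
  show "M = block_diag A B"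
  proof (rule mat_eqI[where n="k + 1" and m="k + 1"])
    fix i j assume ij: "i < k + 1" "j < k + 1"
    show "M $$ (i, j) = block_diag A B $$ (i, j)"
      using ij e by (cases i; cases j) (simp_all add: block_diag_index[OF c], simp_all add: A_def B_def)
  qed (use U(1) block_diag_carrier[OF c] in auto)
qed

end

section \<open>The Cartan decomposition of unitary Lorentz groups\<close>

text \<open>
  The simplifier rewrites \<open>k + 1\<close> to \<open>Suc k\<close>, so these facts are also needed in that form.
\<close>

lemma lorentz_dims [simp]:
  "dim_row (lorentz_form k) = Suc k" "dim_col (lorentz_form k) = Suc k"
  "boost k t \<in> carrier_mat (Suc k) (Suc k)" "rotation k p q \<theta> \<in> carrier_mat (Suc k) (Suc k)"
  using boost_carrier[of k t] rotation_carrier[of k p q \<theta>] by (simp_all add: lorentz_form_def)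

context quat_subfield
begin

lemma adjoint_plane_mat:
  assumes "p \<noteq> q"
  shows "adjoint_mat cj (plane_mat n p q a b c d) = plane_mat n p q (cj a) (cj c) (cj b) (cj d)"
proof (rule mat_eqI[where n="n" and m="n"])
  fix i j assume ij: "i < n" "j < n"
  show "adjoint_mat cj (plane_mat n p q a b c d) $$ (i, j) = plane_mat n p q (cj a) (cj c) (cj b) (cj d) $$ (i, j)"
    unfolding adjoint_index[OF plane_mat_carrier ij] using ij assms by (simp add: plane_mat_def)
qed (simp_all add: plane_mat_def adjoint_mat_def)

lemma adjoint_boost: "1 \<le> k \<Longrightarrow> adjoint_mat cj (boost k t) = boost k t"
  by (simp add: boost_def adjoint_plane_mat)

lemma adjoint_rotation: "p \<noteq> q \<Longrightarrow> adjoint_mat cj (rotation k p q t) = rotation k p q (- t)"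
  by (simp add: rotation_def adjoint_plane_mat cj_minus)

lemma boost_lorentz:
  assumes k: "1 \<le> k"
  shows "boost k t \<in> lorentz_mats cj k"
proof -
  let ?b = "\<lambda>t. boost k t :: 'a mat" and ?J = "lorentz_form k :: 'a mat" and ?n = "k + 1"
  have b: "?b t \<in> carrier_mat ?n ?n" for t by (rule boost_carrier)
  note J = lorentz_form_carrier(1)[of k, where ?'a='a]
  have "?J * ?b t = ?b (- t) * ?J"
  proof (rule mat_eqI[where n="?n" and m="?n"])
    fix i j assume ij: "i < ?n" "j < ?n"
    show "(?J * ?b t) $$ (i, j) = (?b (- t) * ?J) $$ (i, j)"
      unfolding lorentz_form_mult_index[OF b ij] mult_lorentz_form_index[OF b ij]
      using ij k by (simp add: boost_def plane_mat_def)
  qed (use square_mult_carrier[OF J b] square_mult_carrier[OF b J] in auto)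
  then have "adjoint_mat cj (?b t) * ?J * ?b t = ?b t * (?b (- t) * ?J)"
    unfolding adjoint_boost[OF k] assoc_mult_mat[OF b J b] by simp
  also have "\<dots> = ?b (t + - t) * ?J"
    unfolding boost_add[OF k] by (rule assoc_mult_mat[OF b b J, symmetric])
  also have "\<dots> = ?J" using boost_0[OF k, where ?'a='a] left_mult_one_mat[OF J] by simp
  finally show ?thesis by (simp add: lorentz_mats_def)
qed

lemma rotation_stabilizer:
  assumes pq: "p \<noteq> q" "1 \<le> p" "p \<le> k" "1 \<le> q" "q \<le> k"
  shows "rotation k p q t \<in> stabilizer k"
proof -
  let ?R = "rotation k p q t :: 'a mat" and ?J = "lorentz_form k :: 'a mat" and ?n = "k + 1"
  have R: "?R \<in> carrier_mat ?n ?n" and J: "?J \<in> carrier_mat ?n ?n"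
    by (rule rotation_carrier, rule lorentz_form_carrier)
  have A: "adjoint_mat cj ?R \<in> carrier_mat ?n ?n" unfolding adjoint_carrier by (rule R)
  have u: "adjoint_mat cj ?R * ?R = 1\<^sub>m ?n"
    using pq rotation_add[of p q k "- t" t, where ?'a='a] rotation_0[of p q k, where ?'a='a] by (simp add: adjoint_rotation)
  have "?J * ?R = ?R * ?J"
  proof (rule mat_eqI[where n="?n" and m="?n"])
    fix i j assume ij: "i < ?n" "j < ?n"
    show "(?J * ?R) $$ (i, j) = (?R * ?J) $$ (i, j)"
      unfolding lorentz_form_mult_index[OF R ij] mult_lorentz_form_index[OF R ij]
      using ij pq by (simp add: rotation_def plane_mat_def)
  qed (use carrier_matD[OF R] in auto)
  then have "adjoint_mat cj ?R * ?J * ?R = adjoint_mat cj ?R * (?R * ?J)"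
    using assoc_mult_mat[OF A J R] by simp
  also have "\<dots> = ?J" using assoc_mult_mat[OF A R J] u left_mult_one_mat[OF J] by simp
  finally show ?thesis using R u by (simp add: stabilizer_def lorentz_mats_def unitary_mats_def)
qed

text \<open>
  A Lorentz transformation that fixes the vector \<open>e\<^sub>0\<close> preserves its orthogonal complement, on which
  the form is definite.
\<close>

lemma lorentz_first_column_stabilizer:
  assumes r: "r \<in> lorentz_mats cj k" and r0: "r $$ (0, 0) = 1" and r1: "\<And>i. i < k \<Longrightarrow> r $$ (Suc i, 0) = 0"
  shows "r \<in> stabilizer k"
proof -
  have c: "r \<in> carrier_mat (k + 1) (k + 1)" and L: "\<And>i j. i < k + 1 \<Longrightarrow> j < k + 1 \<Longrightarrow>
      cj (r $$ (0, i)) * r $$ (0, j) - (\<Sum>l<k. cj (r $$ (Suc l, i)) * r $$ (Suc l, j))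
      = (if i = j then (if i = 0 then 1 else - 1) else 0)"
    using r unfolding lorentz_mats_iff by blast+
  have r2: "r $$ (0, Suc j) = 0" if "j < k" for j
    using L[of 0 "Suc j"] that by (simp add: r0 r1)
  have "(\<Sum>x<k+1. cj (r $$ (x, i)) * r $$ (x, j)) = (if i = j then 1 else 0)" if ij: "i < k + 1" "j < k + 1" for i j
  proof -
    have "(\<Sum>l<k. cj (r $$ (Suc l, i)) * r $$ (Suc l, j)) =
      cj (r $$ (0, i)) * r $$ (0, j) - (if i = j then (if i = 0 then 1 else - 1) else 0)"
      using L[OF ij] by (simp add: algebra_simps)
    then show ?thesis
      using ij by (cases i; cases j) (auto simp: sum.lessThan_Suc_shift r0 r2 simp del: sum.lessThan_Suc)
  qed
  then show ?thesis using r c unfolding stabilizer_def Int_iff unitary_mats_iff by blast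
qed

text \<open>
  If \<open>h a\<^sub>t\<close> and \<open>g\<close> have the same first column, then \<open>(h a\<^sub>t)\<^sup>-\<^sup>1 g\<close> fixes \<open>e\<^sub>0\<close>. A Cartan decomposition of
  \<open>g\<close> is thus obtained as soon as the first column is matched.
\<close>

lemma lorentz_factorization:
  assumes g: "g \<in> lorentz_mats cj k" and h: "h \<in> stabilizer k" and k: "1 \<le> k"
    and h0: "h $$ (0, 0) * of_real (cosh t) = g $$ (0, 0)"
    and h1: "\<And>i. i < k \<Longrightarrow> h $$ (Suc i, k) * of_real (sinh t) = g $$ (Suc i, 0)"
  obtains r where "r \<in> stabilizer k" "r $$ (0, 0) = 1" "g = h * boost k t * r"
proof
  let ?n = "k + 1"
  define M where "M = h * boost k t"
  have MinL: "M \<in> lorentz_mats cj k"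
    unfolding M_def using h boost_lorentz[OF k] by (auto simp: stabilizer_def intro: lorentz_mult)
  note i = lorentz_inv_mult[OF MinL]
  have c: "g \<in> carrier_mat ?n ?n" "M \<in> carrier_mat ?n ?n" "h \<in> carrier_mat ?n ?n"
    using g MinL h by (auto simp: lorentz_mats_def stabilizer_def)
  have col: "M $$ (x, 0) = g $$ (x, 0)" if x: "x < ?n" for x
  proof -
    have "M $$ (x, 0) = (\<Sum>y<?n. h $$ (x, y) * boost k t $$ (y, 0))"
      unfolding M_def by (rule mat_mult_index[OF c(3) boost_carrier x]) simp
    also have "\<dots> = (\<Sum>y<?n. (if y = 0 then h $$ (x, 0) * of_real (cosh t) else 0) + (if y = k then h $$ (x, k) * of_real (sinh t) else 0))"
      by (rule sum.cong) (use k in \<open>auto simp: boost_def plane_mat_def\<close>)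
    also have "\<dots> = h $$ (x, 0) * of_real (cosh t) + h $$ (x, k) * of_real (sinh t)"
      by (simp add: sum.distrib)
    also have "\<dots> = g $$ (x, 0)"
      using x h0 h1[of "x - 1"] stabilizer_entries(2)[OF h, of "x - 1"] stabilizer_entries(3)[OF h, of "k - 1"] k
      by (cases x) auto
    finally show ?thesis .
  qed
  define r where "r = lorentz_inv k M * g"
  have rL: "r \<in> lorentz_mats cj k"
    unfolding r_def by (intro lorentz_mult lorentz_inv_in_lorentz MinL g)
  have "M * r = M * lorentz_inv k M * g" unfolding r_def by (rule assoc_mult_mat[OF c(2) i(1) c(1), symmetric])
  then show "g = h * boost k t * r" using i(3) left_mult_one_mat[OF c(1)] by (simp add: M_def)
  have r0: "r $$ (x, 0) = (if x = 0 then 1 else 0)" if x: "x < ?n" for x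
  proof -
    have "r $$ (x, 0) = (\<Sum>y<?n. lorentz_inv k M $$ (x, y) * g $$ (y, 0))"
      unfolding r_def by (rule mat_mult_index[OF i(1) c(1) x]) simp
    also have "\<dots> = (\<Sum>y<?n. lorentz_inv k M $$ (x, y) * M $$ (y, 0))"
      by (rule sum.cong) (auto simp: col)
    also have "\<dots> = (lorentz_inv k M * M) $$ (x, 0)"
      by (rule mat_mult_index[OF i(1) c(2) x, symmetric]) simp
    finally show ?thesis using i(2) x by simp
  qed
  show "r $$ (0, 0) = 1" using r0[of 0] by simp
  show "r \<in> stabilizer k" by (rule lorentz_first_column_stabilizer[OF rL]) (use r0 in auto)
qed

lemma lorentz_first_column:
  assumes g: "g \<in> lorentz_mats cj k"
  shows "(norm (g $$ (0, 0)))\<^sup>2 = 1 + (\<Sum>i<k. (norm (g $$ (Suc i, 0)))\<^sup>2)"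
proof -
  have "cj (g $$ (0, 0)) * g $$ (0, 0) - (\<Sum>l<k. cj (g $$ (Suc l, 0)) * g $$ (Suc l, 0)) = 1"
    using g by (simp add: lorentz_mats_iff)
  then have "(norm (g $$ (0, 0)))\<^sup>2 - (\<Sum>i<k. (norm (g $$ (Suc i, 0)))\<^sup>2) = 1"
    unfolding cj_mult_self of_real_sum[symmetric] of_real_diff[symmetric] of_real_eq_1_iff .
  then show ?thesis by simp
qed

lemma lorentz_first_row:
  assumes g: "g \<in> lorentz_mats cj k"
  shows "(norm (g $$ (0, 0)))\<^sup>2 = 1 + (\<Sum>i<k. (norm (g $$ (0, Suc i)))\<^sup>2)"
  using lorentz_first_column[OF lorentz_adjoint[OF g]] g
  by (simp add: adjoint_index[where n="k+1" and m="k+1"] lorentz_mats_def)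

text \<open>
  Polar coordinates \<open>(t, v)\<close> of the first column of \<open>g\<close>. For \<open>t = 0\<close> the direction \<open>v\<close> is arbitrary.
\<close>

lemma polar_first_column:
  assumes g: "g \<in> lorentz_mats cj k" and k: "1 \<le> k"
  obtains t v where "t \<ge> 0" "norm (g $$ (0, 0)) = cosh t" "(\<Sum>i<k. (norm (v i))\<^sup>2) = 1"
    "\<And>i. i < k \<Longrightarrow> g $$ (Suc i, 0) = v i * of_real (sinh t)"
proof -
  let ?a = "norm (g $$ (0, 0))"
  note col = lorentz_first_column[OF g]
  have "?a\<^sup>2 \<ge> 1" unfolding col by (simp add: sum_nonneg)
  then have a1: "?a \<ge> 1" using power_mono_iff[of 1 ?a 2] by simp
  define t where "t = arcosh ?a"
  have t: "t \<ge> 0" "cosh t = ?a" using a1 by (simp_all add: t_def)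
  have s2: "(sinh t)\<^sup>2 = (\<Sum>i<k. (norm (g $$ (Suc i, 0)))\<^sup>2)"
    using hyperbolic_pythagoras[of t] col t(2) by simp
  define v where "v i = (if sinh t = 0 then (if i = 0 then 1 else 0) else g $$ (Suc i, 0) * of_real (inverse (sinh t)))" for i
  have "(\<Sum>i<k. (norm (v i))\<^sup>2) = 1"
  proof (cases "sinh t = 0")
    case True
    then have "(\<Sum>i<k. (norm (v i))\<^sup>2) = (\<Sum>i<k. if i = 0 then 1 else 0)"
      by (intro sum.cong) (auto simp: v_def)
    then show ?thesis using k by simp
  next
    case False
    then have "(\<Sum>i<k. (norm (v i))\<^sup>2) = (\<Sum>i<k. (norm (g $$ (Suc i, 0)))\<^sup>2) * (inverse (sinh t))\<^sup>2"
      unfolding sum_distrib_right by (intro sum.cong) (auto simp: v_def norm_mult norm_inverse power_mult_distrib power_inverse)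
    then show ?thesis using False by (simp add: s2[symmetric] power_inverse)
  qed
  moreover have "g $$ (Suc i, 0) = v i * of_real (sinh t)" if "i < k" for i
  proof (cases "sinh t = 0")
    case True
    then have "g $$ (Suc i, 0) = 0" using s2 that by (simp add: sum_nonneg_eq_0_iff)
    then show ?thesis using True by simp
  next
    case False
    then show ?thesis by (simp add: v_def mult.assoc flip: of_real_mult)
  qed
  ultimately show ?thesis using that t by metis
qed

lemma phase_diag_unitary:
  assumes c: "norm c = 1"
  shows "phase_diag n m c \<in> unitary_mats cj n"
proof -
  have cc: "cj c * c = 1" using c by (simp add: cj_mult_self)
  have "(\<Sum>x<n. cj (phase_diag n m c $$ (x, i)) * phase_diag n m c $$ (x, j)) = (if i = j then 1 else 0)"
    if ij: "i < n" "j < n" for i j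
  proof -
    have "(\<Sum>x<n. cj (phase_diag n m c $$ (x, i)) * phase_diag n m c $$ (x, j)) = (\<Sum>x<n. if x = i then (if i = j then 1 else 0) else 0)"
      by (rule sum.cong) (use ij cc in \<open>auto simp: phase_diag_def\<close>)
    then show ?thesis using ij by simp
  qed
  then show ?thesis by (simp add: unitary_mats_iff)
qed

text \<open>
  A Householder reflection composed with a phase: for unit vectors \<open>x\<close>, \<open>v\<close> such that \<open>x\<^sup>*v\<close> is real, the
  reflection along \<open>w = x - v\<close> exchanges \<open>x\<close> and \<open>v\<close>. Over a noncommutative field the phase is
  moved into \<open>x = e \<alpha>\<close>, with the last basis vector \<open>e\<close>.
\<close>

lemma unitary_with_last_column:
  assumes k: "1 \<le> k" and v: "(\<Sum>i<k. (norm (v i))\<^sup>2) = 1"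
  obtains B where "B \<in> unitary_mats cj k" "\<And>i. i < k \<Longrightarrow> B $$ (i, k - 1) = v i"
proof
  define m where "m = k - 1"
  have m: "m < k" using k by (simp add: m_def)
  define \<rho> where "\<rho> = norm (v m)"
  \<comment> \<open>The phase that makes the product of \<open>e \<alpha>\<close> and \<open>v\<close> real and nonnegative.\<close>
  define \<alpha> where "\<alpha> = (if v m = 0 then 1 else v m * of_real (inverse \<rho>))"
  have \<alpha>: "norm \<alpha> = 1" by (simp add: \<alpha>_def \<rho>_def norm_mult norm_inverse)
  have v\<alpha>: "v m = \<alpha> * of_real \<rho>" by (auto simp: \<alpha>_def \<rho>_def mult.assoc simp flip: of_real_mult)
  define w where "w i = (if i = m then \<alpha> else 0) - v i" for i
  define N where "N = (\<Sum>i<k. (norm (w i))\<^sup>2)"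
  have wm: "w m = \<alpha> * of_real (1 - \<rho>)" by (simp add: w_def v\<alpha> algebra_simps)
  have "N = (norm (w m))\<^sup>2 + (\<Sum>i\<in>{..<k}-{m}. (norm (w i))\<^sup>2)"
    unfolding N_def by (rule sum.remove) (use m in auto)
  also have "(\<Sum>i\<in>{..<k}-{m}. (norm (w i))\<^sup>2) = (\<Sum>i\<in>{..<k}-{m}. (norm (v i))\<^sup>2)"
    by (rule sum.cong) (auto simp: w_def)
  also have "\<dots> = 1 - \<rho>\<^sup>2"
    using sum.remove[of "{..<k}" m "\<lambda>i. (norm (v i))\<^sup>2"] m v by (simp add: \<rho>_def)
  also have "(norm (w m))\<^sup>2 = (1 - \<rho>)\<^sup>2" by (simp only: wm norm_mult \<alpha> norm_of_real) simp
  finally have N: "N = 2 * (1 - \<rho>)" by (simp add: power2_eq_square algebra_simps)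
  \<comment> \<open>If \<open>N = 0\<close>, then \<open>s = 0\<close> and the reflection below degenerates to the identity, as it should.\<close>
  define s where "s = 2 / N"
  define H where "H = Matrix.mat k k (\<lambda>(i, j). (if i = j then 1 else 0) - s *\<^sub>R (w i * cj (w j)))"
  have H: "H \<in> carrier_mat k k" by (simp add: H_def)
  have ww: "(\<Sum>l<k. cj (w l) * w l) = of_real N" by (simp add: N_def cj_mult_self)
  have sN: "s * s * N = 2 * s" by (simp add: s_def)
  have "(\<Sum>l<k. cj (H $$ (l, i)) * H $$ (l, j)) = (if i = j then 1 else 0)" if ij: "i < k" "j < k" for i j
  proof -
    have cjs: "cj (s *\<^sub>R x) = s *\<^sub>R cj x" for x by (simp add: scaleR_conv_of_real cj_mult)
       (simp add: of_real_def)
    have "(\<Sum>l<k. cj (H $$ (l, i)) * H $$ (l, j)) =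
      (\<Sum>l<k. (if l = i then (if i = j then 1 else 0) else 0) - (if l = i then s *\<^sub>R (w i * cj (w j)) else 0)
         - (if l = j then s *\<^sub>R (w i * cj (w j)) else 0) + (s * s) *\<^sub>R (w i * (cj (w l) * w l) * cj (w j)))"
      by (rule sum.cong) (use ij in \<open>auto simp: H_def cj_diff cjs cj_mult algebra_simps\<close>)
    also have "\<dots> = (if i = j then 1 else 0) - s *\<^sub>R (w i * cj (w j)) - s *\<^sub>R (w i * cj (w j))
        + (s * s) *\<^sub>R (w i * (\<Sum>l<k. cj (w l) * w l) * cj (w j))"
      using ij by (simp add: sum.distrib sum_subtractf sum_distrib_left sum_distrib_right scaleR_sum_right)
    also have "(s * s) *\<^sub>R (w i * (\<Sum>l<k. cj (w l) * w l) * cj (w j)) = (s * s * N) *\<^sub>R (w i * cj (w j))"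
      unfolding ww by (simp add: of_real_def)
    also have "\<dots> = s *\<^sub>R (w i * cj (w j)) + s *\<^sub>R (w i * cj (w j))"
      unfolding sN by (simp flip: scaleR_left_distrib)
    finally show ?thesis by simp
  qed
  then have HU: "H \<in> unitary_mats cj k" using H by (simp add: unitary_mats_iff)
  show "H * phase_diag k m \<alpha> \<in> unitary_mats cj k"
    by (rule unitary_mult[OF HU phase_diag_unitary[OF \<alpha>]])
  show "(H * phase_diag k m \<alpha>) $$ (i, k - 1) = v i" if i: "i < k" for i
  proof -
    have "(H * phase_diag k m \<alpha>) $$ (i, m) = H $$ (i, m) * \<alpha>"
      using mult_phase_diag_index[OF H i m, of m \<alpha>] by simp
    also have "\<dots> = (if i = m then \<alpha> else 0) - s *\<^sub>R (w i * (cj (w m) * \<alpha>))"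
      using i m by (simp add: H_def algebra_simps)
    also have "cj (w m) * \<alpha> = of_real (1 - \<rho>)"
      using cj_mult_self(1)[of \<alpha>] \<alpha> by (simp add: wm cj_mult mult.assoc del: of_real_diff)
    also have "s *\<^sub>R (w i * of_real (1 - \<rho>)) = (s * (1 - \<rho>)) *\<^sub>R w i" by (simp add: of_real_def)
    also have "\<dots> = w i"
    proof (cases "N = 0")
      case True
      then have "w i = 0" using i by (simp add: N_def sum_nonneg_eq_0_iff)
      then show ?thesis by simp
    next
      case False
      then have "s * (1 - \<rho>) = 1" using N by (simp add: s_def)
      then show ?thesis by simp
    qed
    finally show ?thesis by (simp add: w_def m_def)
  qed
qed

text \<open>
  Only the last column of the unitary block \<open>B\<close> is prescribed; over the commutative fields the other
  columns serve to adjust its determinant.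
\<close>

lemma cartan_factorization:
  assumes g: "g \<in> lorentz_mats cj k" and k: "1 \<le> k"
    and A: "A \<in> unitary_mats cj 1" "A $$ (0, 0) * of_real (cosh t) = g $$ (0, 0)"
    and B: "B \<in> unitary_mats cj k" "\<And>i. i < k \<Longrightarrow> B $$ (i, k - 1) * of_real (sinh t) = g $$ (Suc i, 0)"
  obtains r where "r \<in> stabilizer k" "r $$ (0, 0) = 1" "g = block_diag A B * boost k t * r"
proof -
  note ix = block_diag_index[OF unitary_matsD(1)[OF A(1)] unitary_matsD(1)[OF B(1)]]
  have "block_diag A B $$ (Suc i, k) * of_real (sinh t) = g $$ (Suc i, 0)" if "i < k" for i
    using ix(4)[OF that, of "k - 1"] k B(2)[OF that] by simp
  then show thesis
    using lorentz_factorization[OF g block_diag_stabilizer[OF A(1) B(1)] k, of t] ix(1) A(2) that by metis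
qed

lemma unit_1x1_unitary: "norm a = 1 \<Longrightarrow> Matrix.mat 1 1 (\<lambda>_. a) \<in> unitary_mats cj 1"
  by (simp add: unitary_mats_iff cj_mult_self)

end

section \<open>Determinants and the three fields of scalars\<close>

lemma det_phase_diag: "m < n \<Longrightarrow> Determinant.det (phase_diag n m c) = (c :: 'a::comm_ring_1)"
proof -
  assume m: "m < n"
  have "phase_diag n m c = multrow_mat n m c"
    by (rule eq_matI) (auto simp: phase_diag_def)
  then show ?thesis using det_multrow_mat[OF m] by simp
qed

lemma det_block_diag:
  fixes A B :: "'a::{comm_ring_1, ring_no_zero_divisors} mat"
  assumes "A \<in> carrier_mat 1 1" "B \<in> carrier_mat k k"
  shows "Determinant.det (block_diag A B) = A $$ (0, 0) * Determinant.det B"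
  using assms det_four_block_mat_lower_left_zero_col[of A "0\<^sub>m (dim_row A) (dim_col B)" k "0\<^sub>m (dim_row B) (dim_col A)" B]
  by (simp add: block_diag_def det_single)

locale commutative_quat_subfield = quat_subfield cj \<phi>
  for cj :: "'a::real_normed_field \<Rightarrow> 'a" and \<phi> :: "'a \<Rightarrow> quat"
begin

lemma det_adjoint: "A \<in> carrier_mat n n \<Longrightarrow> Determinant.det (adjoint_mat cj A) = cj (Determinant.det A)"
proof -
  assume A: "A \<in> carrier_mat n n"
  interpret comm_ring_hom cj by unfold_locales (simp_all add: cj_add cj_mult)
  show ?thesis unfolding adjoint_mat_def hom_det det_transpose[OF A] ..
qed

lemma norm_det_unitary:
  assumes A: "A \<in> unitary_mats cj n"
  shows "norm (Determinant.det A) = 1"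
proof -
  note c = unitary_matsD(1)[OF A]
  have "cj (Determinant.det A) * Determinant.det A = Determinant.det (adjoint_mat cj A * A)"
    using c by (subst det_mult[where n=n]) (auto simp: det_adjoint)
  also have "\<dots> = 1" using unitary_matsD(2)[OF A] by simp
  finally have "(norm (Determinant.det A))\<^sup>2 = 1" unfolding cj_mult_self of_real_eq_1_iff .
  then show ?thesis using norm_ge_zero[of "Determinant.det A"] by (simp add: power2_eq_1_iff)
qed

lemma det_lorentz_inv:
  assumes A: "A \<in> lorentz_mats cj k" and d: "Determinant.det A = 1"
  shows "Determinant.det (lorentz_inv k A) = 1"
proof -
  have "Determinant.det (lorentz_inv k A * A) = Determinant.det (lorentz_inv k A) * Determinant.det A"
    by (rule det_mult) (use lorentz_inv_mult[OF A] lorentz_matsD[OF A] in auto)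
  then show ?thesis using lorentz_inv_mult(2)[OF A] d by simp
qed

text \<open>
  The boost \<open>a\<^sub>t\<close> is the square of \<open>a\<^sub>t\<^sub>/\<^sub>2\<close>, and the determinant of a self-adjoint Lorentz transformation
  is \<open>1\<close> or \<open>-1\<close>.
\<close>

lemma det_boost:
  assumes k: "1 \<le> k"
  shows "Determinant.det (boost k t :: 'a mat) = 1"
proof -
  let ?b = "boost k (t / 2) :: 'a mat" and ?J = "lorentz_form k :: 'a mat"
  note c = boost_carrier[of k "t / 2", where ?'a='a] and J = lorentz_form_carrier(1)[of k, where ?'a='a]
  have JJ: "Determinant.det ?J * Determinant.det ?J = 1"
    unfolding det_mult[OF J J, symmetric] lorentz_form_square by simp
  have "Determinant.det ?J = Determinant.det (adjoint_mat cj ?b * ?J * ?b)"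
    using lorentz_matsD(2)[OF boost_lorentz[OF k]] by simp
  also have "\<dots> = Determinant.det ?b * Determinant.det ?J * Determinant.det ?b"
    unfolding adjoint_boost[OF k] det_mult[OF square_mult_carrier[OF c J] c] det_mult[OF c J] ..
  finally have "Determinant.det ?b * Determinant.det ?b * (Determinant.det ?J * Determinant.det ?J) = Determinant.det ?J * Determinant.det ?J"
    by (simp add: mult_ac)
  then have "Determinant.det ?b * Determinant.det ?b = 1" unfolding JJ by simp
  then show ?thesis
    using boost_add[OF k, of "t/2" "t/2", where ?'a='a] det_mult[OF c c] by simp
qed

text \<open>
  A phase in column 0, which differs from the last column as \<open>k \<ge> 2\<close>, changes the determinant freely.
\<close>

lemma unitary_with_last_column_and_det:
  assumes B: "B \<in> unitary_mats cj k" and k: "2 \<le> k" and d: "norm d = 1"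
  obtains B' where "B' \<in> unitary_mats cj k" "Determinant.det B' = d" "\<And>i. i < k \<Longrightarrow> B' $$ (i, k - 1) = B $$ (i, k - 1)"
proof
  let ?c = "d / Determinant.det B"
  have n: "norm ?c = 1" using d norm_det_unitary[OF B] by (simp add: norm_divide)
  have nz: "Determinant.det B \<noteq> 0" using norm_det_unitary[OF B] by auto
  show "B * phase_diag k 0 ?c \<in> unitary_mats cj k" by (rule unitary_mult[OF B phase_diag_unitary[OF n]])
  show "Determinant.det (B * phase_diag k 0 ?c) = d"
    using k nz by (simp add: det_mult[OF unitary_matsD(1)[OF B] phase_diag_carrier] det_phase_diag)
  show "(B * phase_diag k 0 ?c) $$ (i, k - 1) = B $$ (i, k - 1)" if "i < k" for i
    using k that mult_phase_diag_index[OF unitary_matsD(1)[OF B] that, of "k - 1" 0 ?c] by simp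
qed

lemma cartan_factorization_det_1:
  assumes g: "g \<in> lorentz_mats cj k" and dg: "Determinant.det g = 1" and k: "2 \<le> k"
  obtains t h r where "t \<ge> 0" "h \<in> stabilizer k" "Determinant.det h = 1"
    "h $$ (0, 0) = g $$ (0, 0) / of_real (norm (g $$ (0, 0)))" "r \<in> stabilizer k" "r $$ (0, 0) = 1" "Determinant.det r = 1"
    "g = h * boost k t * r"
proof -
  have k1: "1 \<le> k" using k by simp
  obtain t v where t: "t \<ge> 0" "norm (g $$ (0, 0)) = cosh t" "(\<Sum>i<k. (norm (v i))\<^sup>2) = 1"
    "\<And>i. i < k \<Longrightarrow> g $$ (Suc i, 0) = v i * of_real (sinh t)"
    using polar_first_column[OF g k1] by metis
  obtain B where B: "B \<in> unitary_mats cj k" "\<And>i. i < k \<Longrightarrow> B $$ (i, k - 1) = v i"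
    using unitary_with_last_column[OF k1 t(3)] by metis
  define a where "a = g $$ (0, 0) / of_real (norm (g $$ (0, 0)))"
  have ch: "cosh t > 0" by (rule cosh_real_pos)
  have a: "norm a = 1" "a * of_real (cosh t) = g $$ (0, 0)" using t(2) ch by (auto simp: a_def norm_divide)
  define A where "A = Matrix.mat 1 1 (\<lambda>_. a)"
  have A: "A \<in> unitary_mats cj 1" "A $$ (0, 0) = a" unfolding A_def using unit_1x1_unitary[OF a(1)] by simp_all
  have "norm (inverse a) = 1" using a(1) by (simp add: norm_inverse)
  then obtain B' where B': "B' \<in> unitary_mats cj k" "Determinant.det B' = inverse a" "\<And>i. i < k \<Longrightarrow> B' $$ (i, k - 1) = B $$ (i, k - 1)"
    using unitary_with_last_column_and_det[OF B(1) k] by metis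
  obtain r where r: "r \<in> stabilizer k" "r $$ (0, 0) = 1" "g = block_diag A B' * boost k t * r"
    using cartan_factorization[OF g k1 A(1) _ B'(1)] a(2) A(2) B'(3) B(2) t(4) by metis
  let ?h = "block_diag A B'"
  have h: "?h \<in> stabilizer k" by (rule block_diag_stabilizer[OF A(1) B'(1)])
  have "a \<noteq> 0" using a(1) by auto
  then have dh: "Determinant.det ?h = 1"
    using det_block_diag[OF unitary_matsD(1)[OF A(1)] unitary_matsD(1)[OF B'(1)]] A(2) B'(2) by simp
  have c: "?h \<in> carrier_mat (k+1) (k+1)" "r \<in> carrier_mat (k+1) (k+1)"
    using h r(1) by (auto simp: stabilizer_def lorentz_mats_def)
  have "Determinant.det g = Determinant.det ?h * Determinant.det (boost k t :: 'a mat) * Determinant.det r"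
    unfolding r(3) det_mult[OF square_mult_carrier[OF c(1) boost_carrier] c(2)] det_mult[OF c(1) boost_carrier] ..
  then have dr: "Determinant.det r = 1" using dg dh det_boost[OF k1] by simp
  have h0: "?h $$ (0, 0) = g $$ (0, 0) / of_real (norm (g $$ (0, 0)))"
    using block_diag_index(1)[OF unitary_matsD(1)[OF A(1)] unitary_matsD(1)[OF B'(1)]] A(2) by (simp add: a_def)
  show thesis by (rule that[OF t(1) h dh h0 r(1,2) dr r(3)])
qed

end

interpretation RQ: commutative_quat_subfield "id :: real \<Rightarrow> real" of_real
  by unfold_locales (simp_all add: quat_eq_iff norm_quat_def)

interpretation CQ: commutative_quat_subfield cnj quat_of_complex
  by unfold_locales (simp_all add: quat_eq_iff quat_sel_mult norm_quat_def norm_complex_def quat_of_complex_def)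

interpretation HQ: quat_subfield qcnj id
  by unfold_locales simp_all

lemma map_mat_id: "map_mat id A = A"
  by (rule eq_matI) auto

context quat_subfield
begin

lemma map_\<phi>_carrier [simp]: "map_mat \<phi> A \<in> carrier_mat n m \<longleftrightarrow> A \<in> carrier_mat n m"
  by (rule map_carrier_mat)

lemma map_\<phi>_lorentz: "A \<in> lorentz_mats cj k \<Longrightarrow> map_mat \<phi> A \<in> lorentz_mats qcnj k"
proof -
  assume A: "A \<in> lorentz_mats cj k"
  note c = lorentz_matsD(1)[OF A]
  have a: "adjoint_mat cj A \<in> carrier_mat (k + 1) (k + 1)" using c by simp
  have "adjoint_mat qcnj (map_mat \<phi> A) * lorentz_form k * map_mat \<phi> A = map_mat \<phi> (adjoint_mat cj A * lorentz_form k * A)"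
    unfolding map_\<phi>_mult[OF square_mult_carrier[OF a lorentz_form_carrier(1)] c] map_\<phi>_mult[OF a lorentz_form_carrier(1)] map_\<phi>_adjoint
    by simp
  then show ?thesis using lorentz_matsD(2)[OF A] c by (simp add: lorentz_mats_def)
qed

lemma map_\<phi>_unitary: "A \<in> unitary_mats cj n \<Longrightarrow> map_mat \<phi> A \<in> unitary_mats qcnj n"
proof -
  assume A: "A \<in> unitary_mats cj n"
  note c = unitary_matsD(1)[OF A]
  have a: "adjoint_mat cj A \<in> carrier_mat n n" using c by simp
  have "adjoint_mat qcnj (map_mat \<phi> A) * map_mat \<phi> A = map_mat \<phi> (adjoint_mat cj A * A)"
    unfolding map_\<phi>_mult[OF a c] map_\<phi>_adjoint ..
  then show ?thesis using unitary_matsD(2)[OF A] c by (simp add: unitary_mats_def)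
qed

lemma map_\<phi>_stabilizer: "A \<in> stabilizer k \<Longrightarrow> map_mat \<phi> A \<in> HQ.stabilizer k"
  using map_\<phi>_lorentz map_\<phi>_unitary unfolding stabilizer_def HQ.stabilizer_def by blast

lemma map_\<phi>_lorentz_inv:
  assumes c: "A \<in> carrier_mat (k + 1) (k + 1)"
  shows "map_mat \<phi> (lorentz_inv k A) = HQ.lorentz_inv k (map_mat \<phi> A)"
proof -
  have a: "adjoint_mat cj A \<in> carrier_mat (k + 1) (k + 1)" using c by simp
  note J = lorentz_form_carrier(1)
  show ?thesis
    unfolding lorentz_inv_def HQ.lorentz_inv_def map_\<phi>_mult[OF square_mult_carrier[OF J a] J] map_\<phi>_mult[OF J a] map_\<phi>_adjoint
    by simp
qed

lemma map_\<phi>_plane_mat: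
  shows "map_mat \<phi> (plane_mat n p q a b c d) = plane_mat n p q (\<phi> a) (\<phi> b) (\<phi> c) (\<phi> d)"
proof (rule mat_eqI[where n="n" and m="n"])
  fix i j assume ij: "i < n" "j < n"
  have "map_mat \<phi> (plane_mat n p q a b c d) $$ (i, j) = \<phi> (plane_mat n p q a b c d $$ (i, j))"
    by (rule index_map_mat(1)) (use ij in \<open>simp_all add: plane_mat_def\<close>)
  also have "\<dots> = plane_mat n p q (\<phi> a) (\<phi> b) (\<phi> c) (\<phi> d) $$ (i, j)"
    unfolding plane_mat_def index_mat(1)[OF ij] prod.case if_distrib[of \<phi>] \<phi>_0 \<phi>_1 ..
  finally show "map_mat \<phi> (plane_mat n p q a b c d) $$ (i, j) = \<dots>" .
qed (simp_all add: plane_mat_def)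

lemma map_\<phi>_boost: "map_mat \<phi> (boost k t) = boost k t"
  by (simp add: boost_def map_\<phi>_plane_mat \<phi>_of_real)

lemma map_\<phi>_rotation: "map_mat \<phi> (rotation k p q t) = rotation k p q t"
  by (simp add: rotation_def map_\<phi>_plane_mat \<phi>_of_real \<phi>_minus)

lemma map_\<phi>_mult3:
  assumes "A \<in> carrier_mat n n" "B \<in> carrier_mat n n" "C \<in> carrier_mat n n"
  shows "map_mat \<phi> (A * B * C) = map_mat \<phi> A * map_mat \<phi> B * map_mat \<phi> C"
  unfolding map_\<phi>_mult[OF square_mult_carrier[OF assms(1,2)] assms(3)] map_\<phi>_mult[OF assms(1,2)] ..

lemma image_one: "1\<^sub>m n \<in> X \<Longrightarrow> 1\<^sub>m n \<in> map_mat \<phi> ` X"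
  using map_\<phi>_one[of n] by (metis image_eqI)

lemma image_rotation: "rotation k p q t \<in> X \<Longrightarrow> rotation k p q t \<in> map_mat \<phi> ` X"
  using map_\<phi>_rotation[of k p q t] by (metis image_eqI)

lemma image_mult:
  assumes "g \<in> map_mat \<phi> ` X" "h \<in> map_mat \<phi> ` X"
    and "X \<subseteq> carrier_mat n n" "\<And>A B. A \<in> X \<Longrightarrow> B \<in> X \<Longrightarrow> A * B \<in> X"
  shows "g * h \<in> map_mat \<phi> ` X"
proof -
  obtain A B where AB: "A \<in> X" "B \<in> X" "g = map_mat \<phi> A" "h = map_mat \<phi> B" using assms(1,2) by blast
  have "g * h = map_mat \<phi> (A * B)"
    unfolding AB(3,4) by (rule map_\<phi>_mult[symmetric]) (use AB(1,2) assms(3) in auto)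
  then show ?thesis using assms(4)[OF AB(1,2)] by blast
qed

lemma image_inv:
  assumes "g \<in> map_mat \<phi> ` X" "X \<subseteq> carrier_mat (k + 1) (k + 1)" "\<And>A. A \<in> X \<Longrightarrow> lorentz_inv k A \<in> X"
  shows "HQ.lorentz_inv k g \<in> map_mat \<phi> ` X"
proof -
  obtain A where A: "A \<in> X" "g = map_mat \<phi> A" using assms(1) by blast
  show ?thesis
    unfolding A(2) map_\<phi>_lorentz_inv[OF subsetD[OF assms(2) A(1)], symmetric] by (rule imageI[OF assms(3)[OF A(1)]])
qed

lemma image_adjoint:
  assumes "g \<in> map_mat \<phi> ` X" "\<And>A. A \<in> X \<Longrightarrow> adjoint_mat cj A \<in> X"
  shows "adjoint_mat qcnj g \<in> map_mat \<phi> ` X"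
proof -
  obtain A where A: "A \<in> X" "g = map_mat \<phi> A" using assms(1) by blast
  show ?thesis unfolding A(2) map_\<phi>_adjoint[symmetric] by (rule imageI[OF assms(2)[OF A(1)]])
qed

end

section \<open>The groups G and K of the hyperbolic spaces\<close>

lemma topspace_mat_topology [simp]: "topspace (mat_topology n) = carrier_mat n n"
  by (auto simp: mat_topology_def topspace_pullback_topology)

lemma continuous_map_mat_entry:
  assumes "i < n" "j < n"
  shows "continuous_map (mat_topology n) euclidean (\<lambda>A. A $$ (i, j))"
proof -
  have "continuous_map (product_topology (\<lambda>_. euclidean) ({..<n} \<times> {..<n})) euclidean (\<lambda>f. f (i, j))"
    using assms by (intro continuous_map_product_projection) auto
  from continuous_map_pullback[OF this, of "carrier_mat n n" "\<lambda>A. restrict (\<lambda>ij. A $$ ij) ({..<n} \<times> {..<n})"]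
  show ?thesis using assms by (simp add: mat_topology_def comp_def)
qed

lemma continuous_map_into_mat_topology:
  assumes "\<And>x. x \<in> topspace X \<Longrightarrow> f x \<in> carrier_mat n n"
    and "\<And>i j. i < n \<Longrightarrow> j < n \<Longrightarrow> continuous_map X euclidean (\<lambda>x. f x $$ (i, j))"
  shows "continuous_map X (mat_topology n) f"
  unfolding mat_topology_def
proof (rule continuous_map_pullback')
  show "continuous_map X (product_topology (\<lambda>_. euclidean) ({..<n} \<times> {..<n}))
     ((\<lambda>A. restrict (\<lambda>ij. A $$ ij) ({..<n} \<times> {..<n})) \<circ> f)"
    using assms(2) by (auto simp: continuous_map_componentwise)
qed (use assms(1) in auto)

lemma SO_1_one: "1\<^sub>m (k + 1) \<in> SO_1 k"
  using RQ.lorentz_one[of k] by (simp add: SO_1_def)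

lemma SO_1_mult: "A \<in> SO_1 k \<Longrightarrow> B \<in> SO_1 k \<Longrightarrow> A * B \<in> SO_1 k"
  using RQ.lorentz_mult[of A k B] det_mult[of A "k + 1" B] by (auto simp: SO_1_def lorentz_mats_def)

lemma SO_1_inv: "A \<in> SO_1 k \<Longrightarrow> RQ.lorentz_inv k A \<in> SO_1 k"
  using RQ.lorentz_inv_in_lorentz RQ.det_lorentz_inv by (auto simp: SO_1_def)

lemma SO_1_carrier: "A \<in> SO_1 k \<Longrightarrow> A \<in> carrier_mat (k + 1) (k + 1)"
  by (auto simp: SO_1_def lorentz_mats_def)

abbreviation SO_1_topology :: "nat \<Rightarrow> real mat topology" where
  "SO_1_topology k \<equiv> subtopology (mat_topology (k + 1)) (SO_1 k)"

lemma SOo_1_iff: "A \<in> SOo_1 k \<longleftrightarrow> connected_component_of (SO_1_topology k) (1\<^sub>m (k + 1)) A"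
  by (simp add: SOo_1_def)

lemma SOo_1_subset: "A \<in> SOo_1 k \<Longrightarrow> A \<in> SO_1 k"
  unfolding SOo_1_iff using connected_component_of_equiv[of "SO_1_topology k"] by auto

text \<open>
  Left translations are continuous, so they permute the connected components of \<open>SO(1,k)\<close>. This makes
  the identity component a group.
\<close>

lemma continuous_map_left_mult:
  assumes A: "A \<in> SO_1 k"
  shows "continuous_map (SO_1_topology k) (SO_1_topology k) (\<lambda>B. A * B)"
  unfolding continuous_map_in_subtopology
proof
  show "continuous_map (SO_1_topology k) (mat_topology (k + 1)) (\<lambda>B. A * B)"
  proof (rule continuous_map_into_mat_topology)
    fix i j assume ij: "i < k + 1" "j < k + 1"
    have "continuous_map (SO_1_topology k) euclidean (\<lambda>B. \<Sum>x<k+1. A $$ (i, x) * B $$ (x, j))"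
      by (intro continuous_map_sum continuous_map_real_mult_left continuous_map_from_subtopology continuous_map_mat_entry)
        (use ij in auto)
    then show "continuous_map (SO_1_topology k) euclidean (\<lambda>B. (A * B) $$ (i, j))"
      by (rule continuous_map_eq) (simp add: mat_mult_index[OF SO_1_carrier[OF A] SO_1_carrier ij] del: index_mult_mat(1))
  qed (use SO_1_carrier[OF SO_1_mult[OF A]] in auto)
qed (use SO_1_mult[OF A] in auto)

lemma SOo_1_one: "1\<^sub>m (k + 1) \<in> SOo_1 k"
  unfolding SOo_1_iff using SO_1_one[of k] by (simp add: connected_component_of_refl)

lemma SOo_1_mult:
  assumes A: "A \<in> SOo_1 k" and B: "B \<in> SOo_1 k"
  shows "A * B \<in> SOo_1 k"
proof -
  have "connected_component_of (SO_1_topology k) (A * 1\<^sub>m (k + 1)) (A * B)"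
    by (rule connected_component_of_continuous_image[OF continuous_map_left_mult[OF SOo_1_subset[OF A]]])
      (use B in \<open>simp add: SOo_1_iff\<close>)
  then show ?thesis
    using A connected_component_of_trans right_mult_one_mat[OF SO_1_carrier[OF SOo_1_subset[OF A]]]
    unfolding SOo_1_iff by metis
qed

lemma SOo_1_inv:
  assumes A: "A \<in> SOo_1 k"
  shows "RQ.lorentz_inv k A \<in> SOo_1 k"
proof -
  let ?I = "RQ.lorentz_inv k A"
  have I: "?I \<in> SO_1 k" using SO_1_inv SOo_1_subset[OF A] by blast
  have "?I * A = 1\<^sub>m (k + 1)"
    using RQ.lorentz_inv_mult(2)[of A k] SOo_1_subset[OF A] by (auto simp: SO_1_def)
  moreover have "connected_component_of (SO_1_topology k) (?I * 1\<^sub>m (k + 1)) (?I * A)"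
    by (rule connected_component_of_continuous_image[OF continuous_map_left_mult[OF I]])
      (use A in \<open>simp add: SOo_1_iff\<close>)
  ultimately show ?thesis
    using right_mult_one_mat[OF SO_1_carrier[OF I]] connected_component_of_sym[of "SO_1_topology k"]
    unfolding SOo_1_iff by simp
qed

text \<open>
  The corner entry has modulus at least 1 on \<open>SO(1,k)\<close>, so it cannot change its sign on a connected set
  that contains the identity.
\<close>

lemma SOo_1_corner_ge_1:
  assumes A: "A \<in> SOo_1 k"
  shows "A $$ (0, 0) \<ge> 1"
proof -
  have sq: "\<bar>B $$ (0, 0)\<bar> \<ge> 1" if "B \<in> SO_1 k" for B
  proof -
    have "(norm (B $$ (0, 0)))\<^sup>2 \<ge> 1"
      using RQ.lorentz_first_column[of B k] that by (simp add: SO_1_def sum_nonneg)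
    then show ?thesis using power_mono_iff[of 1 "norm (B $$ (0, 0))" 2] by simp
  qed
  obtain T where T: "connectedin (SO_1_topology k) T" "1\<^sub>m (k + 1) \<in> T" "A \<in> T"
    using A unfolding SOo_1_iff connected_component_of_def by blast
  have "continuous_map (SO_1_topology k) euclidean (\<lambda>B. B $$ (0, 0))"
    by (intro continuous_map_from_subtopology continuous_map_mat_entry) auto
  then have conn: "connected ((\<lambda>B. B $$ (0, 0)) ` T)"
    using connectedin_continuous_map_image[OF _ T(1)] by fastforce
  have 1: "(1::real) \<in> (\<lambda>B. B $$ (0, 0)) ` T" using T(2) by force
  have 2: "A $$ (0, 0) \<in> (\<lambda>B. B $$ (0, 0)) ` T" using T(3) by blast
  have "T \<subseteq> SO_1 k" using T(1) by (auto simp: connectedin_def)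
  then have "0 \<notin> (\<lambda>B. B $$ (0, 0)) ` T" using sq by fastforce
  with connected_contains_Icc[OF conn 2 1] have "\<not> A $$ (0, 0) \<le> 0" by (meson atLeastAtMost_iff subsetD zero_le_one)
  then show ?thesis using sq[OF SOo_1_subset[OF A]] by linarith
qed

text \<open>
  As for boosts, the determinant is the square of the determinant of the rotation by half the angle.
\<close>

lemma rotation_SO_1:
  assumes pq: "p \<noteq> q" "1 \<le> p" "p \<le> k" "1 \<le> q" "q \<le> k"
  shows "rotation k p q t \<in> SO_1 k"
proof -
  let ?R = "\<lambda>t. rotation k p q t :: real mat"
  have "?R (t / 2) \<in> RQ.stabilizer k" by (rule RQ.rotation_stabilizer[OF pq])
  then have "\<bar>Determinant.det (?R (t / 2))\<bar> = 1"
    using RQ.norm_det_unitary[of "?R (t / 2)" "k + 1"] by (simp add: RQ.stabilizer_def)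
  then have "Determinant.det (?R (t / 2)) * Determinant.det (?R (t / 2)) = 1" by (metis abs_mult_self_eq mult_1)
  then have "Determinant.det (?R t) = 1"
    using det_mult[of "?R (t / 2)" "k + 1" "?R (t / 2)"] rotation_add[of p q k "t / 2" "t / 2", where ?'a=real] pq by simp
  then show ?thesis using RQ.rotation_stabilizer[OF pq, of t] by (simp add: SO_1_def RQ.stabilizer_def)
qed

text \<open>
  The angle provides a path to the identity.
\<close>

lemma rotation_SOo_1:
  assumes pq: "p \<noteq> q" "1 \<le> p" "p \<le> k" "1 \<le> q" "q \<le> k"
  shows "rotation k p q t \<in> SOo_1 k"
proof -
  have const_If: "continuous_on UNIV (\<lambda>t. if P then f t else g t)"
    if "continuous_on UNIV f" "continuous_on UNIV g" for P and f g :: "real \<Rightarrow> real"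
    using that by (cases P) simp_all
  have "continuous_map euclidean (SO_1_topology k) (\<lambda>t. rotation k p q t)"
    unfolding continuous_map_in_subtopology
  proof
    show "continuous_map euclidean (mat_topology (k + 1)) (\<lambda>t. rotation k p q t :: real mat)"
    proof (rule continuous_map_into_mat_topology)
      fix i j assume ij: "i < k + 1" "j < k + 1"
      show "continuous_map euclidean euclidean (\<lambda>t. rotation k p q t $$ (i, j) :: real)"
        unfolding rotation_def plane_mat_def index_mat(1)[OF ij] prod.case continuous_map_iff_continuous2
        by (intro const_If continuous_intros)
    qed simp
  qed (use rotation_SO_1[OF pq] in auto)
  moreover have "connected_component_of euclidean 0 t"
    unfolding connected_component_of_def by (rule exI[of _ UNIV]) simp
  ultimately show ?thesis
    using connected_component_of_continuous_image rotation_0[of p q k, where ?'a=real] pq(1)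
    unfolding SOo_1_iff by metis
qed

lemma hyp_K_RR: "hyp_K RR k = map_mat of_real ` {M \<in> RQ.stabilizer k. M $$ (0, 0) = 1 \<and> Determinant.det M = 1}"
proof -
  have "{block_diag (1\<^sub>m 1) B | B. B \<in> unitary_mats id k \<and> Determinant.det B = 1}
    = {M \<in> RQ.stabilizer k. M $$ (0, 0) = (1::real) \<and> Determinant.det M = 1}"
  proof (intro equalityI subsetI)
    fix M assume "M \<in> {block_diag (1\<^sub>m 1) B | B. B \<in> unitary_mats id k \<and> Determinant.det B = (1::real)}"
    then obtain B where B: "B \<in> unitary_mats id k" "Determinant.det B = (1::real)" "M = block_diag (1\<^sub>m 1) B" by blast
    note c = one_carrier_mat[of 1] RQ.unitary_matsD(1)[OF B(1)]
    show "M \<in> {M \<in> RQ.stabilizer k. M $$ (0, 0) = (1::real) \<and> Determinant.det M = 1}"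
      using RQ.block_diag_stabilizer[OF RQ.unitary_one B(1)] block_diag_index(1)[OF c] det_block_diag[OF c] B(2,3) by simp
  next
    fix M assume M: "M \<in> {M \<in> RQ.stabilizer k. M $$ (0, 0) = (1::real) \<and> Determinant.det M = 1}"
    then obtain A B where AB: "A \<in> unitary_mats id 1" "B \<in> unitary_mats id k" "M = block_diag A B" "A $$ (0, 0) = M $$ (0, 0)"
      using RQ.stabilizer_block_diag by blast
    note c = RQ.unitary_matsD(1)[OF AB(1)] RQ.unitary_matsD(1)[OF AB(2)]
    have a: "A $$ (0, 0) = 1" and d: "Determinant.det M = 1" using M AB(4) by simp_all
    have "A = 1\<^sub>m 1" by (rule eq_matI) (use c a in auto)
    moreover have "Determinant.det B = 1" using det_block_diag[OF c] d unfolding AB(3)[symmetric] a by simp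
    ultimately show "M \<in> {block_diag (1\<^sub>m 1) B | B. B \<in> unitary_mats id k \<and> Determinant.det B = (1::real)}"
      using AB by blast
  qed
  then show ?thesis by simp
qed

lemma block_diag_eq_stabilizer_CC:
  "{block_diag A B | A B. A \<in> unitary_mats cnj 1 \<and> B \<in> unitary_mats cnj k \<and> P (block_diag A B)} = {M \<in> CQ.stabilizer k. P M}"
  using CQ.block_diag_stabilizer[of _ _ k] CQ.stabilizer_block_diag[of _ k] by blast

lemma hyp_K_CC: "hyp_K CC k = map_mat quat_of_complex ` {M \<in> CQ.stabilizer k. Determinant.det M = 1}"
  unfolding hyp_K.simps block_diag_eq_stabilizer_CC[of k "\<lambda>M. Determinant.det M = 1"] ..

lemma hyp_K_HH: "hyp_K HH k = HQ.stabilizer k"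
  unfolding hyp_K.simps using HQ.block_diag_stabilizer[of _ _ k] HQ.stabilizer_block_diag[of _ k] by blast

lemma hyp_G_HH: "hyp_G HH k = map_mat id ` Sp_1 k"
  and hyp_K_HH': "hyp_K HH k = map_mat id ` HQ.stabilizer k"
  by (simp_all add: hyp_K_HH map_mat_id del: hyp_K.simps)

lemmas hyp_G_eq = hyp_G.simps(1,2) hyp_G_HH
lemmas hyp_K_eq = hyp_K_RR hyp_K_CC hyp_K_HH'

lemma hyp_G_subset: "hyp_G F k \<subseteq> lorentz_mats qcnj k"
  using RQ.map_\<phi>_lorentz CQ.map_\<phi>_lorentz SOo_1_subset
  by (cases F) (auto simp: SU_1_def Sp_1_def SO_1_def)

lemma hyp_K_subset: "hyp_K F k \<subseteq> HQ.stabilizer k"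
  using RQ.map_\<phi>_stabilizer CQ.map_\<phi>_stabilizer by (cases F) (auto simp: hyp_K_eq map_mat_id simp del: hyp_K.simps)

lemma SU_1_mult: "A \<in> SU_1 k \<Longrightarrow> B \<in> SU_1 k \<Longrightarrow> A * B \<in> SU_1 k"
  using CQ.lorentz_mult[of A k B] det_mult[of A "k + 1" B] by (auto simp: SU_1_def lorentz_mats_def)

lemma SU_1_inv: "A \<in> SU_1 k \<Longrightarrow> CQ.lorentz_inv k A \<in> SU_1 k"
  using CQ.lorentz_inv_in_lorentz CQ.det_lorentz_inv by (auto simp: SU_1_def)

lemma SU_1_one: "1\<^sub>m (k + 1) \<in> SU_1 k"
  using CQ.lorentz_one[of k] by (simp add: SU_1_def)

lemma group_carriers:
  "SOo_1 k \<subseteq> carrier_mat (k + 1) (k + 1)" "SU_1 k \<subseteq> carrier_mat (k + 1) (k + 1)" "Sp_1 k \<subseteq> carrier_mat (k + 1) (k + 1)"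
  using SO_1_carrier[OF SOo_1_subset] by (auto simp: SU_1_def Sp_1_def lorentz_mats_def)

lemma hyp_G_one: "1\<^sub>m (k + 1) \<in> hyp_G F k"
proof (cases F)
  case RR
  show ?thesis unfolding RR hyp_G_eq by (rule RQ.image_one[OF SOo_1_one])
next
  case CC
  show ?thesis unfolding CC hyp_G_eq by (rule CQ.image_one[OF SU_1_one])
next
  case HH
  show ?thesis unfolding HH hyp_G_eq by (rule HQ.image_one[OF HQ.lorentz_one[folded Sp_1_def]])
qed

lemma hyp_G_mult:
  assumes "g \<in> hyp_G F k" "h \<in> hyp_G F k"
  shows "g * h \<in> hyp_G F k"
proof (cases F)
  case RR
  show ?thesis using assms unfolding RR hyp_G_eq by (rule RQ.image_mult[OF _ _ group_carriers(1)]) (rule SOo_1_mult)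
next
  case CC
  show ?thesis using assms unfolding CC hyp_G_eq by (rule CQ.image_mult[OF _ _ group_carriers(2)]) (rule SU_1_mult)
next
  case HH
  show ?thesis using assms unfolding HH hyp_G_eq by (rule HQ.image_mult[OF _ _ group_carriers(3)]) (rule HQ.lorentz_mult[folded Sp_1_def])
qed

lemma hyp_G_inv:
  assumes "g \<in> hyp_G F k"
  shows "HQ.lorentz_inv k g \<in> hyp_G F k"
proof (cases F)
  case RR
  show ?thesis using assms unfolding RR hyp_G_eq by (rule RQ.image_inv[OF _ group_carriers(1)]) (rule SOo_1_inv)
next
  case CC
  show ?thesis using assms unfolding CC hyp_G_eq by (rule CQ.image_inv[OF _ group_carriers(2)]) (rule SU_1_inv)
next
  case HH
  show ?thesis using assms unfolding HH hyp_G_eq by (rule HQ.image_inv[OF _ group_carriers(3)]) (rule HQ.lorentz_inv_in_lorentz[folded Sp_1_def])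
qed

lemma rotation_SU_1:
  assumes pq: "p \<noteq> q" "1 \<le> p" "p \<le> k" "1 \<le> q" "q \<le> k"
  shows "rotation k p q t \<in> SU_1 k"
proof -
  have "map_mat of_real (rotation k p q t) = (rotation k p q t :: complex mat)"
    unfolding CQ.map_\<phi>_eq_iff[symmetric] CQ.map_\<phi>_rotation RQ.map_\<phi>_rotation[symmetric]
    by (rule eq_matI) (auto simp: CQ.\<phi>_of_real)
  then have "Determinant.det (rotation k p q t :: complex mat) = 1"
    using rotation_SO_1[OF pq, of t] of_real_hom.hom_det[of "rotation k p q t :: real mat", where ?'a=complex] by (simp add: SO_1_def)
  then show ?thesis using CQ.rotation_stabilizer[OF pq, of t] by (simp add: SU_1_def CQ.stabilizer_def)
qed

lemma rotation_hyp_G: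
  assumes pq: "p \<noteq> q" "1 \<le> p" "p \<le> k" "1 \<le> q" "q \<le> k"
  shows "rotation k p q t \<in> hyp_G F k"
proof (cases F)
  case RR
  show ?thesis unfolding RR hyp_G_eq by (rule RQ.image_rotation[OF rotation_SOo_1[OF pq]])
next
  case CC
  show ?thesis unfolding CC hyp_G_eq by (rule CQ.image_rotation[OF rotation_SU_1[OF pq]])
next
  case HH
  show ?thesis unfolding HH hyp_G.simps using HQ.rotation_stabilizer[OF pq, of t] by (simp add: Sp_1_def HQ.stabilizer_def)
qed

text \<open>
  The sets of real and complex matrices that represent \<open>SO(k)\<close> and \<open>S(U(1) \<times> U(k))\<close>.
\<close>

abbreviation SO_block :: "nat \<Rightarrow> real mat set" where
  "SO_block k \<equiv> {M \<in> RQ.stabilizer k. M $$ (0, 0) = 1 \<and> Determinant.det M = 1}"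

abbreviation SU_block :: "nat \<Rightarrow> complex mat set" where
  "SU_block k \<equiv> {M \<in> CQ.stabilizer k. Determinant.det M = 1}"

lemma block_carriers:
  "SO_block k \<subseteq> carrier_mat (k + 1) (k + 1)" "SU_block k \<subseteq> carrier_mat (k + 1) (k + 1)" "HQ.stabilizer k \<subseteq> carrier_mat (k + 1) (k + 1)"
  by (auto simp: RQ.stabilizer_def CQ.stabilizer_def HQ.stabilizer_def lorentz_mats_def)

lemma SO_block_mult:
  assumes A: "A \<in> SO_block k" and B: "B \<in> SO_block k"
  shows "A * B \<in> SO_block k"
proof -
  have c: "A \<in> carrier_mat (k+1) (k+1)" "B \<in> carrier_mat (k+1) (k+1)" using A B block_carriers(1) by blast+
  have "(A * B) $$ (0, 0) = (\<Sum>x<k+1. A $$ (0, x) * B $$ (x, 0))" by (rule mat_mult_index[OF c]) auto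
  also have "\<dots> = 1"
    using A B RQ.stabilizer_entries(3)[of A k] by (simp add: sum.lessThan_Suc_shift del: sum.lessThan_Suc)
  finally show ?thesis using A B RQ.stabilizer_mult[of A k B] det_mult[OF c] by simp
qed

lemma SO_block_adjoint: "A \<in> SO_block k \<Longrightarrow> adjoint_mat id A \<in> SO_block k"
  using RQ.stabilizer_adjoint[of A k] RQ.det_adjoint[of A "k + 1"] RQ.adjoint_index[of A "k + 1" "k + 1" 0 0] block_carriers(1)[of k]
  by auto

lemma SU_block_mult: "A \<in> SU_block k \<Longrightarrow> B \<in> SU_block k \<Longrightarrow> A * B \<in> SU_block k"
  using CQ.stabilizer_mult[of A k B] det_mult[of A "k + 1" B] block_carriers(2)[of k] by auto

lemma SU_block_adjoint: "A \<in> SU_block k \<Longrightarrow> adjoint_mat cnj A \<in> SU_block k"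
  using CQ.stabilizer_adjoint[of A k] CQ.det_adjoint[of A "k + 1"] block_carriers(2)[of k] by auto

lemma hyp_K_one: "1\<^sub>m (k + 1) \<in> hyp_K F k"
proof (cases F)
  case RR
  show ?thesis unfolding RR hyp_K_eq by (rule RQ.image_one) (use RQ.stabilizer_one[of k] in simp)
next
  case CC
  show ?thesis unfolding CC hyp_K_eq by (rule CQ.image_one) (use CQ.stabilizer_one[of k] in simp)
next
  case HH
  show ?thesis unfolding HH hyp_K_eq by (rule HQ.image_one[OF HQ.stabilizer_one])
qed

lemma hyp_K_mult:
  assumes "g \<in> hyp_K F k" "h \<in> hyp_K F k"
  shows "g * h \<in> hyp_K F k"
proof (cases F)
  case RR
  show ?thesis using assms unfolding RR hyp_K_eq by (rule RQ.image_mult[OF _ _ block_carriers(1)]) (rule SO_block_mult)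
next
  case CC
  show ?thesis using assms unfolding CC hyp_K_eq by (rule CQ.image_mult[OF _ _ block_carriers(2)]) (rule SU_block_mult)
next
  case HH
  show ?thesis using assms unfolding HH hyp_K_eq by (rule HQ.image_mult[OF _ _ block_carriers(3)]) (rule HQ.stabilizer_mult)
qed

lemma hyp_K_adjoint:
  assumes "g \<in> hyp_K F k"
  shows "adjoint_mat qcnj g \<in> hyp_K F k"
proof (cases F)
  case RR
  show ?thesis using assms unfolding RR hyp_K_eq by (rule RQ.image_adjoint) (rule SO_block_adjoint)
next
  case CC
  show ?thesis using assms unfolding CC hyp_K_eq by (rule CQ.image_adjoint) (rule SU_block_adjoint)
next
  case HH
  show ?thesis using assms unfolding HH hyp_K_eq by (rule HQ.image_adjoint) (rule HQ.stabilizer_adjoint)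
qed

lemma rotation_hyp_K:
  assumes pq: "p \<noteq> q" "1 \<le> p" "p \<le> k" "1 \<le> q" "q \<le> k"
  shows "rotation k p q t \<in> hyp_K F k"
proof (cases F)
  case RR
  have "rotation k p q t $$ (0, 0) = (1 :: real)" using pq by (simp add: rotation_def plane_mat_def)
  then have "rotation k p q t \<in> SO_block k"
    using RQ.rotation_stabilizer[OF pq, of t] rotation_SO_1[OF pq, of t] by (simp add: SO_1_def)
  then show ?thesis unfolding RR hyp_K_eq by (rule RQ.image_rotation)
next
  case CC
  have "rotation k p q t \<in> SU_block k"
    using CQ.rotation_stabilizer[OF pq, of t] rotation_SU_1[OF pq, of t] by (simp add: SU_1_def)
  then show ?thesis unfolding CC hyp_K_eq by (rule CQ.image_rotation)
next
  case HH
  show ?thesis unfolding HH hyp_K_HH by (rule HQ.rotation_stabilizer[OF pq])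
qed

text \<open>
  The phase \<open>g\<^sub>0\<^sub>0 / \<bar>g\<^sub>0\<^sub>0\<bar>\<close> of the corner entry goes into the \<open>1 \<times> 1\<close> block of the left factor. For
  \<open>F = \<real>\<close> it equals 1, because the corner is positive on the identity component.
\<close>

lemma hyp_cartan_decomposition:
  assumes g: "g \<in> hyp_G F k" and k: "2 \<le> k"
  obtains t h r where "t \<ge> 0" "h \<in> hyp_K F k" "r \<in> hyp_K F k" "g = h * hyp_a k t * r"
proof -
  have k1: "1 \<le> k" using k by simp
  have a: "hyp_a k t = boost k t" for t by (rule hyp_a_boost[OF k1])
  show thesis
  proof (cases F)
    case RR
    then obtain A where A: "A \<in> SOo_1 k" "g = map_mat of_real A" using g by auto
    have AL: "A \<in> lorentz_mats id k" "Determinant.det A = 1" using SOo_1_subset[OF A(1)] by (auto simp: SO_1_def)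
    obtain t h r where *: "t \<ge> 0" "h \<in> RQ.stabilizer k" "Determinant.det h = 1"
      "h $$ (0, 0) = A $$ (0, 0) / of_real (norm (A $$ (0, 0)))" "r \<in> RQ.stabilizer k" "r $$ (0, 0) = 1" "Determinant.det r = 1"
      "A = h * boost k t * r"
      using RQ.cartan_factorization_det_1[OF AL k] by metis
    have h0: "h $$ (0, 0) = 1" using *(4) SOo_1_corner_ge_1[OF A(1)] by simp
    have c: "h \<in> carrier_mat (k+1) (k+1)" "r \<in> carrier_mat (k+1) (k+1)"
      using *(2,5) by (auto simp: RQ.stabilizer_def lorentz_mats_def)
    have "g = map_mat of_real h * boost k t * map_mat of_real r"
      unfolding A(2) *(8) RQ.map_\<phi>_mult3[OF c(1) boost_carrier c(2)] RQ.map_\<phi>_boost ..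
    then have eq: "g = map_mat of_real h * hyp_a k t * map_mat of_real r" unfolding a .
    show thesis
      by (rule that[OF *(1) _ _ eq]; unfold RR hyp_K_RR; rule imageI) (use * h0 in simp_all)
  next
    case CC
    then obtain A where A: "A \<in> SU_1 k" "g = map_mat quat_of_complex A" using g by auto
    have AL: "A \<in> lorentz_mats cnj k" "Determinant.det A = 1" using A(1) by (auto simp: SU_1_def)
    obtain t h r where *: "t \<ge> 0" "h \<in> CQ.stabilizer k" "Determinant.det h = 1"
      "r \<in> CQ.stabilizer k" "Determinant.det r = 1" "A = h * boost k t * r"
      using CQ.cartan_factorization_det_1[OF AL k] by metis
    have c: "h \<in> carrier_mat (k+1) (k+1)" "r \<in> carrier_mat (k+1) (k+1)"
      using *(2,4) by (auto simp: CQ.stabilizer_def lorentz_mats_def)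
    have "g = map_mat quat_of_complex h * boost k t * map_mat quat_of_complex r"
      unfolding A(2) *(6) CQ.map_\<phi>_mult3[OF c(1) boost_carrier c(2)] CQ.map_\<phi>_boost ..
    then have eq: "g = map_mat quat_of_complex h * hyp_a k t * map_mat quat_of_complex r" unfolding a .
    show thesis
      by (rule that[OF *(1) _ _ eq]; unfold CC hyp_K_CC; rule imageI) (use * in simp_all)
  next
    case HH
    have gL: "g \<in> lorentz_mats qcnj k" using g HH by (simp add: Sp_1_def)
    obtain t v where t: "t \<ge> 0" "norm (g $$ (0, 0)) = cosh t" "(\<Sum>i<k. (norm (v i))\<^sup>2) = 1"
      "\<And>i. i < k \<Longrightarrow> g $$ (Suc i, 0) = v i * of_real (sinh t)"
      using HQ.polar_first_column[OF gL k1] by metis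
    obtain B where B: "B \<in> unitary_mats qcnj k" "\<And>i. i < k \<Longrightarrow> B $$ (i, k - 1) = v i"
      using HQ.unitary_with_last_column[OF k1 t(3)] by metis
    define q where "q = g $$ (0, 0) * of_real (inverse (cosh t))"
    have ch: "cosh t > 0" by (rule cosh_real_pos)
    have "norm q = norm (g $$ (0, 0)) * inverse (cosh t)"
      unfolding q_def norm_mult norm_of_real using ch by simp
    then have q: "norm q = 1" using t(2) ch by simp
    have inv: "inverse (cosh t) * cosh t = 1" using ch by simp
    have q': "q * of_real (cosh t) = g $$ (0, 0)"
    proof -
      have "of_real (inverse (cosh t)) * of_real (cosh t) = (of_real (inverse (cosh t) * cosh t) :: quat)"
        by (rule of_real_mult[symmetric])
      also have "\<dots> = 1" unfolding inv by (rule of_real_1)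
      finally have "of_real (inverse (cosh t)) * of_real (cosh t) = (1 :: quat)" .
      then show ?thesis unfolding q_def by (metis mult.assoc mult_1_right)
    qed
    define A where "A = Matrix.mat 1 1 (\<lambda>_. q)"
    have A: "A \<in> unitary_mats qcnj 1" "A $$ (0, 0) = q" unfolding A_def using HQ.unit_1x1_unitary[OF q] by simp_all
    obtain r where r: "r \<in> HQ.stabilizer k" "g = block_diag A B * boost k t * r"
      using HQ.cartan_factorization[OF gL k1 A(1) _ B(1)] A(2) q' B(2) t(4) by metis
    show thesis
      by (rule that[OF t(1)]) (unfold HH hyp_K_HH a, rule HQ.block_diag_stabilizer[OF A(1) B(1)], rule r(1), rule r(2))
  qed
qed

section \<open>The hyperbolic distance\<close>

abbreviation hyp_coset :: "hscalar \<Rightarrow> nat \<Rightarrow> quat mat \<Rightarrow> quat mat set" where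
  "hyp_coset F k x \<equiv> x <#\<^bsub>hyp_group F k\<^esub> hyp_K F k"

lemma hyp_group_simps [simp]:
  "carrier (hyp_group F k) = hyp_G F k" "x \<otimes>\<^bsub>hyp_group F k\<^esub> y = x * y" "\<one>\<^bsub>hyp_group F k\<^esub> = 1\<^sub>m (k + 1)"
  by (simp_all add: hyp_group_def)

lemma hyp_l_coset: "x <#\<^bsub>hyp_group F k\<^esub> S = (\<lambda>h. x * h) ` S"
  by (auto simp: l_coset_def)

lemma hyp_G_carrier: "g \<in> hyp_G F k \<Longrightarrow> g \<in> carrier_mat (k + 1) (k + 1)"
  using hyp_G_subset[of F k] by (auto simp: lorentz_mats_def)

lemma hyp_K_carrier: "h \<in> hyp_K F k \<Longrightarrow> h \<in> carrier_mat (k + 1) (k + 1)"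
  using hyp_K_subset[of F k] by (auto simp: HQ.stabilizer_def lorentz_mats_def)

lemma group_hyp_group: "group (hyp_group F k)"
proof (rule groupI, unfold hyp_group_simps)
  fix x y z assume "x \<in> hyp_G F k" "y \<in> hyp_G F k" "z \<in> hyp_G F k"
  then show "x * y * z = x * (y * z)" using assoc_mult_mat hyp_G_carrier by blast
next
  fix x assume x: "x \<in> hyp_G F k"
  show "1\<^sub>m (k + 1) * x = x" by (rule left_mult_one_mat[OF hyp_G_carrier[OF x]])
  show "\<exists>y\<in>hyp_G F k. y * x = 1\<^sub>m (k + 1)"
    using hyp_G_inv[OF x] HQ.lorentz_inv_mult(2)[of x k] hyp_G_subset[of F k] x by blast
next
  show "1\<^sub>m (k + 1) \<in> hyp_G F k" by (rule hyp_G_one)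
qed (rule hyp_G_mult)

lemma inv_hyp_group:
  assumes y: "y \<in> hyp_G F k"
  shows "inv\<^bsub>hyp_group F k\<^esub> y = HQ.lorentz_inv k y"
  by (rule group.inv_equality[OF group_hyp_group])
    (use hyp_G_inv[OF y] y HQ.lorentz_inv_mult(2)[of y k] hyp_G_subset[of F k] in auto)

text \<open>
  The Lorentz form on the first columns. The points of \<open>H\<^sub>k(F)\<close> are the lines of positive vectors,
  spanned by first columns, and their distance only depends on this pairing.
\<close>

definition lorentz_pairing :: "nat \<Rightarrow> quat mat \<Rightarrow> quat mat \<Rightarrow> quat" where
  "lorentz_pairing k y x = qcnj (y $$ (0, 0)) * x $$ (0, 0) - (\<Sum>l<k. qcnj (y $$ (Suc l, 0)) * x $$ (Suc l, 0))"

lemma lorentz_pairing_eq: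
  assumes "y \<in> carrier_mat (k + 1) (k + 1)" "x \<in> carrier_mat (k + 1) (k + 1)"
  shows "(adjoint_mat qcnj y * lorentz_form k * x) $$ (0, 0) = lorentz_pairing k y x"
  unfolding lorentz_pairing_def by (rule HQ.lorentz_form_entry[OF assms]) auto

lemma lorentz_pairing_inv:
  assumes y: "y \<in> carrier_mat (k + 1) (k + 1)" and x: "x \<in> carrier_mat (k + 1) (k + 1)"
  shows "(HQ.lorentz_inv k y * x) $$ (0, 0) = lorentz_pairing k y x"
proof -
  note J = lorentz_form_carrier(1)[of k, where ?'a=quat] and s = square_mult_carrier
  have a: "adjoint_mat qcnj y \<in> carrier_mat (k + 1) (k + 1)" using y by simp
  have "HQ.lorentz_inv k y * x = lorentz_form k * (adjoint_mat qcnj y * lorentz_form k * x)"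
    unfolding HQ.lorentz_inv_def assoc_mult_mat[OF J a J]
    by (rule assoc_mult_mat[OF J s[OF a J] x])
  moreover have z: "0 < k + 1" by simp
  ultimately show ?thesis
    by (simp only: lorentz_form_mult_index[OF s[OF s[OF a J] x] z z] if_P[OF refl] lorentz_pairing_eq[OF y x])
qed

lemma lorentz_pairing_invariant:
  assumes g: "g \<in> lorentz_mats qcnj k" and y: "y \<in> carrier_mat (k + 1) (k + 1)" and x: "x \<in> carrier_mat (k + 1) (k + 1)"
  shows "lorentz_pairing k (g * y) (g * x) = lorentz_pairing k y x"
proof -
  note gc = HQ.lorentz_matsD(1)[OF g] and s = square_mult_carrier
  show ?thesis
    unfolding lorentz_pairing_eq[OF s[OF gc y] s[OF gc x], symmetric] lorentz_pairing_eq[OF y x, symmetric]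
      HQ.adjoint_form_mult[OF gc y x lorentz_form_carrier(1) HQ.lorentz_matsD(2)[OF g]] ..
qed

lemma mult_stabilizer_column:
  assumes x: "x \<in> carrier_mat (k + 1) (k + 1)" and h: "h \<in> HQ.stabilizer k" and i: "i < k + 1"
  shows "(x * h) $$ (i, 0) = x $$ (i, 0) * h $$ (0, 0)"
proof -
  have hc: "h \<in> carrier_mat (k + 1) (k + 1)" using h by (auto simp: HQ.stabilizer_def lorentz_mats_def)
  have z: "0 < k + 1" by simp
  have "(x * h) $$ (i, 0) = (\<Sum>l<k+1. x $$ (i, l) * h $$ (l, 0))" by (rule mat_mult_index[OF x hc i z])
  also have "\<dots> = x $$ (i, 0) * h $$ (0, 0) + (\<Sum>l<k. x $$ (i, Suc l) * h $$ (Suc l, 0))"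
    unfolding Suc_eq_plus1[symmetric] by (rule sum.lessThan_Suc_shift)
  also have "(\<Sum>l<k. x $$ (i, Suc l) * h $$ (Suc l, 0)) = 0"
    by (rule sum.neutral) (simp add: HQ.stabilizer_entries(2)[OF h])
  finally show ?thesis by (simp only: add_0_right)
qed

lemma norm_lorentz_pairing_stabilizer:
  assumes x: "x \<in> carrier_mat (k + 1) (k + 1)" and y: "y \<in> carrier_mat (k + 1) (k + 1)"
    and h: "h \<in> HQ.stabilizer k" and h': "h' \<in> HQ.stabilizer k"
  shows "norm (lorentz_pairing k (y * h') (x * h)) = norm (lorentz_pairing k y x)"
proof -
  have "lorentz_pairing k (y * h') (x * h) = qcnj (h' $$ (0, 0)) * lorentz_pairing k y x * h $$ (0, 0)"
    unfolding lorentz_pairing_def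
    by (simp add: mult_stabilizer_column[OF x h] mult_stabilizer_column[OF y h'] HQ.cj_mult
      right_diff_distrib left_diff_distrib mult.assoc sum_distrib_left sum_distrib_right del: index_mult_mat(1))
  then show ?thesis
    using HQ.stabilizer_entries(1)[OF h] HQ.stabilizer_entries(1)[OF h'] by (simp add: norm_mult)
qed

lemma mem_hyp_coset: "x \<in> hyp_G F k \<Longrightarrow> x \<in> hyp_coset F k x"
  unfolding hyp_l_coset
  by (rule image_eqI[OF _ hyp_K_one]) (simp only: right_mult_one_mat[OF hyp_G_carrier])

lemma hyp_coset_eqD:
  assumes "x' \<in> hyp_G F k" "hyp_coset F k x = hyp_coset F k x'"
  obtains h where "h \<in> hyp_K F k" "x' = x * h"
  using mem_hyp_coset[OF assms(1)] assms(2) unfolding hyp_l_coset by blast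

lemma hyp_space_iff: "X \<in> hyp_space F k \<longleftrightarrow> (\<exists>x\<in>hyp_G F k. X = hyp_coset F k x)"
  by (auto simp: hyp_space_def LCOSETS_def)

lemma hyp_act_coset:
  assumes "g \<in> hyp_G F k" "x \<in> hyp_G F k"
  shows "g <#\<^bsub>hyp_group F k\<^esub> hyp_coset F k x = hyp_coset F k (g * x)"
  unfolding hyp_l_coset image_image
  by (rule image_cong[OF refl])
    (rule assoc_mult_mat[OF hyp_G_carrier[OF assms(1)] hyp_G_carrier[OF assms(2)] hyp_K_carrier, symmetric])

lemma dbl_coset_eq: "dbl_coset F k g = {h * (g * r) | h r. h \<in> hyp_K F k \<and> r \<in> hyp_K F k}"
  by (auto simp: dbl_coset_def set_mult_def hyp_l_coset)

lemma dbl_coset_invariant: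
  assumes a: "a \<in> carrier_mat (k + 1) (k + 1)" and h: "h \<in> hyp_K F k" and r: "r \<in> hyp_K F k"
  shows "dbl_coset F k (h * a * r) = dbl_coset F k a"
proof -
  note c = hyp_K_carrier and s = square_mult_carrier
  have sub: "dbl_coset F k (h * a * r) \<subseteq> dbl_coset F k a"
    if a: "a \<in> carrier_mat (k + 1) (k + 1)" and h: "h \<in> hyp_K F k" and r: "r \<in> hyp_K F k" for a h r
  proof
    fix m assume "m \<in> dbl_coset F k (h * a * r)"
    then obtain u v where uv: "u \<in> hyp_K F k" "v \<in> hyp_K F k" "m = u * (h * a * r * v)" unfolding dbl_coset_eq by blast
    have "h * a * r * v = h * (a * (r * v))"
      using assoc_mult_mat[OF s[OF c[OF h] a] c[OF r] c[OF uv(2)]] assoc_mult_mat[OF c[OF h] a s[OF c[OF r] c[OF uv(2)]]] by simp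
    then have "m = u * h * (a * (r * v))"
      using uv(3) assoc_mult_mat[OF c[OF uv(1)] c[OF h] s[OF a s[OF c[OF r] c[OF uv(2)]]]] by simp
    then show "m \<in> dbl_coset F k a"
      unfolding dbl_coset_eq using hyp_K_mult uv(1,2) h r by blast
  qed
  have inv: "adjoint_mat qcnj u * u = 1\<^sub>m (k + 1)" "u * adjoint_mat qcnj u = 1\<^sub>m (k + 1)" if "u \<in> hyp_K F k" for u
    using HQ.unitary_matsD(2,3)[of u "k + 1"] hyp_K_subset[of F k] that by (auto simp: HQ.stabilizer_def)
  let ?h = "adjoint_mat qcnj h" and ?r = "adjoint_mat qcnj r"
  note hk = hyp_K_adjoint[OF h] and rk = hyp_K_adjoint[OF r]
  have "?h * (h * a * r) * ?r = ?h * (h * a * r * ?r)"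
    by (rule assoc_mult_mat[OF c[OF hk] s[OF s[OF c[OF h] a] c[OF r]] c[OF rk]])
  also have "h * a * r * ?r = h * a"
    using assoc_mult_mat[OF s[OF c[OF h] a] c[OF r] c[OF rk]] inv(2)[OF r] right_mult_one_mat[OF s[OF c[OF h] a]] by simp
  also have "?h * (h * a) = a"
    using assoc_mult_mat[OF c[OF hk] c[OF h] a] inv(1)[OF h] left_mult_one_mat[OF a] by simp
  finally have "?h * (h * a * r) * ?r = a" .
  then show ?thesis
    using sub[OF a h r] sub[OF s[OF s[OF c[OF h] a] c[OF r]] hk rk] by auto
qed

lemma hyp_a_carrier: "hyp_a k t \<in> carrier_mat (k + 1) (k + 1)"
  by (simp add: hyp_a_def)

text \<open>
  Multiplying by \<open>K\<close> from either side changes the corner entry of \<open>y\<^sup>-\<^sup>1 x\<close> by a phase only, and for \<open>a\<^sub>t\<close>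
  this entry is \<open>cosh t\<close>. This gives uniqueness of the parameter of the double coset; its existence is
  the Cartan decomposition.
\<close>

lemma hyp_dist_coset:
  assumes k: "2 \<le> k" and x: "x \<in> hyp_G F k" and y: "y \<in> hyp_G F k"
  shows "hyp_dist F k (hyp_coset F k x) (hyp_coset F k y) \<ge> 0"
    "cosh (hyp_dist F k (hyp_coset F k x) (hyp_coset F k y)) = norm (lorentz_pairing k y x)"
proof -
  note c = hyp_G_carrier and s = square_mult_carrier
  define P where "P t \<longleftrightarrow> t \<ge> 0 \<and> (\<exists>x'\<in>hyp_G F k. \<exists>y'\<in>hyp_G F k.
     hyp_coset F k x = hyp_coset F k x' \<and> hyp_coset F k y = hyp_coset F k y' \<and>
     dbl_coset F k (inv\<^bsub>hyp_group F k\<^esub> y' \<otimes>\<^bsub>hyp_group F k\<^esub> x') = dbl_coset F k (hyp_a k t))" for t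
  have P_cosh: "t \<ge> 0 \<and> cosh t = norm (lorentz_pairing k y x)" if "P t" for t
  proof -
    obtain x' y' where *: "t \<ge> 0" "x' \<in> hyp_G F k" "y' \<in> hyp_G F k" "hyp_coset F k x = hyp_coset F k x'"
      "hyp_coset F k y = hyp_coset F k y'" "dbl_coset F k (HQ.lorentz_inv k y' * x') = dbl_coset F k (hyp_a k t)"
      using \<open>P t\<close> unfolding P_def using inv_hyp_group by fastforce
    obtain h h' where h: "h \<in> hyp_K F k" "x' = x * h" "h' \<in> hyp_K F k" "y' = y * h'"
      using hyp_coset_eqD[OF *(2,4)] hyp_coset_eqD[OF *(3,5)] by metis
    have m: "HQ.lorentz_inv k y' * x' \<in> hyp_G F k" by (intro hyp_G_mult hyp_G_inv *)
    have "1\<^sub>m (k+1) * (HQ.lorentz_inv k y' * x' * 1\<^sub>m (k+1)) = HQ.lorentz_inv k y' * x'"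
      unfolding right_mult_one_mat[OF c[OF m]] by (rule left_mult_one_mat[OF c[OF m]])
    then have "HQ.lorentz_inv k y' * x' \<in> dbl_coset F k (HQ.lorentz_inv k y' * x')"
      unfolding dbl_coset_eq by - (intro CollectI exI conjI, erule sym, (rule hyp_K_one)+)
    then obtain u v where uv: "u \<in> hyp_K F k" "v \<in> hyp_K F k" "HQ.lorentz_inv k y' * x' = u * (hyp_a k t * v)"
      unfolding *(6) unfolding dbl_coset_eq by blast
    have us: "u \<in> HQ.stabilizer k" "v \<in> HQ.stabilizer k" "h \<in> HQ.stabilizer k" "h' \<in> HQ.stabilizer k"
      using uv h hyp_K_subset by blast+
    have av: "(hyp_a k t * v) $$ (0, 0) = of_real (cosh t) * v $$ (0, 0)"
      using mult_stabilizer_column[OF hyp_a_carrier us(2), of 0 t] by (simp add: hyp_a_def)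
    have "(u * (hyp_a k t * v)) $$ (0, 0) = (\<Sum>l<k+1. u $$ (0, l) * (hyp_a k t * v) $$ (l, 0))"
      by (rule mat_mult_index[OF hyp_K_carrier[OF uv(1)] s[OF hyp_a_carrier hyp_K_carrier[OF uv(2)]]]) auto
    also have "\<dots> = u $$ (0, 0) * (of_real (cosh t) * v $$ (0, 0))"
      using HQ.stabilizer_entries(3)[OF us(1)] by (simp add: sum.lessThan_Suc_shift av del: sum.lessThan_Suc index_mult_mat(1))
    finally have "lorentz_pairing k y' x' = u $$ (0, 0) * (of_real (cosh t) * v $$ (0, 0))"
      unfolding uv(3)[symmetric] lorentz_pairing_inv[OF c[OF *(3)] c[OF *(2)]] .
    then have "norm (lorentz_pairing k y' x') = cosh t"
      using HQ.stabilizer_entries(1)[OF us(1)] HQ.stabilizer_entries(1)[OF us(2)] by (simp add: norm_mult)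
    then show ?thesis
      unfolding h(2,4) norm_lorentz_pairing_stabilizer[OF c[OF x] c[OF y] us(3,4)] using *(1) by simp
  qed
  have "HQ.lorentz_inv k y * x \<in> hyp_G F k" by (intro hyp_G_mult hyp_G_inv x y)
  then obtain t h r where thr: "t \<ge> 0" "h \<in> hyp_K F k" "r \<in> hyp_K F k" "HQ.lorentz_inv k y * x = h * hyp_a k t * r"
    using hyp_cartan_decomposition[OF _ k] by metis
  have "dbl_coset F k (HQ.lorentz_inv k y * x) = dbl_coset F k (hyp_a k t)"
    unfolding thr(4) by (rule dbl_coset_invariant[OF hyp_a_carrier thr(2,3)])
  then have "P t"
    unfolding P_def hyp_group_simps inv_hyp_group[OF y, symmetric]
    by (intro conjI bexI[of _ x] bexI[of _ y] refl thr(1) x y)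
  moreover have "t' = t" if "P t'" for t'
    using P_cosh[OF that] P_cosh[OF \<open>P t\<close>] arcosh_cosh_real by metis
  ultimately have "P (THE t. P t)" by (rule theI)
  then have "P (hyp_dist F k (hyp_coset F k x) (hyp_coset F k y))"
    by (simp only: hyp_dist_def P_def)
  then show "hyp_dist F k (hyp_coset F k x) (hyp_coset F k y) \<ge> 0"
    "cosh (hyp_dist F k (hyp_coset F k x) (hyp_coset F k y)) = norm (lorentz_pairing k y x)"
    using P_cosh by blast+
qed

lemma bounded_linear_quat_sel: "bounded_linear qre" "bounded_linear qi" "bounded_linear qj" "bounded_linear qk"
  by (rule bounded_linear_intro[where K=1];
      simp add: scaleR_quat_def norm_quat_def real_le_rsqrt)+

lemma space_hyp_borel [simp]: "space (hyp_borel F k) = hyp_space F k"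
  unfolding hyp_borel_def by (rule space_measure_of) blast

text \<open>
  A function on \<open>G/K\<close> that is continuous as a function on \<open>G\<close> is continuous for the quotient topology.
\<close>

lemma hyp_borel_measurableI:
  fixes f :: "quat mat set \<Rightarrow> real"
  assumes f': "continuous_map (subtopology (mat_topology (k + 1)) (hyp_G F k)) euclideanreal f'"
    and eq: "\<And>x. x \<in> hyp_G F k \<Longrightarrow> f (hyp_coset F k x) = f' x"
  shows "f \<in> borel_measurable (hyp_borel F k)"
proof (rule borel_measurableI)
  fix S :: "real set" assume S: "open S"
  let ?T = "subtopology (mat_topology (k + 1)) (hyp_G F k)"
  have "openin ?T {x \<in> topspace ?T. f' x \<in> S}"
    by (rule openin_continuous_map_preimage[OF f']) (use S in simp)
  also have "{x \<in> topspace ?T. f' x \<in> S} = {x \<in> hyp_G F k. hyp_coset F k x \<in> f -` S \<inter> space (hyp_borel F k)}"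
    using eq hyp_G_carrier[of _ F k] hyp_space_iff[of _ F k] by auto
  finally have "f -` S \<inter> hyp_space F k \<in> {U. U \<subseteq> hyp_space F k \<and> openin ?T {x \<in> hyp_G F k. hyp_coset F k x \<in> U}}"
    by simp
  then show "f -` S \<inter> space (hyp_borel F k) \<in> sets (hyp_borel F k)"
    unfolding space_hyp_borel unfolding hyp_borel_def by (rule in_measure_of[rotated]) blast
qed

text \<open>
  The entries of the rank-one matrix \<open>x e\<^sub>0 e\<^sub>0\<^sup>* x\<^sup>*\<close>, which is a function of the coset \<open>X = xK\<close>. These are
  coordinates on \<open>G/K\<close> in which the squared pairing of two points is a polynomial.
\<close>

definition hyp_proj :: "hscalar \<Rightarrow> nat \<Rightarrow> nat \<Rightarrow> nat \<Rightarrow> quat mat set \<Rightarrow> quat" where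
  "hyp_proj F k i j X = (let x = SOME x. x \<in> hyp_G F k \<and> X = hyp_coset F k x in x $$ (i, 0) * qcnj (x $$ (j, 0)))"

lemma hyp_proj_coset:
  assumes x: "x \<in> hyp_G F k" and ij: "i < k + 1" "j < k + 1"
  shows "hyp_proj F k i j (hyp_coset F k x) = x $$ (i, 0) * qcnj (x $$ (j, 0))"
proof -
  define y where "y = (SOME y. y \<in> hyp_G F k \<and> hyp_coset F k x = hyp_coset F k y)"
  have y: "y \<in> hyp_G F k" "hyp_coset F k x = hyp_coset F k y"
    using someI[of "\<lambda>y. y \<in> hyp_G F k \<and> hyp_coset F k x = hyp_coset F k y" x] x unfolding y_def by auto
  obtain h where h: "h \<in> hyp_K F k" "y = x * h" using hyp_coset_eqD[OF y] by blast
  have hs: "h \<in> HQ.stabilizer k" using h(1) hyp_K_subset by blast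
  have "y $$ (i, 0) * qcnj (y $$ (j, 0)) = x $$ (i, 0) * (h $$ (0, 0) * qcnj (h $$ (0, 0))) * qcnj (x $$ (j, 0))"
    unfolding h(2) mult_stabilizer_column[OF hyp_G_carrier[OF x] hs ij(1)] mult_stabilizer_column[OF hyp_G_carrier[OF x] hs ij(2)]
      HQ.cj_mult mult.assoc ..
  also have "h $$ (0, 0) * qcnj (h $$ (0, 0)) = 1"
    unfolding HQ.cj_mult_self HQ.stabilizer_entries(1)[OF hs] by simp
  finally show ?thesis by (simp add: hyp_proj_def y_def[symmetric])
qed

lemma hyp_proj_measurable:
  assumes ij: "i < k + 1" "j < k + 1"
  shows "(\<lambda>X. qre (hyp_proj F k i j X)) \<in> borel_measurable (hyp_borel F k)"
    "(\<lambda>X. qi (hyp_proj F k i j X)) \<in> borel_measurable (hyp_borel F k)"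
    "(\<lambda>X. qj (hyp_proj F k i j X)) \<in> borel_measurable (hyp_borel F k)"
    "(\<lambda>X. qk (hyp_proj F k i j X)) \<in> borel_measurable (hyp_borel F k)"
proof -
  let ?T = "subtopology (mat_topology (k + 1)) (hyp_G F k)"
  have entry: "continuous_map ?T euclideanreal (\<lambda>x. l (x $$ (i, 0)))"
    if l: "bounded_linear l" and i: "i < k + 1" for l i
  proof -
    have "continuous_map euclidean euclideanreal l"
      using linear_continuous_on[OF l] by simp
    moreover have "continuous_map ?T euclidean (\<lambda>x. x $$ (i, 0))"
      by (rule continuous_map_from_subtopology[OF continuous_map_mat_entry]) (use i in auto)
    ultimately have "continuous_map ?T euclideanreal (l \<circ> (\<lambda>x. x $$ (i, 0)))"
      using continuous_map_compose by blast
    then show ?thesis by (simp add: comp_def)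
  qed
  note e = entry[OF bounded_linear_quat_sel(1)] entry[OF bounded_linear_quat_sel(2)]
    entry[OF bounded_linear_quat_sel(3)] entry[OF bounded_linear_quat_sel(4)]
  note intros = continuous_map_add continuous_map_diff continuous_map_minus continuous_map_real_mult e ij
  have proj: "(\<lambda>X. l (hyp_proj F k i j X)) \<in> borel_measurable (hyp_borel F k)"
    if "continuous_map ?T euclideanreal (\<lambda>x. l (x $$ (i, 0) * qcnj (x $$ (j, 0))))" for l
    by (rule hyp_borel_measurableI[OF that]) (simp only: hyp_proj_coset[OF _ ij])
  show "(\<lambda>X. qre (hyp_proj F k i j X)) \<in> borel_measurable (hyp_borel F k)"
    "(\<lambda>X. qi (hyp_proj F k i j X)) \<in> borel_measurable (hyp_borel F k)"
    "(\<lambda>X. qj (hyp_proj F k i j X)) \<in> borel_measurable (hyp_borel F k)"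
    "(\<lambda>X. qk (hyp_proj F k i j X)) \<in> borel_measurable (hyp_borel F k)"
    by (rule proj, unfold quat_sel_mult qcnj_sel, intro intros)+
qed

definition lorentz_sign :: "nat \<Rightarrow> real" where "lorentz_sign i = (if i = 0 then 1 else - 1)"

text \<open>
  The right hand side separates the variables \<open>X\<close> and \<open>Y\<close>, which yields measurability of the distance for
  the product \<open>\<sigma>\<close>-algebra.
\<close>

lemma cosh_square_hyp_dist:
  assumes k: "2 \<le> k" and X: "X \<in> hyp_space F k" and Y: "Y \<in> hyp_space F k"
  shows "(cosh (hyp_dist F k X Y))\<^sup>2 =
    (\<Sum>i<k+1. \<Sum>j<k+1. lorentz_sign i * lorentz_sign j * qre (hyp_proj F k i j X * hyp_proj F k j i Y))"
proof -
  obtain x y where x: "x \<in> hyp_G F k" "X = hyp_coset F k x" and y: "y \<in> hyp_G F k" "Y = hyp_coset F k y"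
    using X Y unfolding hyp_space_iff by blast
  have pair: "lorentz_pairing k y x = (\<Sum>i<k+1. lorentz_sign i *\<^sub>R (qcnj (y $$ (i, 0)) * x $$ (i, 0)))"
    by (simp add: lorentz_pairing_def lorentz_sign_def sum.lessThan_Suc_shift sum_negf del: sum.lessThan_Suc)
  have scaleR: "qre (r *\<^sub>R u) = r * qre u" "qcnj (r *\<^sub>R u) = r *\<^sub>R qcnj u" for r u
    by (simp_all add: scaleR_quat_def qcnj_def)
  have "(cosh (hyp_dist F k X Y))\<^sup>2 = qre (lorentz_pairing k y x * qcnj (lorentz_pairing k y x))"
    unfolding x(2) y(2) hyp_dist_coset(2)[OF k x(1) y(1)] HQ.cj_mult_self quat_sel ..
  also have "\<dots> = (\<Sum>i<k+1. \<Sum>j<k+1. qre ((lorentz_sign i *\<^sub>R (qcnj (y $$ (i, 0)) * x $$ (i, 0))) *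
      (lorentz_sign j *\<^sub>R (qcnj (x $$ (j, 0)) * y $$ (j, 0)))))"
    unfolding pair HQ.cj_sum sum_product quat_sel_sum scaleR HQ.cj_mult HQ.cj_cj ..
  also have "\<dots> = (\<Sum>i<k+1. \<Sum>j<k+1. lorentz_sign i * lorentz_sign j * qre (hyp_proj F k i j X * hyp_proj F k j i Y))"
  proof (intro sum.cong refl)
    fix i j assume "i \<in> {..<k+1}" "j \<in> {..<k+1}"
    then have ij: "i < k + 1" "j < k + 1" by auto
    have "qre (qcnj (y $$ (i, 0)) * x $$ (i, 0) * (qcnj (x $$ (j, 0)) * y $$ (j, 0))) =
      qre (x $$ (i, 0) * qcnj (x $$ (j, 0)) * (y $$ (j, 0) * qcnj (y $$ (i, 0))))"
      using qre_mult_commute[of "qcnj (y $$ (i, 0))" "x $$ (i, 0) * (qcnj (x $$ (j, 0)) * y $$ (j, 0))"] by (simp only: mult.assoc)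
    then show "qre ((lorentz_sign i *\<^sub>R (qcnj (y $$ (i, 0)) * x $$ (i, 0))) *
      (lorentz_sign j *\<^sub>R (qcnj (x $$ (j, 0)) * y $$ (j, 0)))) =
      lorentz_sign i * lorentz_sign j * qre (hyp_proj F k i j X * hyp_proj F k j i Y)"
      unfolding x(2) y(2) hyp_proj_coset[OF x(1) ij] hyp_proj_coset[OF y(1) ij(2,1)] by (simp add: scaleR)
  qed
  finally show ?thesis .
qed

lemma hyp_dist_nonneg: "2 \<le> k \<Longrightarrow> X \<in> hyp_space F k \<Longrightarrow> Y \<in> hyp_space F k \<Longrightarrow> hyp_dist F k X Y \<ge> 0"
  using hyp_dist_coset(1) unfolding hyp_space_iff by blast

lemma hyp_dist_measurable [measurable]:
  assumes k: "2 \<le> k"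
  shows "(\<lambda>(X, Y). hyp_dist F k X Y) \<in> borel_measurable (hyp_borel F k \<Otimes>\<^sub>M hyp_borel F k)"
proof -
  define S where "S X Y = (\<Sum>i<k+1. \<Sum>j<k+1. lorentz_sign i * lorentz_sign j * qre (hyp_proj F k i j X * hyp_proj F k j i Y))" for X Y
  have S: "(\<lambda>(X, Y). S X Y) \<in> borel_measurable (hyp_borel F k \<Otimes>\<^sub>M hyp_borel F k)"
  proof -
    have [measurable]: "(\<lambda>X. qre (hyp_proj F k i j X)) \<in> borel_measurable (hyp_borel F k)"
        "(\<lambda>X. qi (hyp_proj F k i j X)) \<in> borel_measurable (hyp_borel F k)"
        "(\<lambda>X. qj (hyp_proj F k i j X)) \<in> borel_measurable (hyp_borel F k)"
        "(\<lambda>X. qk (hyp_proj F k i j X)) \<in> borel_measurable (hyp_borel F k)"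
      if "i \<in> {..<k+1}" "j \<in> {..<k+1}" for i j using hyp_proj_measurable[of i k j F] that by auto
    show ?thesis unfolding S_def quat_sel_mult split_beta' by measurable
  qed
  have "(\<lambda>(X, Y). ln (sqrt (S X Y) + sqrt ((sqrt (S X Y))\<^sup>2 - 1))) \<in> borel_measurable (hyp_borel F k \<Otimes>\<^sub>M hyp_borel F k)"
    using S unfolding split_beta' by measurable
  then show ?thesis
  proof (rule measurable_cong[THEN iffD1, rotated])
    fix z assume "z \<in> space (hyp_borel F k \<Otimes>\<^sub>M hyp_borel F k)"
    then obtain X Y where z: "z = (X, Y)" "X \<in> hyp_space F k" "Y \<in> hyp_space F k"
      by (auto simp: space_pair_measure)
    let ?d = "hyp_dist F k X Y"
    have "sqrt (S X Y) = cosh ?d"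
      unfolding S_def cosh_square_hyp_dist[OF k z(2,3), symmetric] by simp
    then show "(case z of (X, Y) \<Rightarrow> ln (sqrt (S X Y) + sqrt ((sqrt (S X Y))\<^sup>2 - 1))) = (case z of (X, Y) \<Rightarrow> hyp_dist F k X Y)"
      using arcosh_real_def[OF cosh_real_ge_1[of ?d]] arcosh_cosh_real[OF hyp_dist_nonneg[OF k z(2,3)]] z(1) by simp
  qed
qed

lemma hyp_dist_commute:
  assumes k: "2 \<le> k" and X: "X \<in> hyp_space F k" and Y: "Y \<in> hyp_space F k"
  shows "hyp_dist F k X Y = hyp_dist F k Y X"
proof -
  obtain x y where x: "x \<in> hyp_G F k" "X = hyp_coset F k x" and y: "y \<in> hyp_G F k" "Y = hyp_coset F k y"
    using X Y unfolding hyp_space_iff by blast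
  have "lorentz_pairing k x y = qcnj (lorentz_pairing k y x)"
    by (simp add: lorentz_pairing_def HQ.cj_diff HQ.cj_mult HQ.cj_sum)
  then have "cosh (hyp_dist F k X Y) = cosh (hyp_dist F k Y X)"
    unfolding x(2) y(2) hyp_dist_coset(2)[OF k x(1) y(1)] hyp_dist_coset(2)[OF k y(1) x(1)] by simp
  then show ?thesis
    using arcosh_cosh_real hyp_dist_nonneg[OF k X Y] hyp_dist_nonneg[OF k Y X] by metis
qed

lemma hyp_dist_invariant:
  assumes k: "2 \<le> k" and g: "g \<in> hyp_G F k" and X: "X \<in> hyp_space F k" and Y: "Y \<in> hyp_space F k"
  shows "hyp_dist F k (g <#\<^bsub>hyp_group F k\<^esub> X) (g <#\<^bsub>hyp_group F k\<^esub> Y) = hyp_dist F k X Y"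
proof -
  obtain x y where x: "x \<in> hyp_G F k" "X = hyp_coset F k x" and y: "y \<in> hyp_G F k" "Y = hyp_coset F k y"
    using X Y unfolding hyp_space_iff by blast
  have "g \<in> lorentz_mats qcnj k" using g hyp_G_subset by blast
  note inv = lorentz_pairing_invariant[OF this hyp_G_carrier[OF y(1)] hyp_G_carrier[OF x(1)]]
  have "cosh (hyp_dist F k (g <#\<^bsub>hyp_group F k\<^esub> X) (g <#\<^bsub>hyp_group F k\<^esub> Y)) = cosh (hyp_dist F k X Y)"
    unfolding x(2) y(2) hyp_act_coset[OF g x(1)] hyp_act_coset[OF g y(1)]
      hyp_dist_coset(2)[OF k x(1) y(1)] hyp_dist_coset(2)[OF k hyp_G_mult[OF g x(1)] hyp_G_mult[OF g y(1)]] inv ..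
  moreover have "g <#\<^bsub>hyp_group F k\<^esub> X \<in> hyp_space F k" "g <#\<^bsub>hyp_group F k\<^esub> Y \<in> hyp_space F k"
    unfolding x(2) y(2) hyp_act_coset[OF g x(1)] hyp_act_coset[OF g y(1)] hyp_space_iff
    using hyp_G_mult[OF g x(1)] hyp_G_mult[OF g y(1)] by blast+
  ultimately show ?thesis
    using arcosh_cosh_real hyp_dist_nonneg[OF k] X Y by metis
qed

section \<open>Invariant kernels and the isotropy of a step\<close>

definition hyp_origin :: "hscalar \<Rightarrow> nat \<Rightarrow> quat mat set" where
  "hyp_origin F k = hyp_coset F k (1\<^sub>m (k + 1))"

lemma hyp_origin_in_space: "hyp_origin F k \<in> hyp_space F k"
  unfolding hyp_origin_def hyp_space_iff using hyp_G_one by blast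

lemma hyp_act_origin:
  assumes "g \<in> hyp_G F k"
  shows "g <#\<^bsub>hyp_group F k\<^esub> hyp_origin F k = hyp_coset F k g"
  unfolding hyp_origin_def hyp_act_coset[OF assms hyp_G_one] right_mult_one_mat[OF hyp_G_carrier[OF assms]] ..

lemma hyp_coset_stabilizer:
  assumes h: "h \<in> hyp_K F k"
  shows "hyp_coset F k h = hyp_origin F k"
proof -
  have inv: "h * adjoint_mat qcnj h = 1\<^sub>m (k + 1)"
    using HQ.unitary_matsD(3)[of h "k + 1"] hyp_K_subset[of F k] h by (auto simp: HQ.stabilizer_def)
  have "(\<lambda>u. h * u) ` hyp_K F k = hyp_K F k"
  proof
    show "hyp_K F k \<subseteq> (\<lambda>u. h * u) ` hyp_K F k"
    proof
      fix u assume u: "u \<in> hyp_K F k"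
      have "h * (adjoint_mat qcnj h * u) = u"
        unfolding assoc_mult_mat[OF hyp_K_carrier[OF h] hyp_K_carrier[OF hyp_K_adjoint[OF h]] hyp_K_carrier[OF u], symmetric] inv
        by (rule left_mult_one_mat[OF hyp_K_carrier[OF u]])
      then show "u \<in> (\<lambda>u. h * u) ` hyp_K F k"
        by (rule image_eqI[OF sym]) (rule hyp_K_mult[OF hyp_K_adjoint[OF h] u])
    qed
  qed (use hyp_K_mult[OF h] in blast)
  also have "\<dots> = (\<lambda>u. 1\<^sub>m (k + 1) * u) ` hyp_K F k"
  proof -
    have "(\<lambda>u. 1\<^sub>m (k + 1) * u) ` hyp_K F k = (\<lambda>u. u) ` hyp_K F k"
      by (rule image_cong[OF refl]) (rule left_mult_one_mat[OF hyp_K_carrier])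
    then show ?thesis by simp
  qed
  finally show ?thesis unfolding hyp_origin_def hyp_l_coset .
qed

lemma hyp_act_space:
  assumes g: "g \<in> hyp_G F k" and X: "X \<in> hyp_space F k"
  shows "g <#\<^bsub>hyp_group F k\<^esub> X \<in> hyp_space F k"
  using X unfolding hyp_space_iff using hyp_act_coset[OF g] hyp_G_mult[OF g] by blast

lemma hyp_act_inv:
  assumes g: "g \<in> hyp_G F k" and X: "X \<in> hyp_space F k"
  shows "g <#\<^bsub>hyp_group F k\<^esub> (HQ.lorentz_inv k g <#\<^bsub>hyp_group F k\<^esub> X) = X"
proof -
  obtain x where x: "x \<in> hyp_G F k" "X = hyp_coset F k x" using X unfolding hyp_space_iff by blast
  note i = hyp_G_inv[OF g] and c = hyp_G_carrier
  have "g * (HQ.lorentz_inv k g * x) = x"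
    unfolding assoc_mult_mat[OF c[OF g] c[OF i] c[OF x(1)], symmetric]
    using HQ.lorentz_inv_mult(3)[of g k] hyp_G_subset[of F k] g left_mult_one_mat[OF c[OF x(1)]] by auto
  then show ?thesis
    unfolding x(2) hyp_act_coset[OF i x(1)] hyp_act_coset[OF g hyp_G_mult[OF i x(1)]] by simp
qed

lemma kernel_space:
  assumes \<kappa>: "\<kappa> \<in> E \<rightarrow>\<^sub>M prob_algebra E" and X: "X \<in> space E"
  shows "sets (\<kappa> X) = sets E" "space (\<kappa> X) = space E" "prob_space (\<kappa> X)"
proof -
  have "\<kappa> X \<in> space (prob_algebra E)" using measurable_space[OF \<kappa> X] .
  then show "sets (\<kappa> X) = sets E" "prob_space (\<kappa> X)" by (auto simp: space_prob_algebra)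
  then show "space (\<kappa> X) = space E" using sets_eq_imp_space_eq by blast
qed

text \<open>
  The set of all \<open>Y\<close> with \<open>f Y \<in> B\<close> is the \<open>g\<close>-translate of the set of all \<open>Y\<close> with \<open>f (g Y) \<in> B\<close>.
\<close>

lemma invariant_kernel_distr:
  fixes f :: "quat mat set \<Rightarrow> real"
  assumes inv: "invariant_kernel F k \<kappa>" and \<kappa>: "\<kappa> \<in> hyp_borel F k \<rightarrow>\<^sub>M prob_algebra (hyp_borel F k)"
    and g: "g \<in> hyp_G F k" and X: "X \<in> hyp_space F k"
    and f: "f \<in> borel_measurable (hyp_borel F k)"
    and fg: "(\<lambda>Y. f (g <#\<^bsub>hyp_group F k\<^esub> Y)) \<in> borel_measurable (hyp_borel F k)"
  shows "distr (\<kappa> (g <#\<^bsub>hyp_group F k\<^esub> X)) borel f = distr (\<kappa> X) borel (\<lambda>Y. f (g <#\<^bsub>hyp_group F k\<^esub> Y))"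
proof (rule measure_eqI)
  let ?E = "hyp_borel F k" and ?gX = "g <#\<^bsub>hyp_group F k\<^esub> X" and ?fg = "\<lambda>Y. f (g <#\<^bsub>hyp_group F k\<^esub> Y)"
  have gX: "?gX \<in> hyp_space F k" by (rule hyp_act_space[OF g X])
  note s = kernel_space[OF \<kappa>, unfolded space_hyp_borel]
  fix B assume "B \<in> sets (distr (\<kappa> ?gX) borel f)"
  then have B: "B \<in> sets borel" by simp
  have A: "?fg -` B \<inter> hyp_space F k \<in> sets ?E" using measurable_sets[OF fg B] by simp
  have "f -` B \<inter> hyp_space F k = (\<lambda>Y. g <#\<^bsub>hyp_group F k\<^esub> Y) ` (?fg -` B \<inter> hyp_space F k)"
  proof
    show "f -` B \<inter> hyp_space F k \<subseteq> (\<lambda>Y. g <#\<^bsub>hyp_group F k\<^esub> Y) ` (?fg -` B \<inter> hyp_space F k)"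
    proof
      fix Y assume Y: "Y \<in> f -` B \<inter> hyp_space F k"
      then have Y': "Y \<in> hyp_space F k" by simp
      show "Y \<in> (\<lambda>Y. g <#\<^bsub>hyp_group F k\<^esub> Y) ` (?fg -` B \<inter> hyp_space F k)"
        by (rule image_eqI[where x="HQ.lorentz_inv k g <#\<^bsub>hyp_group F k\<^esub> Y"])
          (use hyp_act_inv[OF g Y'] hyp_act_space[OF hyp_G_inv[OF g] Y'] Y in auto)
    qed
  qed (use hyp_act_space[OF g] in auto)
  moreover have "emeasure (\<kappa> ?gX) ((\<lambda>Y. g <#\<^bsub>hyp_group F k\<^esub> Y) ` (?fg -` B \<inter> hyp_space F k)) = emeasure (\<kappa> X) (?fg -` B \<inter> hyp_space F k)"
    using inv g X A unfolding invariant_kernel_def by blast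
  ultimately show "emeasure (distr (\<kappa> ?gX) borel f) B = emeasure (distr (\<kappa> X) borel ?fg) B"
    using f fg B s(1,2)[OF X] s(1,2)[OF gX] by (subst (1 2) emeasure_distr) (auto cong: measurable_cong_sets)
qed simp

text \<open>
  Rotations fix the origin, so the kernel at the origin is invariant under them.
\<close>

lemma invariant_kernel_integral_rotation:
  fixes f :: "quat mat set \<Rightarrow> real"
  assumes inv: "invariant_kernel F k \<kappa>" and \<kappa>: "\<kappa> \<in> hyp_borel F k \<rightarrow>\<^sub>M prob_algebra (hyp_borel F k)"
    and pq: "p \<noteq> q" "1 \<le> p" "p \<le> k" "1 \<le> q" "q \<le> k"
    and f: "f \<in> borel_measurable (hyp_borel F k)" and f': "f' \<in> borel_measurable (hyp_borel F k)"
    and rot: "\<And>y. y \<in> hyp_G F k \<Longrightarrow> f (hyp_coset F k (rotation k p q t * y)) = f' (hyp_coset F k y)"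
  shows "integral\<^sup>L (\<kappa> (hyp_origin F k)) f = integral\<^sup>L (\<kappa> (hyp_origin F k)) f'"
proof -
  let ?R = "rotation k p q t :: quat mat" and ?E = "hyp_borel F k" and ?o = "hyp_origin F k"
  have R: "?R \<in> hyp_G F k" by (rule rotation_hyp_G[OF pq])
  have o: "?o \<in> space ?E" by (simp add: hyp_origin_in_space)
  note s = kernel_space[OF \<kappa> o]
  have Ro: "?R <#\<^bsub>hyp_group F k\<^esub> ?o = ?o"
    unfolding hyp_act_origin[OF R] by (rule hyp_coset_stabilizer[OF rotation_hyp_K[OF pq]])
  have ff': "f (?R <#\<^bsub>hyp_group F k\<^esub> Y) = f' Y" if "Y \<in> hyp_space F k" for Y
    using that rot hyp_act_coset[OF R] unfolding hyp_space_iff by auto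
  have fR: "(\<lambda>Y. f (?R <#\<^bsub>hyp_group F k\<^esub> Y)) \<in> borel_measurable ?E"
    by (rule measurable_cong[THEN iffD2, OF _ f']) (simp add: ff')
  have [measurable]: "f \<in> borel_measurable (\<kappa> ?o)" "f' \<in> borel_measurable (\<kappa> ?o)"
    "(\<lambda>Y. f (?R <#\<^bsub>hyp_group F k\<^esub> Y)) \<in> borel_measurable (\<kappa> ?o)"
    using f f' fR by (simp_all cong: measurable_cong_sets add: s(1))
  have "integral\<^sup>L (\<kappa> ?o) f = integral\<^sup>L (distr (\<kappa> ?o) borel f) (\<lambda>x. x)"
    by (subst integral_distr) auto
  also have "distr (\<kappa> ?o) borel f = distr (\<kappa> ?o) borel (\<lambda>Y. f (?R <#\<^bsub>hyp_group F k\<^esub> Y))"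
    using invariant_kernel_distr[OF inv \<kappa> R hyp_origin_in_space f fR] unfolding Ro .
  also have "integral\<^sup>L \<dots> (\<lambda>x. x) = (\<integral>Y. f (?R <#\<^bsub>hyp_group F k\<^esub> Y) \<partial>\<kappa> ?o)"
    by (subst integral_distr) auto
  also have "\<dots> = integral\<^sup>L (\<kappa> ?o) f'"
    by (rule Bochner_Integration.integral_cong[OF refl]) (simp add: s(2) ff')
  finally show ?thesis .
qed

lemma rotation_mult_column:
  assumes y: "y \<in> carrier_mat (k + 1) (k + 1)" and pq: "p \<noteq> q" "p \<le> k" "q \<le> k" and i: "i < k + 1"
  shows "(rotation k p q (pi / 2) * y) $$ (i, 0) = (if i = p then - y $$ (q, 0) else if i = q then y $$ (p, 0) else y $$ (i, 0))"
    "(rotation k p q pi * y) $$ (i, 0) = (if i = p \<or> i = q then - y $$ (i, 0) else y $$ (i, 0))"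
proof -
  have *: "p < k + 1" "q < k + 1" "0 < k + 1" using pq by auto
  show "(rotation k p q (pi / 2) * y) $$ (i, 0) = (if i = p then - y $$ (q, 0) else if i = q then y $$ (p, 0) else y $$ (i, 0))"
    unfolding rotation_def plane_mat_mult_index[OF y pq(1) *(1,2) i *(3)] by simp
  show "(rotation k p q pi * y) $$ (i, 0) = (if i = p \<or> i = q then - y $$ (i, 0) else y $$ (i, 0))"
    unfolding rotation_def plane_mat_mult_index[OF y pq(1) *(1,2) i *(3)] by auto
qed

lemma hyp_proj_sandwich_measurable:
  assumes ij: "i < k + 1" "j < k + 1"
  shows "(\<lambda>Y. qre (a * hyp_proj F k i j Y * b)) \<in> borel_measurable (hyp_borel F k)"
proof -
  note [measurable] = hyp_proj_measurable[OF ij]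
  show ?thesis unfolding quat_sel_mult by measurable
qed

lemma hyp_G_corner:
  assumes y: "y \<in> hyp_G F k"
  shows "(norm (y $$ (0, 0)))\<^sup>2 = 1 + (\<Sum>i<k. (norm (y $$ (Suc i, 0)))\<^sup>2)" "norm (y $$ (0, 0)) \<ge> 1"
    "i < k \<Longrightarrow> norm (y $$ (Suc i, 0)) \<le> norm (y $$ (0, 0))"
proof -
  show *: "(norm (y $$ (0, 0)))\<^sup>2 = 1 + (\<Sum>i<k. (norm (y $$ (Suc i, 0)))\<^sup>2)"
    using HQ.lorentz_first_column[of y k] y hyp_G_subset by blast
  then show "norm (y $$ (0, 0)) \<ge> 1"
    using power_mono_iff[of 1 "norm (y $$ (0, 0))" 2] by (simp add: sum_nonneg)
  assume i: "i < k"
  have "(norm (y $$ (Suc i, 0)))\<^sup>2 \<le> (\<Sum>i<k. (norm (y $$ (Suc i, 0)))\<^sup>2)"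
    by (rule member_le_sum) (use i in auto)
  then have "(norm (y $$ (Suc i, 0)))\<^sup>2 \<le> (norm (y $$ (0, 0)))\<^sup>2" using * by linarith
  then show "norm (y $$ (Suc i, 0)) \<le> norm (y $$ (0, 0))" by (rule power2_le_imp_le) simp
qed

text \<open>
  Here \<open>h (yK)\<close> is \<open>\<bar>\<Sum>\<^sub>i w\<^sub>i v\<^sub>i\<bar>\<^sup>2\<close> for the vector \<open>v\<^sub>i = y\<^sub>i\<^sub>+\<^sub>1\<^sub>,\<^sub>0 / \<bar>y\<^sub>0\<^sub>0\<bar>\<close>, which has length at most 1.
  By isotropy the mixed terms have expectation zero, and the \<open>k\<close> expectations of \<open>\<bar>v\<^sub>i\<bar>\<^sup>2\<close> agree and add
  up to at most 1.
\<close>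

lemma isotropic_second_moment:
  assumes inv: "invariant_kernel F k \<kappa>" and \<kappa>: "\<kappa> \<in> hyp_borel F k \<rightarrow>\<^sub>M prob_algebra (hyp_borel F k)"
    and k: "3 \<le> k" and w: "(\<Sum>i<k. (norm (w i))\<^sup>2) \<le> 1"
  defines "h \<equiv> \<lambda>Y. \<Sum>i<k. \<Sum>j<k. qre (w i * hyp_proj F k (Suc i) (Suc j) Y * qcnj (w j)) / qre (hyp_proj F k 0 0 Y)"
  shows "h \<in> borel_measurable (hyp_borel F k)" "integrable (\<kappa> (hyp_origin F k)) h" "integral\<^sup>L (\<kappa> (hyp_origin F k)) h \<le> 1 / real k"
proof -
  let ?E = "hyp_borel F k" and ?o = "hyp_origin F k"
  let ?\<mu> = "\<kappa> ?o"
  have o: "?o \<in> space ?E" by (simp add: hyp_origin_in_space)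
  note s = kernel_space[OF \<kappa> o]
  interpret prob_space ?\<mu> by (rule s(3))
  define N where "N a i j b Y = qre (a * hyp_proj F k (Suc i) (Suc j) Y * b) / qre (hyp_proj F k 0 0 Y)" for a i j b Y
  have N_meas: "N a i j b \<in> borel_measurable ?E" if "i < k" "j < k" for a i j b
  proof -
    have [measurable]: "(\<lambda>Y. qre (a * hyp_proj F k (Suc i) (Suc j) Y * b)) \<in> borel_measurable ?E"
      by (rule hyp_proj_sandwich_measurable) (use that in auto)
    have [measurable]: "(\<lambda>Y. qre (hyp_proj F k 0 0 Y)) \<in> borel_measurable ?E"
      by (rule hyp_proj_measurable) auto
    show ?thesis unfolding N_def by measurable
  qed
  have N_coset: "N a i j b (hyp_coset F k y) = qre (a * (y $$ (Suc i, 0) * qcnj (y $$ (Suc j, 0))) * b) / (norm (y $$ (0, 0)))\<^sup>2"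
    if "i < k" "j < k" "y \<in> hyp_G F k" for a i j b y
  proof -
    have *: "Suc i < k + 1" "Suc j < k + 1" "0 < k + 1" using that by auto
    show ?thesis
      unfolding N_def hyp_proj_coset[OF that(3) *(1,2)] hyp_proj_coset[OF that(3) *(3,3)] HQ.cj_mult_self quat_sel ..
  qed
  have N_bound: "\<bar>N a i j b Y\<bar> \<le> norm a * norm b" if ij: "i < k" "j < k" and Y: "Y \<in> hyp_space F k" for a i j b Y
  proof -
    obtain y where y: "y \<in> hyp_G F k" "Y = hyp_coset F k y" using Y unfolding hyp_space_iff by blast
    let ?n = "norm (y $$ (0, 0))"
    have "\<bar>qre (a * (y $$ (Suc i, 0) * qcnj (y $$ (Suc j, 0))) * b)\<bar> \<le> norm a * (norm (y $$ (Suc i, 0)) * norm (y $$ (Suc j, 0))) * norm b"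
      using abs_qre_le_norm[of "a * (y $$ (Suc i, 0) * qcnj (y $$ (Suc j, 0))) * b"] by (simp add: norm_mult)
    also have "\<dots> \<le> norm a * (?n * ?n) * norm b"
      by (intro mult_mono mult_nonneg_nonneg hyp_G_corner(3)[OF y(1)] ij) auto
    finally have "\<bar>qre (a * (y $$ (Suc i, 0) * qcnj (y $$ (Suc j, 0))) * b)\<bar> \<le> norm a * norm b * ?n\<^sup>2"
      by (simp add: power2_eq_square mult_ac)
    moreover have "?n\<^sup>2 > 0" using hyp_G_corner(2)[OF y(1)] by (intro zero_less_power) linarith
    ultimately show ?thesis
      unfolding y(2) N_coset[OF ij y(1)] by (simp add: abs_divide divide_le_eq)
  qed
  have N_int: "integrable ?\<mu> (N a i j b)" if "i < k" "j < k" for a i j b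
    by (rule integrable_const_bound[where B="norm a * norm b"])
      (use N_bound[OF that] N_meas[OF that] s(1,2) in \<open>auto cong: measurable_cong_sets\<close>)
  have off_diag: "integral\<^sup>L ?\<mu> (N a i j b) = 0" if ij: "i < k" "j < k" "i \<noteq> j" for a i j b
  proof -
    \<comment> \<open>A half turn in the plane of \<open>i\<close> and a third index \<open>l\<close> changes the sign of coordinate \<open>i\<close>, but not of \<open>j\<close>.\<close>
    define l where "l = (if i \<noteq> 0 \<and> j \<noteq> 0 then 0 else if i \<noteq> 1 \<and> j \<noteq> 1 then 1 else (2::nat))"
    have l: "l < k" "l \<noteq> i" "l \<noteq> j" using k ij by (auto simp: l_def)
    have pq: "Suc i \<noteq> Suc l" "1 \<le> Suc i" "Suc i \<le> k" "1 \<le> Suc l" "Suc l \<le> k" using l ij by auto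
    have "integral\<^sup>L ?\<mu> (N a i j b) = integral\<^sup>L ?\<mu> (\<lambda>Y. - N a i j b Y)"
    proof (rule invariant_kernel_integral_rotation[OF inv \<kappa> pq, where t=pi])
      show "N a i j b \<in> borel_measurable ?E" "(\<lambda>Y. - N a i j b Y) \<in> borel_measurable ?E"
        using N_meas[OF ij(1,2)] by auto
      fix y assume y: "y \<in> hyp_G F k"
      note rot = rotation_mult_column(2)[OF hyp_G_carrier[OF y] pq(1,3,5)]
      show "N a i j b (hyp_coset F k (rotation k (Suc i) (Suc l) pi * y)) = - N a i j b (hyp_coset F k y)"
        unfolding N_coset[OF ij(1,2) y] N_coset[OF ij(1,2) hyp_G_mult[OF rotation_hyp_G[OF pq] y]]
        using ij l by (simp add: rot HQ.cj_minus del: index_mult_mat(1))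
    qed
    then show ?thesis by simp
  qed
  \<comment> \<open>A quarter turn exchanges the coordinates \<open>i\<close> and \<open>j\<close> up to sign.\<close>
  have diag: "integral\<^sup>L ?\<mu> (N 1 i i 1) = integral\<^sup>L ?\<mu> (N 1 j j 1)" if ij: "i < k" "j < k" for i j
  proof (cases "i = j")
    case False
    have pq: "Suc i \<noteq> Suc j" "1 \<le> Suc i" "Suc i \<le> k" "1 \<le> Suc j" "Suc j \<le> k" using False ij by auto
    show ?thesis
    proof (rule invariant_kernel_integral_rotation[OF inv \<kappa> pq, where t="pi / 2"])
      show "N 1 i i 1 \<in> borel_measurable ?E" "N 1 j j 1 \<in> borel_measurable ?E"
        using N_meas ij by auto
      fix y assume y: "y \<in> hyp_G F k"
      note rot = rotation_mult_column(1)[OF hyp_G_carrier[OF y] pq(1,3,5)]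
      show "N 1 i i 1 (hyp_coset F k (rotation k (Suc i) (Suc j) (pi / 2) * y)) = N 1 j j 1 (hyp_coset F k y)"
        unfolding N_coset[OF ij(2,2) y] N_coset[OF ij(1,1) hyp_G_mult[OF rotation_hyp_G[OF pq] y]]
        using ij by (simp add: rot HQ.cj_minus del: index_mult_mat(1))
    qed
  qed simp
  define m where "m = integral\<^sup>L ?\<mu> (N 1 0 0 1)"
  have m: "integral\<^sup>L ?\<mu> (N 1 i i 1) = m" if "i < k" for i
    unfolding m_def by (rule diag) (use that k in auto)
  have "real k * m = (\<Sum>i<k. integral\<^sup>L ?\<mu> (N 1 i i 1))" by (simp add: m)
  also have "\<dots> = integral\<^sup>L ?\<mu> (\<lambda>Y. \<Sum>i<k. N 1 i i 1 Y)"
    by (rule Bochner_Integration.integral_sum[symmetric]) (auto intro: N_int)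
  also have "\<dots> \<le> integral\<^sup>L ?\<mu> (\<lambda>Y. 1)"
  proof (rule integral_mono)
    fix Y assume "Y \<in> space ?\<mu>"
    then have "Y \<in> hyp_space F k" using s(2) by simp
    then obtain y where y: "y \<in> hyp_G F k" "Y = hyp_coset F k y" unfolding hyp_space_iff by blast
    have "(\<Sum>i<k. N 1 i i 1 Y) = (\<Sum>i<k. (norm (y $$ (Suc i, 0)))\<^sup>2 / (norm (y $$ (0, 0)))\<^sup>2)"
      unfolding y(2) by (rule sum.cong[OF refl], subst N_coset[OF _ _ y(1)]) (simp_all only: HQ.cj_mult_self mult_1_left mult_1_right quat_sel lessThan_iff)
    also have "\<dots> = ((norm (y $$ (0, 0)))\<^sup>2 - 1) / (norm (y $$ (0, 0)))\<^sup>2"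
      using hyp_G_corner(1)[OF y(1)] by (simp add: sum_divide_distrib[symmetric])
    also have "\<dots> \<le> 1" by (simp add: divide_le_eq_1)
    finally show "(\<Sum>i<k. N 1 i i 1 Y) \<le> 1" .
  qed (auto intro!: N_int)
  also have "\<dots> = 1" by (simp add: prob_space)
  finally have m1: "m \<le> 1 / real k" using k by (simp add: field_simps)
  have h: "h = (\<lambda>Y. \<Sum>i<k. \<Sum>j<k. N (w i) i j (qcnj (w j)) Y)" by (simp add: h_def N_def)
  show "h \<in> borel_measurable ?E" unfolding h using N_meas by (intro borel_measurable_sum) auto
  show "integrable ?\<mu> h" unfolding h by (intro Bochner_Integration.integrable_sum N_int) auto
  have scale: "N a i i (qcnj a) Y = (norm a)\<^sup>2 * N 1 i i 1 Y" if i: "i < k" and Y: "Y \<in> space ?\<mu>" for a i Y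
  proof -
    have "Y \<in> hyp_space F k" using Y s(2) by simp
    then obtain y where y: "y \<in> hyp_G F k" "Y = hyp_coset F k y" unfolding hyp_space_iff by blast
    have "qre (a * of_real r * qcnj a) = (norm a)\<^sup>2 * r" for r
      unfolding norm_quat_square by (simp add: quat_sel_mult power2_eq_square algebra_simps)
    then show ?thesis
      unfolding y(2) N_coset[OF i i y(1)] HQ.cj_mult_self by (simp del: of_real_power)
  qed
  have "integral\<^sup>L ?\<mu> h = (\<Sum>i<k. \<Sum>j<k. integral\<^sup>L ?\<mu> (N (w i) i j (qcnj (w j))))"
    unfolding h by (subst Bochner_Integration.integral_sum, (intro Bochner_Integration.integrable_sum N_int; simp),
      intro sum.cong refl Bochner_Integration.integral_sum N_int, simp_all)
  also have "\<dots> = (\<Sum>i<k. \<Sum>j<k. if j = i then integral\<^sup>L ?\<mu> (N (w i) i i (qcnj (w i))) else 0)"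
    by (intro sum.cong refl) (auto simp: off_diag)
  also have "\<dots> = (\<Sum>i<k. (norm (w i))\<^sup>2 * m)"
  proof (intro sum.cong refl)
    fix i assume "i \<in> {..<k}"
    then have i: "i < k" by simp
    have "integral\<^sup>L ?\<mu> (N (w i) i i (qcnj (w i))) = integral\<^sup>L ?\<mu> (\<lambda>Y. (norm (w i))\<^sup>2 * N 1 i i 1 Y)"
      by (rule Bochner_Integration.integral_cong[OF refl]) (rule scale[OF i])
    then show "(\<Sum>j<k. if j = i then integral\<^sup>L ?\<mu> (N (w i) i i (qcnj (w i))) else 0) = (norm (w i))\<^sup>2 * m"
      using i m[OF i] by simp
  qed
  also have "\<dots> = (\<Sum>i<k. (norm (w i))\<^sup>2) * m" by (simp add: sum_distrib_right)
  also have "\<dots> \<le> (\<Sum>i<k. (norm (w i))\<^sup>2) * (1 / real k)" by (rule mult_left_mono[OF m1]) (simp add: sum_nonneg)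
  also have "\<dots> \<le> 1 * (1 / real k)" by (rule mult_right_mono[OF w]) simp
  finally show "integral\<^sup>L ?\<mu> h \<le> 1 / real k" by simp
qed

lemma borel_measurable_cosh [measurable]:
  fixes f :: "'b \<Rightarrow> real"
  assumes "f \<in> borel_measurable M"
  shows "(\<lambda>x. cosh (f x)) \<in> borel_measurable M"
  using measurable_compose[OF assms borel_measurable_continuous_onI[of "cosh :: real \<Rightarrow> real"]]
  by (simp add: continuous_intros)

lemma hyp_dist_section_measurable:
  assumes k: "2 \<le> k" and X: "X \<in> hyp_space F k"
  shows "(\<lambda>Y. hyp_dist F k X Y) \<in> borel_measurable (hyp_borel F k)"
    "(\<lambda>Y. hyp_dist F k Y X) \<in> borel_measurable (hyp_borel F k)"
proof -
  have X': "X \<in> space (hyp_borel F k)" using X by simp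
  show "(\<lambda>Y. hyp_dist F k X Y) \<in> borel_measurable (hyp_borel F k)"
    using measurable_compose[OF measurable_Pair1'[OF X'] hyp_dist_measurable[OF k]] by simp
  show "(\<lambda>Y. hyp_dist F k Y X) \<in> borel_measurable (hyp_borel F k)"
    using measurable_compose[OF measurable_Pair2'[OF X'] hyp_dist_measurable[OF k]] by simp
qed

lemma hyp_act_dist_measurable:
  assumes k: "2 \<le> k" and g: "g \<in> hyp_G F k" and X: "X \<in> hyp_space F k"
  shows "(\<lambda>Y. hyp_dist F k X (g <#\<^bsub>hyp_group F k\<^esub> Y)) \<in> borel_measurable (hyp_borel F k)"
proof (rule measurable_cong[THEN iffD2, OF _ hyp_dist_section_measurable(1)[OF k hyp_act_space[OF hyp_G_inv[OF g] X]]])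
  fix Y assume "Y \<in> space (hyp_borel F k)"
  then have Y: "Y \<in> hyp_space F k" by simp
  show "hyp_dist F k X (g <#\<^bsub>hyp_group F k\<^esub> Y) = hyp_dist F k (HQ.lorentz_inv k g <#\<^bsub>hyp_group F k\<^esub> X) Y"
    using hyp_dist_invariant[OF k g hyp_act_space[OF hyp_G_inv[OF g] X] Y] unfolding hyp_act_inv[OF g X] .
qed

lemma lorentz_pairing_one:
  "lorentz_pairing k (1\<^sub>m (k + 1)) x = x $$ (0, 0)" "lorentz_pairing k x (1\<^sub>m (k + 1)) = qcnj (x $$ (0, 0))"
  by (simp_all add: lorentz_pairing_def)

text \<open>
  Translating \<open>X = gK\<close> to the origin turns the step into a step from the origin, to which
  \<open>isotropic_second_moment\<close> applies with the vector \<open>w\<^sub>i = g\<^sub>0\<^sub>,\<^sub>i\<^sub>+\<^sub>1 / \<bar>g\<^sub>0\<^sub>0\<bar>\<close>.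
\<close>

lemma step_ratio_second_moment:
  assumes inv: "invariant_kernel F k \<kappa>" and \<kappa>: "\<kappa> \<in> hyp_borel F k \<rightarrow>\<^sub>M prob_algebra (hyp_borel F k)"
    and k: "3 \<le> k" and X: "X \<in> hyp_space F k"
  defines "f \<equiv> \<lambda>Y. (cosh (hyp_dist F k (hyp_origin F k) Y) /
    (cosh (hyp_dist F k (hyp_origin F k) X) * cosh (hyp_dist F k X Y)) - 1)\<^sup>2"
  shows "(\<integral>\<^sup>+ Y. ennreal (f Y) \<partial>\<kappa> X) \<le> ennreal (1 / real k)"
proof -
  let ?E = "hyp_borel F k" and ?o = "hyp_origin F k"
  have k2: "2 \<le> k" using k by simp
  note os = hyp_origin_in_space[of F k]
  obtain g where g: "g \<in> hyp_G F k" "X = hyp_coset F k g" using X unfolding hyp_space_iff by blast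
  have X_eq: "X = g <#\<^bsub>hyp_group F k\<^esub> ?o" unfolding g(2) hyp_act_origin[OF g(1)] ..
  note s = kernel_space[OF \<kappa>, unfolded space_hyp_borel]
  define f' where "f' Y = f (g <#\<^bsub>hyp_group F k\<^esub> Y)" for Y
  have f: "f \<in> borel_measurable ?E"
  proof -
    note [measurable] = hyp_dist_section_measurable(1)[OF k2 os] hyp_dist_section_measurable(1)[OF k2 X]
    show ?thesis unfolding f_def by measurable
  qed
  have f': "f' \<in> borel_measurable ?E"
  proof -
    note [measurable] = hyp_act_dist_measurable[OF k2 g(1) os] hyp_act_dist_measurable[OF k2 g(1) X]
    show ?thesis unfolding f'_def f_def by measurable
  qed
  have distr_eq: "distr (\<kappa> X) borel f = distr (\<kappa> ?o) borel f'"
    using invariant_kernel_distr[OF inv \<kappa> g(1) os f f'[unfolded f'_def]] unfolding X_eq[symmetric] f'_def .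
  let ?n = "norm (g $$ (0, 0))"
  define w where "w i = inverse ?n *\<^sub>R g $$ (0, Suc i)" for i
  define h where "h Y = (\<Sum>i<k. \<Sum>j<k. qre (w i * hyp_proj F k (Suc i) (Suc j) Y * qcnj (w j)) / qre (hyp_proj F k 0 0 Y))" for Y
  have n: "?n \<ge> 1" by (rule hyp_G_corner(2)[OF g(1)])
  have row: "?n\<^sup>2 = 1 + (\<Sum>i<k. (norm (g $$ (0, Suc i)))\<^sup>2)"
    using HQ.lorentz_first_row[of g k] g(1) hyp_G_subset by blast
  have "(\<Sum>i<k. (norm (w i))\<^sup>2) = (\<Sum>i<k. (norm (g $$ (0, Suc i)))\<^sup>2) / ?n\<^sup>2"
    by (simp add: w_def power_mult_distrib sum_divide_distrib divide_inverse power_inverse sum_distrib_left mult.commute)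
  also have "\<dots> = (?n\<^sup>2 - 1) / ?n\<^sup>2" using row by simp
  also have "\<dots> \<le> 1" by (simp add: divide_le_eq_1)
  finally have w: "(\<Sum>i<k. (norm (w i))\<^sup>2) \<le> 1" .
  note h = isotropic_second_moment[OF inv \<kappa> k w, folded h_def]
  have le: "f' Y \<le> h Y" if Y: "Y \<in> hyp_space F k" for Y
  proof -
    obtain y where y: "y \<in> hyp_G F k" "Y = hyp_coset F k y" using Y unfolding hyp_space_iff by blast
    let ?m = "norm (y $$ (0, 0))"
    have m: "?m \<ge> 1" by (rule hyp_G_corner(2)[OF y(1)])
    define u where "u = (\<Sum>i<k. w i * y $$ (Suc i, 0))"
    have gy: "g * y \<in> hyp_G F k" by (rule hyp_G_mult[OF g(1) y(1)])
    have corner: "(g * y) $$ (0, 0) = g $$ (0, 0) * y $$ (0, 0) + ?n *\<^sub>R u"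
    proof -
      have "(g * y) $$ (0, 0) = (\<Sum>l<k+1. g $$ (0, l) * y $$ (l, 0))"
        by (rule mat_mult_index[OF hyp_G_carrier[OF g(1)] hyp_G_carrier[OF y(1)]]) auto
      also have "\<dots> = g $$ (0, 0) * y $$ (0, 0) + (\<Sum>i<k. g $$ (0, Suc i) * y $$ (Suc i, 0))"
        by (simp add: sum.lessThan_Suc_shift del: sum.lessThan_Suc)
      also have "(\<Sum>i<k. g $$ (0, Suc i) * y $$ (Suc i, 0)) = ?n *\<^sub>R u"
      proof -
        have "?n > 0" using n by linarith
        then have "?n * inverse ?n = 1" by (metis right_inverse less_irrefl)
        then show ?thesis unfolding u_def scaleR_sum_right by (simp add: w_def)
      qed
      finally show ?thesis .
    qed
    have d1: "cosh (hyp_dist F k ?o (g <#\<^bsub>hyp_group F k\<^esub> Y)) = norm (g $$ (0, 0) * y $$ (0, 0) + ?n *\<^sub>R u)"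
      unfolding y(2) hyp_act_coset[OF g(1) y(1)] hyp_origin_def hyp_dist_coset(2)[OF k2 hyp_G_one gy] lorentz_pairing_one
      unfolding corner[symmetric] by simp
    have d2: "cosh (hyp_dist F k ?o X) = ?n"
      unfolding g(2) hyp_origin_def hyp_dist_coset(2)[OF k2 hyp_G_one g(1)] lorentz_pairing_one by simp
    have d3: "cosh (hyp_dist F k X (g <#\<^bsub>hyp_group F k\<^esub> Y)) = ?m"
      unfolding X_eq hyp_dist_invariant[OF k2 g(1) os Y]
      unfolding y(2) hyp_origin_def hyp_dist_coset(2)[OF k2 hyp_G_one y(1)] lorentz_pairing_one by simp
    have "f' Y = ((norm (g $$ (0, 0) * y $$ (0, 0) + ?n *\<^sub>R u) - norm (g $$ (0, 0) * y $$ (0, 0))) / (?n * ?m))\<^sup>2"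
    proof -
      have "?n * ?m \<noteq> 0" using n m by auto
      then show ?thesis unfolding f'_def f_def d1 d2 d3 norm_mult by (simp add: diff_divide_distrib)
    qed
    also have "\<dots> \<le> (norm (?n *\<^sub>R u) / (?n * ?m))\<^sup>2"
    proof -
      have "\<bar>norm (g $$ (0, 0) * y $$ (0, 0) + ?n *\<^sub>R u) - norm (g $$ (0, 0) * y $$ (0, 0))\<bar> \<le> norm (?n *\<^sub>R u)"
        using norm_triangle_ineq3[of "g $$ (0, 0) * y $$ (0, 0) + ?n *\<^sub>R u" "g $$ (0, 0) * y $$ (0, 0)"] by simp
      then show ?thesis unfolding power_divide by (intro divide_right_mono) (simp_all add: abs_le_square_iff[symmetric])
    qed
    also have "\<dots> = (norm u)\<^sup>2 / ?m\<^sup>2" using n by (auto simp: power_divide power_mult_distrib)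
    also have "(norm u)\<^sup>2 = qre (u * qcnj u)" unfolding HQ.cj_mult_self quat_sel ..
    also have "\<dots> = (\<Sum>i<k. \<Sum>j<k. qre (w i * (y $$ (Suc i, 0) * qcnj (y $$ (Suc j, 0))) * qcnj (w j)))"
      unfolding u_def HQ.cj_sum sum_product quat_sel_sum HQ.cj_mult mult.assoc ..
    also have "\<dots> / ?m\<^sup>2 = h Y"
      unfolding h_def sum_divide_distrib
    proof (intro sum.cong refl)
      fix i j assume "i \<in> {..<k}" "j \<in> {..<k}"
      then have *: "Suc i < k + 1" "Suc j < k + 1" "0 < k + 1" by auto
      show "qre (w i * (y $$ (Suc i, 0) * qcnj (y $$ (Suc j, 0))) * qcnj (w j)) / ?m\<^sup>2 =
        qre (w i * hyp_proj F k (Suc i) (Suc j) Y * qcnj (w j)) / qre (hyp_proj F k 0 0 Y)"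
        unfolding y(2) hyp_proj_coset[OF y(1) *(1,2)] hyp_proj_coset[OF y(1) *(3,3)] HQ.cj_mult_self quat_sel ..
    qed
    finally show ?thesis .
  qed
  have [measurable]: "f \<in> borel_measurable (\<kappa> X)" "f' \<in> borel_measurable (\<kappa> ?o)"
    using f f' by (simp_all cong: measurable_cong_sets add: s(1)[OF X] s(1)[OF os])
  have "(\<integral>\<^sup>+ Y. ennreal (f Y) \<partial>\<kappa> X) = (\<integral>\<^sup>+ x. ennreal x \<partial>distr (\<kappa> X) borel f)"
    by (subst nn_integral_distr) auto
  also have "\<dots> = (\<integral>\<^sup>+ Y. ennreal (f' Y) \<partial>\<kappa> ?o)"
    unfolding distr_eq by (subst nn_integral_distr) auto
  also have "\<dots> \<le> (\<integral>\<^sup>+ Y. ennreal (h Y) \<partial>\<kappa> ?o)"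
    by (rule nn_integral_mono) (simp add: s(2)[OF os] le ennreal_leI)
  also have "\<dots> = ennreal (integral\<^sup>L (\<kappa> ?o) h)"
  proof (rule nn_integral_eq_integral[OF h(2)])
    have "0 \<le> h Y" if "Y \<in> hyp_space F k" for Y
      using le[OF that] unfolding f'_def f_def by (meson order_trans zero_le_power2)
    then show "AE Y in \<kappa> ?o. 0 \<le> h Y" by (intro AE_I2) (simp add: s(2)[OF os])
  qed
  also have "\<dots> \<le> ennreal (1 / real k)" by (rule ennreal_leI[OF h(3)])
  finally show ?thesis .
qed

section \<open>Characteristic functions and Markov chains\<close>

lemma ln_cosh_bounds:
  fixes x :: real
  shows "0 \<le> ln (cosh x)" "ln (cosh x) \<le> \<bar>x\<bar>" "\<bar>x\<bar> - ln 2 \<le> ln (cosh x)"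
proof -
  have "cosh \<bar>x\<bar> \<le> exp \<bar>x\<bar>" by (simp add: cosh_def)
  then have "ln (cosh \<bar>x\<bar>) \<le> ln (exp \<bar>x\<bar>)" by (subst ln_le_cancel_iff) (auto simp: cosh_real_pos)
  then show "ln (cosh x) \<le> \<bar>x\<bar>" by simp
  have "exp \<bar>x\<bar> / 2 \<le> cosh \<bar>x\<bar>" by (simp add: cosh_def)
  then have "ln (exp \<bar>x\<bar> / 2) \<le> ln (cosh \<bar>x\<bar>)" by (subst ln_le_cancel_iff) (auto simp: cosh_real_pos)
  then show "\<bar>x\<bar> - ln 2 \<le> ln (cosh x)" by (simp add: ln_div)
  show "0 \<le> ln (cosh x)" by (rule ln_ge_zero) (rule cosh_real_ge_1)
qed

lemma norm_iexp_diff_le: "norm (iexp a - iexp b) \<le> \<bar>a - b\<bar>" "norm (iexp a - iexp b) \<le> 2"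
proof -
  have "iexp a - iexp b = iexp b * (iexp (a - b) - 1)"
    by (simp add: algebra_simps exp_add[symmetric])
  then have "norm (iexp a - iexp b) = norm (iexp (a - b) - 1)" by (simp add: norm_mult)
  also have "\<dots> \<le> \<bar>a - b\<bar>" using iexp_approx1[of "a - b" 0] by simp
  finally show "norm (iexp a - iexp b) \<le> \<bar>a - b\<bar>" .
  show "norm (iexp a - iexp b) \<le> 2" using norm_triangle_ineq4[of "iexp a" "iexp b"] by simp
qed

text \<open>
  The central limit theorem for powers of a single characteristic function, including the degenerate
  case \<open>v = 0\<close>. It follows from the second-order Taylor expansion at 0.
\<close>

lemma char_power_tendsto_gaussian:
  fixes \<mu> :: "real measure"
  assumes "real_distribution \<mu>" and sq: "integrable \<mu> (\<lambda>x. x\<^sup>2)" and mean: "integral\<^sup>L \<mu> (\<lambda>x. x) = 0"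
    and var: "integral\<^sup>L \<mu> (\<lambda>x. x\<^sup>2) = v"
  shows "(\<lambda>n. char \<mu> (t / sqrt (real n)) ^ n) \<longlonglongrightarrow> complex_of_real (exp (- (v * t\<^sup>2) / 2))"
proof -
  interpret real_distribution \<mu> by fact
  have int: "integrable \<mu> (\<lambda>x. x)" by (rule square_integrable_imp_integrable[OF _ sq]) simp
  define \<epsilon> where "\<epsilon> n = (LINT x|\<mu>. min (6 * x\<^sup>2) (\<bar>t / sqrt (real n)\<bar> * \<bar>x\<bar> ^ 3))" for n :: nat
  have v0: "v \<ge> 0" unfolding var[symmetric] by simp
  have bound: "\<forall>\<^sub>F n in sequentially. norm (char \<mu> (t / sqrt (real n)) ^ n - complex_of_real ((1 + (- (v * t\<^sup>2) / 2) / real n) ^ n)) \<le> t\<^sup>2 / 6 * \<epsilon> n"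
  proof (rule eventually_sequentiallyI)
    fix n :: nat assume "n \<ge> Suc (nat \<lceil>v * t\<^sup>2\<rceil>)"
    then have n: "n > 0" "real n \<ge> v * t\<^sup>2" by linarith+
    let ?s = "t / sqrt (real n)" and ?z = "1 + (- (v * t\<^sup>2) / 2) / real n"
    have s2: "?s\<^sup>2 = t\<^sup>2 / real n" using n by (simp add: power_divide)
    have z_eq: "?z = 1 - ?s\<^sup>2 * v / 2" unfolding s2 by (simp add: field_simps)
    have 1: "norm (char \<mu> ?s - complex_of_real ?z) \<le> ?s\<^sup>2 / 6 * \<epsilon> n"
      unfolding z_eq \<epsilon>_def by (rule char_approx3) (use int sq mean var in auto)
    have "0 \<le> v * t\<^sup>2 / real n" "v * t\<^sup>2 / real n \<le> 1" using n v0 by (simp_all add: divide_le_eq_1)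
    moreover have "?z = 1 - v * t\<^sup>2 / real n / 2" by simp
    ultimately have z: "\<bar>?z\<bar> \<le> 1" by linarith
    have "norm (char \<mu> ?s ^ n - complex_of_real ?z ^ n) \<le> real n * norm (char \<mu> ?s - complex_of_real ?z)"
      by (rule norm_power_diff) (use z cmod_char_le_1 in \<open>simp_all only: norm_of_real\<close>)
    also have "\<dots> \<le> real n * (?s\<^sup>2 / 6 * \<epsilon> n)" by (rule mult_left_mono[OF 1]) simp
    also have "\<dots> = t\<^sup>2 / 6 * \<epsilon> n" unfolding s2 using n by simp
    finally show "norm (char \<mu> ?s ^ n - complex_of_real (?z ^ n)) \<le> t\<^sup>2 / 6 * \<epsilon> n" unfolding of_real_power .
  qed
  have "(\<lambda>n. min (6 * x\<^sup>2) (\<bar>t / sqrt (real n)\<bar> * \<bar>x\<bar> ^ 3)) \<longlonglongrightarrow> 0" for x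
  proof (rule tendsto_sandwich[OF _ _ tendsto_const])
    have "(\<lambda>n. 1 / sqrt (real n)) \<longlonglongrightarrow> 0" by real_asymp
    then have "(\<lambda>n. \<bar>t\<bar> * \<bar>x\<bar> ^ 3 * (1 / sqrt (real n))) \<longlonglongrightarrow> \<bar>t\<bar> * \<bar>x\<bar> ^ 3 * 0" by (intro tendsto_intros)
    then show "(\<lambda>n. \<bar>t\<bar> * \<bar>x\<bar> ^ 3 * (1 / sqrt (real n))) \<longlonglongrightarrow> 0" by simp
  qed (auto simp: abs_divide)
  then have "(\<lambda>n. \<epsilon> n) \<longlonglongrightarrow> (LINT x|\<mu>. 0)"
    unfolding \<epsilon>_def by (intro integral_dominated_convergence[where w="\<lambda>x. 6 * x\<^sup>2"]) (use sq in auto)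
  then have \<epsilon>: "(\<lambda>n. t\<^sup>2 / 6 * \<epsilon> n) \<longlonglongrightarrow> 0" by (auto intro: tendsto_mult_right_zero)
  have "(\<lambda>n. complex_of_real ((1 + (- (v * t\<^sup>2) / 2) / real n) ^ n)) \<longlonglongrightarrow> complex_of_real (exp (- (v * t\<^sup>2) / 2))"
    by (intro tendsto_of_real tendsto_exp_limit_sequentially)
  then show ?thesis by (rule Lim_transform) (rule Lim_null_comparison[OF bound \<epsilon>])
qed

lemma centered_normal_char:
  assumes v: "v \<ge> 0"
  shows "real_distribution (centered_normal v)" "char (centered_normal v) t = complex_of_real (exp (- (v * t\<^sup>2) / 2))"
proof -
  have "real_distribution (centered_normal v) \<and> char (centered_normal v) t = complex_of_real (exp (- (v * t\<^sup>2) / 2))"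
  proof (cases "v = 0")
    case True
    have "real_distribution (return borel (0::real))"
      by (intro real_distribution.intro prob_space_return real_distribution_axioms.intro) auto
    then show ?thesis using True by (simp add: centered_normal_def char_def integral_return)
  next
    case False
    then have v: "sqrt v > 0" using v by simp
    interpret std: real_distribution std_normal_distribution by (rule real_dist_normal_dist)
    have "distributed std_normal_distribution lborel (\<lambda>x. x) (normal_density 0 1)"
      unfolding distributed_def by (auto simp: distr_id2)
    then have "distributed std_normal_distribution lborel (\<lambda>x. 0 + sqrt v * x) (normal_density (0 + sqrt v * 0) (\<bar>sqrt v\<bar> * 1))"
      using v by (intro std.normal_density_affine) auto
    then have "distr std_normal_distribution lborel (\<lambda>x. sqrt v * x) = density lborel (normal_density 0 (sqrt v))"
      using v unfolding distributed_def by simp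
    moreover have "distr std_normal_distribution lborel (\<lambda>x. sqrt v * x) = distr std_normal_distribution borel (\<lambda>x. sqrt v * x)"
      by (rule distr_cong) auto
    ultimately have eq: "centered_normal v = distr std_normal_distribution borel (\<lambda>x. sqrt v * x)"
      using False by (simp add: centered_normal_def)
    have "char (centered_normal v) t = char std_normal_distribution (sqrt v * t)"
      unfolding eq char_def by (subst integral_distr) (auto simp: mult_ac)
    also have "\<dots> = complex_of_real (exp (- (v * t\<^sup>2) / 2))"
      unfolding char_std_normal_distribution using assms by (simp add: power_mult_distrib)
    finally show ?thesis unfolding eq using std.real_distribution_distr by auto
  qed
  then show "real_distribution (centered_normal v)" "char (centered_normal v) t = complex_of_real (exp (- (v * t\<^sup>2) / 2))"
    by blast+
qed

context
  fixes M :: "'w measure" and E :: "'s measure" and \<kappa> :: "'s \<Rightarrow> 's measure" and S :: "nat \<Rightarrow> 'w \<Rightarrow> 's"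
  assumes mc: "markov_chain M E \<kappa> S"
begin

lemma markov_chainD:
  "prob_space M" "\<kappa> \<in> E \<rightarrow>\<^sub>M prob_algebra E" "S n \<in> M \<rightarrow>\<^sub>M E"
  "A \<in> sets E \<Longrightarrow> AE \<omega> in M. real_cond_exp M (past M E S n) (indicator (S (Suc n) -` A \<inter> space M)) \<omega> = measure (\<kappa> (S n \<omega>)) A"
  using mc unfolding markov_chain_def by blast+

lemma space_past [simp]: "space (past M E S n) = space M"
  unfolding past_def by (rule space_measure_of) blast

lemma sets_past: "sets (past M E S n) = sigma_sets (space M) {S i -` A \<inter> space M | i A. i \<le> n \<and> A \<in> sets E}"
  unfolding past_def by (rule sets_measure_of) blast

lemma subalgebra_past: "subalgebra M (past M E S n)"
proof -
  have "sigma_sets (space M) {S i -` A \<inter> space M | i A. i \<le> n \<and> A \<in> sets E} \<subseteq> sets M"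
    by (rule sets.sigma_sets_subset) (use measurable_sets[OF markov_chainD(3)] in blast)
  then show ?thesis by (simp add: subalgebra_def sets_past)
qed

lemma measurable_past:
  assumes "i \<le> n"
  shows "S i \<in> past M E S n \<rightarrow>\<^sub>M E"
proof (rule measurableI)
  fix A assume "A \<in> sets E"
  then have "S i -` A \<inter> space M \<in> {S i -` A \<inter> space M | i A. i \<le> n \<and> A \<in> sets E}" using assms by blast
  then show "S i -` A \<inter> space (past M E S n) \<in> sets (past M E S n)"
    unfolding space_past sets_past by (rule sigma_sets.Basic)
qed (use measurable_space[OF markov_chainD(3)] in simp)

lemma markov_rectangle:
  assumes B: "B \<in> sets (past M E S n)" and A: "A \<in> sets E"
  shows "emeasure M (B \<inter> (S (Suc n) -` A \<inter> space M)) = (\<integral>\<^sup>+\<omega>. indicator B \<omega> * emeasure (\<kappa> (S n \<omega>)) A \<partial>M)"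
proof -
  interpret prob_space M by (rule markov_chainD(1))
  interpret finite_measure_subalgebra M "past M E S n"
    by unfold_locales (rule subalgebra_past)
  let ?N = "past M E S n" and ?C = "S (Suc n) -` A \<inter> space M"
  have C: "?C \<in> sets M" using measurable_sets[OF markov_chainD(3) A] .
  have BM: "B \<in> sets M" using B subalgebra_past unfolding subalgebra_def by blast
  have int: "integrable M (indicator ?C :: 'w \<Rightarrow> real)"
    using C by (intro integrable_real_indicator) (auto simp: less_top[symmetric])
  have prob: "prob_space (\<kappa> (S n \<omega>))" "sets (\<kappa> (S n \<omega>)) = sets E" if "\<omega> \<in> space M" for \<omega>
    using measurable_space[OF markov_chainD(2) measurable_space[OF markov_chainD(3) that, of n]]
    by (auto simp: space_prob_algebra)
  have [measurable]: "(\<lambda>x. emeasure (\<kappa> x) A) \<in> borel_measurable E"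
    using measurable_compose[OF measurable_prob_algebraD[OF markov_chainD(2)] measurable_emeasure_subprob_algebra[OF A]] .
  have "(\<lambda>x. measure (\<kappa> x) A) \<in> borel_measurable E"
    unfolding Sigma_Algebra.measure_def by measurable
  then have meas: "(\<lambda>\<omega>. indicator B \<omega> * measure (\<kappa> (S n \<omega>)) A) \<in> borel_measurable M"
    using BM measurable_compose[OF markov_chainD(3)] by (intro borel_measurable_times) auto
  have "measure M (B \<inter> ?C) = (\<integral>\<omega>. indicator B \<omega> * indicator ?C \<omega> \<partial>M)"
    using BM C by (simp add: indicator_inter_arith[symmetric])
  also have "\<dots> = (\<integral>\<omega>. indicator B \<omega> * real_cond_exp M ?N (indicator ?C) \<omega> \<partial>M)"
    using real_cond_exp_intA[OF int B] by (simp add: set_lebesgue_integral_def)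
  also have "\<dots> = (\<integral>\<omega>. indicator B \<omega> * measure (\<kappa> (S n \<omega>)) A \<partial>M)"
    by (rule integral_cong_AE) (use markov_chainD(4)[OF A, of n] meas BM in auto)
  finally have eq: "measure M (B \<inter> ?C) = (\<integral>\<omega>. indicator B \<omega> * measure (\<kappa> (S n \<omega>)) A \<partial>M)" .
  have "emeasure M (B \<inter> ?C) = ennreal (\<integral>\<omega>. indicator B \<omega> * measure (\<kappa> (S n \<omega>)) A \<partial>M)"
    by (simp add: emeasure_eq_measure eq)
  also have "\<dots> = (\<integral>\<^sup>+\<omega>. ennreal (indicator B \<omega> * measure (\<kappa> (S n \<omega>)) A) \<partial>M)"
    by (rule nn_integral_eq_integral[symmetric])
      (use meas prob in \<open>auto intro!: integrable_const_bound[where B=1] AE_I2 simp: prob_space.prob_le_1 indicator_def\<close>)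
  also have "\<dots> = (\<integral>\<^sup>+\<omega>. indicator B \<omega> * emeasure (\<kappa> (S n \<omega>)) A \<partial>M)"
    by (rule nn_integral_cong) (use prob in \<open>auto simp: indicator_def finite_measure.emeasure_eq_measure prob_space.finite_measure\<close>)
  finally show ?thesis .
qed

text \<open>
  The Markov property is stated for conditional probabilities of single sets, which is the case of
  rectangles. Rectangles determine a measure on the product, so the pair of the past and the next
  state has the law obtained by drawing the next state from the kernel.
\<close>

lemma markov_joint_integral:
  assumes f: "f \<in> borel_measurable (past M E S n \<Otimes>\<^sub>M E)"
  shows "(\<integral>\<^sup>+\<omega>. f (\<omega>, S (Suc n) \<omega>) \<partial>M) = (\<integral>\<^sup>+\<omega>. (\<integral>\<^sup>+y. f (\<omega>, y) \<partial>\<kappa> (S n \<omega>)) \<partial>M)"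
proof -
  interpret prob_space M by (rule markov_chainD(1))
  let ?N = "past M E S n"
  let ?R = "restr_to_subalg M ?N"
  let ?K = "\<lambda>\<omega>. distr (\<kappa> (S n \<omega>)) (?N \<Otimes>\<^sub>M E) (Pair \<omega>)"
  note sub = subalgebra_past[of n]
  have idN: "(\<lambda>\<omega>. \<omega>) \<in> M \<rightarrow>\<^sub>M ?N"
    by (rule measurableI) (use sub in \<open>auto simp: subalgebra_def\<close>)
  have setsR: "sets ?R = sets ?N" by (rule sets_restr_to_subalg[OF sub])
  have spR: "space ?R = space M" by (simp add: space_restr_to_subalg)
  have joint: "(\<lambda>\<omega>. (\<omega>, S (Suc n) \<omega>)) \<in> M \<rightarrow>\<^sub>M ?N \<Otimes>\<^sub>M E"
    using idN markov_chainD(3) by (rule measurable_Pair)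
  have \<kappa>: "(\<lambda>\<omega>. \<kappa> (S n \<omega>)) \<in> ?N \<rightarrow>\<^sub>M subprob_algebra E"
    using measurable_compose[OF measurable_past[OF order_refl] measurable_prob_algebraD[OF markov_chainD(2)]] .
  have \<kappa>s: "sets (\<kappa> (S n \<omega>)) = sets E" if "\<omega> \<in> space M" for \<omega>
    using measurable_space[OF markov_chainD(2) measurable_space[OF markov_chainD(3) that, of n]]
    by (auto simp: space_prob_algebra)
  have KN: "?K \<in> ?N \<rightarrow>\<^sub>M subprob_algebra (?N \<Otimes>\<^sub>M E)"
    by (rule measurable_distr2[OF _ \<kappa>]) simp
  then have K: "?K \<in> ?R \<rightarrow>\<^sub>M subprob_algebra (?N \<Otimes>\<^sub>M E)"
    using setsR by (simp cong: measurable_cong_sets)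
  have neR: "space ?R \<noteq> {}" using spR not_empty by simp
  have pair: "Pair \<omega> \<in> \<kappa> (S n \<omega>) \<rightarrow>\<^sub>M ?N \<Otimes>\<^sub>M E" if "\<omega> \<in> space M" for \<omega>
    using measurable_Pair1'[of \<omega> ?N E] that \<kappa>s[OF that] by (simp cong: measurable_cong_sets)
  have rect: "emeasure (distr M (?N \<Otimes>\<^sub>M E) (\<lambda>\<omega>. (\<omega>, S (Suc n) \<omega>))) (B \<times> A) = emeasure (?R \<bind> ?K) (B \<times> A)"
    if B: "B \<in> sets ?N" and A: "A \<in> sets E" for A B
  proof -
    have BA: "B \<times> A \<in> sets (?N \<Otimes>\<^sub>M E)" using A B by simp
    have BM: "B \<subseteq> space M" using sets.sets_into_space[OF B] by simp
    have "emeasure (distr M (?N \<Otimes>\<^sub>M E) (\<lambda>\<omega>. (\<omega>, S (Suc n) \<omega>))) (B \<times> A) = emeasure M (B \<inter> (S (Suc n) -` A \<inter> space M))"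
      unfolding emeasure_distr[OF joint BA] by (rule arg_cong[where f="emeasure M"]) (use BM in auto)
    also have "\<dots> = (\<integral>\<^sup>+\<omega>. indicator B \<omega> * emeasure (\<kappa> (S n \<omega>)) A \<partial>M)" by (rule markov_rectangle[OF B A])
    also have "\<dots> = (\<integral>\<^sup>+\<omega>. emeasure (?K \<omega>) (B \<times> A) \<partial>M)"
    proof (rule nn_integral_cong)
      fix \<omega> assume \<omega>: "\<omega> \<in> space M"
      have "Pair \<omega> -` (B \<times> A) \<inter> space (\<kappa> (S n \<omega>)) = (if \<omega> \<in> B then A else {})"
        using sets.sets_into_space[OF A] sets_eq_imp_space_eq[OF \<kappa>s[OF \<omega>]] by auto
      then show "indicator B \<omega> * emeasure (\<kappa> (S n \<omega>)) A = emeasure (?K \<omega>) (B \<times> A)"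
        unfolding emeasure_distr[OF pair[OF \<omega>] BA] by (simp add: indicator_def)
    qed
    also have "\<dots> = (\<integral>\<^sup>+\<omega>. emeasure (?K \<omega>) (B \<times> A) \<partial>?R)"
      by (rule nn_integral_subalgebra2[OF sub, symmetric])
        (use measurable_compose[OF KN measurable_emeasure_subprob_algebra[OF BA]] in simp)
    also have "\<dots> = emeasure (?R \<bind> ?K) (B \<times> A)" by (rule emeasure_bind[OF neR K BA, symmetric])
    finally show ?thesis .
  qed
  have eq: "distr M (?N \<Otimes>\<^sub>M E) (\<lambda>\<omega>. (\<omega>, S (Suc n) \<omega>)) = ?R \<bind> ?K"
  proof (rule measure_eqI_generator_eq[OF Int_stable_pair_measure_generator[of ?N E] pair_measure_closed])
    show "sets (distr M (?N \<Otimes>\<^sub>M E) (\<lambda>\<omega>. (\<omega>, S (Suc n) \<omega>))) = sigma_sets (space ?N \<times> space E) {a \<times> b |a b. a \<in> sets ?N \<and> b \<in> sets E}"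
      by (simp add: sets_pair_measure)
    show "sets (?R \<bind> ?K) = sigma_sets (space ?N \<times> space E) {a \<times> b |a b. a \<in> sets ?N \<and> b \<in> sets E}"
      using sets_bind[of ?R ?K "?N \<Otimes>\<^sub>M E"] neR by (simp add: sets_pair_measure)
    show "range (\<lambda>_::nat. space ?N \<times> space E) \<subseteq> {a \<times> b |a b. a \<in> sets ?N \<and> b \<in> sets E}" by blast
    interpret D: prob_space "distr M (?N \<Otimes>\<^sub>M E) (\<lambda>\<omega>. (\<omega>, S (Suc n) \<omega>))" by (rule prob_space_distr[OF joint])
    show "emeasure (distr M (?N \<Otimes>\<^sub>M E) (\<lambda>\<omega>. (\<omega>, S (Suc n) \<omega>))) (space ?N \<times> space E) \<noteq> \<infinity>"
      by simp
  qed (use rect in auto)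
  have "(\<integral>\<^sup>+\<omega>. f (\<omega>, S (Suc n) \<omega>) \<partial>M) = integral\<^sup>N (distr M (?N \<Otimes>\<^sub>M E) (\<lambda>\<omega>. (\<omega>, S (Suc n) \<omega>))) f"
    using f joint by (subst nn_integral_distr) auto
  also have "\<dots> = (\<integral>\<^sup>+\<omega>. integral\<^sup>N (?K \<omega>) f \<partial>?R)"
    unfolding eq by (rule nn_integral_bind[OF f K])
  also have "\<dots> = (\<integral>\<^sup>+\<omega>. integral\<^sup>N (?K \<omega>) f \<partial>M)"
    by (rule nn_integral_subalgebra2[OF sub])
      (use measurable_compose[OF KN nn_integral_measurable_subprob_algebra[OF f]] in simp)
  also have "\<dots> = (\<integral>\<^sup>+\<omega>. (\<integral>\<^sup>+y. f (\<omega>, y) \<partial>\<kappa> (S n \<omega>)) \<partial>M)"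
    by (rule nn_integral_cong) (use f pair in \<open>simp add: nn_integral_distr\<close>)
  finally show ?thesis .
qed

end

section \<open>Radial random walks\<close>

lemma abs_ln_le_of_near_1:
  fixes r :: real
  assumes "\<bar>r - 1\<bar> \<le> 1 / 2"
  shows "\<bar>ln r\<bar> \<le> 2 * \<bar>r - 1\<bar>"
proof -
  have "\<bar>ln (1 + (r - 1)) - (r - 1)\<bar> \<le> 2 * (r - 1)\<^sup>2" by (rule abs_ln_one_plus_x_minus_x_bound[OF assms])
  also have "2 * (r - 1)\<^sup>2 = 2 * \<bar>r - 1\<bar> * \<bar>r - 1\<bar>" by (simp add: power2_eq_square)
  also have "\<dots> \<le> 1 * \<bar>r - 1\<bar>" by (rule mult_right_mono) (use assms in auto)
  finally have "\<bar>ln r - (r - 1)\<bar> \<le> \<bar>r - 1\<bar>" by simp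
  then have "\<bar>ln r - (r - 1)\<bar> + \<bar>r - 1\<bar> \<le> \<bar>r - 1\<bar> + \<bar>r - 1\<bar>" by (rule add_right_mono)
  moreover have "\<bar>ln r\<bar> \<le> \<bar>ln r - (r - 1)\<bar> + \<bar>r - 1\<bar>"
    using abs_triangle_ineq[of "ln r - (r - 1)" "r - 1"] by simp
  ultimately show ?thesis unfolding mult_2 by (rule order_trans[rotated])
qed

lemma hyp_dist_comp_measurable:
  assumes k: "2 \<le> k" and "f \<in> N \<rightarrow>\<^sub>M hyp_borel F k" "g \<in> N \<rightarrow>\<^sub>M hyp_borel F k"
  shows "(\<lambda>\<omega>. hyp_dist F k (f \<omega>) (g \<omega>)) \<in> borel_measurable N"
  using measurable_compose[OF measurable_Pair[OF assms(2,3)] hyp_dist_measurable[OF k]] by simp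

locale hyp_walk =
  fixes F :: hscalar and k :: nat and M :: "'w measure" and S :: "nat \<Rightarrow> 'w \<Rightarrow> quat mat set"
    and \<nu> :: "real measure" and \<kappa> :: "quat mat set \<Rightarrow> quat mat set measure"
  assumes k: "2 \<le> k" and inv: "invariant_kernel F k \<kappa>" and mc: "markov_chain M (hyp_borel F k) \<kappa> S"
    and start: "\<omega> \<in> space M \<Longrightarrow> S 0 \<omega> = hyp_origin F k"
    and step_distr: "distr M borel (\<lambda>\<omega>. hyp_dist F k (S n \<omega>) (S (Suc n) \<omega>)) = \<nu>"
begin

sublocale prob_space M by (rule markov_chainD(1)[OF mc])

abbreviation "E \<equiv> hyp_borel F k"
abbreviation "origin \<equiv> hyp_origin F k"

definition step :: "nat \<Rightarrow> 'w \<Rightarrow> real" where "step n \<omega> = hyp_dist F k (S n \<omega>) (S (Suc n) \<omega>)"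

definition radius :: "nat \<Rightarrow> 'w \<Rightarrow> real" where "radius n \<omega> = hyp_dist F k origin (S n \<omega>)"

text \<open>
  In an exact hyperbolic right triangle this quotient is 1; it measures the deviation of the step from
  being orthogonal to the geodesic to the origin.
\<close>

definition ratio :: "nat \<Rightarrow> 'w \<Rightarrow> real" where
  "ratio n \<omega> = cosh (radius (Suc n) \<omega>) / (cosh (radius n \<omega>) * cosh (step n \<omega>))"

lemma kernel_meas: "\<kappa> \<in> E \<rightarrow>\<^sub>M prob_algebra E" by (rule markov_chainD(2)[OF mc])

lemma S_meas: "S n \<in> M \<rightarrow>\<^sub>M E" by (rule markov_chainD(3)[OF mc])

lemma S_space: "\<omega> \<in> space M \<Longrightarrow> S n \<omega> \<in> hyp_space F k"
  using measurable_space[OF S_meas] by simp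

lemma step_meas [measurable]: "step n \<in> borel_measurable M"
  unfolding step_def by (rule hyp_dist_comp_measurable[OF k S_meas S_meas])

lemma step_meas_past: "i < n \<Longrightarrow> step i \<in> borel_measurable (past M E S n)"
  unfolding step_def by (rule hyp_dist_comp_measurable[OF k measurable_past[OF mc] measurable_past[OF mc]]) auto

lemma origin_meas: "(\<lambda>_. origin) \<in> N \<rightarrow>\<^sub>M E"
  using hyp_origin_in_space[of F k] by (intro measurable_const) simp

lemma radius_meas [measurable]: "radius n \<in> borel_measurable M"
  unfolding radius_def by (rule hyp_dist_comp_measurable[OF k origin_meas S_meas])

lemma ratio_meas [measurable]: "ratio n \<in> borel_measurable M"
  unfolding ratio_def by measurable

text \<open>
  By transitivity \<open>X = g o\<close> for some \<open>g\<close>, and \<open>g\<close> preserves both the kernel and the distance.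
\<close>

lemma step_kernel_distr:
  assumes X: "X \<in> hyp_space F k"
  shows "distr (\<kappa> X) borel (hyp_dist F k X) = distr (\<kappa> origin) borel (hyp_dist F k origin)"
proof -
  note os = hyp_origin_in_space[of F k]
  obtain g where g: "g \<in> hyp_G F k" "X = hyp_coset F k g" using X unfolding hyp_space_iff by blast
  have X_eq: "X = g <#\<^bsub>hyp_group F k\<^esub> origin" unfolding g(2) hyp_act_origin[OF g(1)] ..
  have "distr (\<kappa> X) borel (hyp_dist F k X) = distr (\<kappa> origin) borel (\<lambda>Y. hyp_dist F k X (g <#\<^bsub>hyp_group F k\<^esub> Y))"
    using invariant_kernel_distr[OF inv kernel_meas g(1) os hyp_dist_section_measurable(1)[OF k X] hyp_act_dist_measurable[OF k g(1) X]]
    unfolding X_eq[symmetric] .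
  also have "\<dots> = distr (\<kappa> origin) borel (hyp_dist F k origin)"
  proof (rule distr_cong[OF refl refl])
    fix Y assume "Y \<in> space (\<kappa> origin)"
    then have "Y \<in> hyp_space F k" using kernel_space(2)[OF kernel_meas, of origin] os by simp
    then show "hyp_dist F k X (g <#\<^bsub>hyp_group F k\<^esub> Y) = hyp_dist F k origin Y"
      unfolding X_eq using hyp_dist_invariant[OF k g(1) os] by simp
  qed
  finally show ?thesis .
qed

lemma step_joint:
  assumes B: "B \<in> sets (past M E S n)" and C: "C \<in> sets borel"
  shows "emeasure M (B \<inter> (step n -` C \<inter> space M)) = emeasure M B * emeasure (distr (\<kappa> origin) borel (hyp_dist F k origin)) C"
proof -
  let ?N = "past M E S n"
  have BM: "B \<in> sets M" using B subalgebra_past[OF mc, of n] unfolding subalgebra_def by blast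
  define f where "f = (\<lambda>(\<omega>, y). indicator B \<omega> * indicator C (hyp_dist F k (S n \<omega>) y) :: ennreal)"
  have "(\<lambda>z. hyp_dist F k (S n (fst z)) (snd z)) \<in> borel_measurable (?N \<Otimes>\<^sub>M E)"
    by (rule hyp_dist_comp_measurable[OF k measurable_compose[OF measurable_fst measurable_past[OF mc order_refl]] measurable_snd])
  then have f: "f \<in> borel_measurable (?N \<Otimes>\<^sub>M E)"
    unfolding f_def split_beta' using B C by measurable
  have "emeasure M (B \<inter> (step n -` C \<inter> space M)) = (\<integral>\<^sup>+\<omega>. indicator (B \<inter> (step n -` C \<inter> space M)) \<omega> \<partial>M)"
    using BM measurable_sets[OF step_meas C] by (subst nn_integral_indicator) auto
  also have "\<dots> = (\<integral>\<^sup>+\<omega>. f (\<omega>, S (Suc n) \<omega>) \<partial>M)"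
    by (rule nn_integral_cong) (auto simp: f_def step_def indicator_def)
  also have "\<dots> = (\<integral>\<^sup>+\<omega>. (\<integral>\<^sup>+y. f (\<omega>, y) \<partial>\<kappa> (S n \<omega>)) \<partial>M)" by (rule markov_joint_integral[OF mc f])
  also have "\<dots> = (\<integral>\<^sup>+\<omega>. indicator B \<omega> * emeasure (distr (\<kappa> origin) borel (hyp_dist F k origin)) C \<partial>M)"
  proof (rule nn_integral_cong)
    fix \<omega> assume "\<omega> \<in> space M"
    then have X: "S n \<omega> \<in> hyp_space F k" by (rule S_space)
    note s = kernel_space[OF kernel_meas, unfolded space_hyp_borel, OF X]
    have d: "hyp_dist F k (S n \<omega>) \<in> borel_measurable (\<kappa> (S n \<omega>))"
      using hyp_dist_section_measurable(1)[OF k X] by (simp cong: measurable_cong_sets add: s(1))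
    have "(\<integral>\<^sup>+y. f (\<omega>, y) \<partial>\<kappa> (S n \<omega>)) = indicator B \<omega> * (\<integral>\<^sup>+y. indicator C (hyp_dist F k (S n \<omega>) y) \<partial>\<kappa> (S n \<omega>))"
      unfolding f_def using d C by (simp add: nn_integral_cmult)
    also have "(\<integral>\<^sup>+y. indicator C (hyp_dist F k (S n \<omega>) y) \<partial>\<kappa> (S n \<omega>)) = (\<integral>\<^sup>+x. indicator C x \<partial>distr (\<kappa> (S n \<omega>)) borel (hyp_dist F k (S n \<omega>)))"
      using d C by (subst nn_integral_distr) auto
    also have "\<dots> = emeasure (distr (\<kappa> origin) borel (hyp_dist F k origin)) C"
      unfolding step_kernel_distr[OF X] using C by simp
    finally show "(\<integral>\<^sup>+y. f (\<omega>, y) \<partial>\<kappa> (S n \<omega>)) = indicator B \<omega> * emeasure (distr (\<kappa> origin) borel (hyp_dist F k origin)) C" .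
  qed
  also have "\<dots> = emeasure M B * emeasure (distr (\<kappa> origin) borel (hyp_dist F k origin)) C"
    using BM by (subst nn_integral_multc) auto
  finally show ?thesis .
qed

lemma step_distr': "distr M borel (step n) = \<nu>"
  unfolding step_def by (rule step_distr)

lemma step_joint_\<nu>:
  assumes B: "B \<in> sets (past M E S n)" and C: "C \<in> sets borel"
  shows "emeasure M (B \<inter> (step n -` C \<inter> space M)) = emeasure M B * emeasure \<nu> C"
proof -
  have "emeasure \<nu> C = emeasure M (space (past M E S n) \<inter> (step n -` C \<inter> space M))"
    unfolding step_distr'[of n, symmetric] using C step_meas
    by (subst emeasure_distr) (auto simp: space_past[OF mc] intro: arg_cong[where f="emeasure M"])
  also have "\<dots> = emeasure (distr (\<kappa> origin) borel (hyp_dist F k origin)) C"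
    unfolding step_joint[OF sets.top C] by (simp add: space_past[OF mc] emeasure_space_1)
  finally show ?thesis using step_joint[OF B C] by simp
qed

lemma indep_past_step:
  assumes V: "V \<in> borel_measurable (past M E S n)"
  shows "indep_var borel V borel (step n)"
proof -
  have VM: "V \<in> borel_measurable M"
    using V subalgebra_past[OF mc, of n] by (rule measurable_from_subalg[rotated])
  interpret D1: prob_space "distr M borel V" by (rule prob_space_distr[OF VM])
  interpret D2: prob_space "distr M borel (step n)" by (rule prob_space_distr[OF step_meas])
  have "distr M borel V \<Otimes>\<^sub>M distr M borel (step n) = distr M (borel \<Otimes>\<^sub>M borel) (\<lambda>\<omega>. (V \<omega>, step n \<omega>))"
  proof (rule pair_measure_eqI)
    show "sigma_finite_measure (distr M borel V)" "sigma_finite_measure (distr M borel (step n))"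
      by unfold_locales
    show "sets (distr M borel V \<Otimes>\<^sub>M distr M borel (step n)) = sets (distr M (borel \<Otimes>\<^sub>M borel) (\<lambda>\<omega>. (V \<omega>, step n \<omega>)))"
      by (simp cong: sets_pair_measure_cong)
    fix A C assume "A \<in> sets (distr M borel V)" "C \<in> sets (distr M borel (step n))"
    then have A: "A \<in> sets borel" and C: "C \<in> sets borel" by auto
    have B: "V -` A \<inter> space M \<in> sets (past M E S n)"
      using measurable_sets[OF V A] by (simp add: space_past[OF mc])
    have "emeasure (distr M (borel \<Otimes>\<^sub>M borel) (\<lambda>\<omega>. (V \<omega>, step n \<omega>))) (A \<times> C) = emeasure M ((V -` A \<inter> space M) \<inter> (step n -` C \<inter> space M))"
      using VM A C by (subst emeasure_distr) (auto intro!: arg_cong[where f="emeasure M"])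
    also have "\<dots> = emeasure M (V -` A \<inter> space M) * emeasure \<nu> C" by (rule step_joint_\<nu>[OF B C])
    also have "\<dots> = emeasure (distr M borel V) A * emeasure (distr M borel (step n)) C"
      using VM A by (simp add: emeasure_distr step_distr')
    finally show "emeasure (distr M borel V) A * emeasure (distr M borel (step n)) C = emeasure (distr M (borel \<Otimes>\<^sub>M borel) (\<lambda>\<omega>. (V \<omega>, step n \<omega>))) (A \<times> C)" by simp
  qed
  then show ?thesis unfolding indep_var_distribution_eq using VM step_meas by simp
qed

lemma char_sum_steps:
  assumes f [measurable]: "f \<in> borel_measurable borel"
  shows "char (distr M borel (\<lambda>\<omega>. \<Sum>i<n. f (step i \<omega>))) t = char (distr \<nu> borel f) t ^ n"
proof (induction n)
  case 0
  show ?case unfolding char_def by (subst integral_distr) (auto simp: prob_space)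
next
  case (Suc n)
  have V: "(\<lambda>\<omega>. \<Sum>i<n. f (step i \<omega>)) \<in> borel_measurable (past M E S n)"
    by (intro borel_measurable_sum measurable_compose[OF step_meas_past f]) auto
  have "indep_var borel (id \<circ> (\<lambda>\<omega>. \<Sum>i<n. f (step i \<omega>))) borel (f \<circ> step n)"
    by (rule indep_var_compose[OF indep_past_step[OF V]]) auto
  then have ind: "indep_var borel (\<lambda>\<omega>. \<Sum>i<n. f (step i \<omega>)) borel (\<lambda>\<omega>. f (step n \<omega>))" by (simp add: comp_def)
  have "distr M borel (\<lambda>\<omega>. f (step n \<omega>)) = distr \<nu> borel f"
    unfolding step_distr'[of n, symmetric] by (subst distr_distr) (auto simp: comp_def)
  then show ?case using char_distr_add[OF ind, of t] Suc by (simp add: mult.commute)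
qed

lemma ratio_second_moment:
  assumes k3: "3 \<le> k"
  shows "integrable M (\<lambda>\<omega>. (ratio n \<omega> - 1)\<^sup>2)" "expectation (\<lambda>\<omega>. (ratio n \<omega> - 1)\<^sup>2) \<le> 1 / real k"
proof -
  let ?N = "past M E S n"
  define f where "f = (\<lambda>(\<omega>, y). ennreal ((cosh (hyp_dist F k origin y) / (cosh (hyp_dist F k origin (S n \<omega>)) * cosh (hyp_dist F k (S n \<omega>) y)) - 1)\<^sup>2))"
  have Sn: "(\<lambda>z. S n (fst z)) \<in> ?N \<Otimes>\<^sub>M E \<rightarrow>\<^sub>M E"
    by (rule measurable_compose[OF measurable_fst measurable_past[OF mc order_refl]])
  note [measurable] = hyp_dist_comp_measurable[OF k Sn measurable_snd]
    hyp_dist_comp_measurable[OF k origin_meas Sn] hyp_dist_comp_measurable[OF k origin_meas measurable_snd]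
  have f: "f \<in> borel_measurable (?N \<Otimes>\<^sub>M E)"
    unfolding f_def split_beta' by measurable
  have "(\<integral>\<^sup>+\<omega>. ennreal ((ratio n \<omega> - 1)\<^sup>2) \<partial>M) = (\<integral>\<^sup>+\<omega>. f (\<omega>, S (Suc n) \<omega>) \<partial>M)"
    by (simp add: f_def ratio_def radius_def step_def)
  also have "\<dots> = (\<integral>\<^sup>+\<omega>. (\<integral>\<^sup>+y. f (\<omega>, y) \<partial>\<kappa> (S n \<omega>)) \<partial>M)" by (rule markov_joint_integral[OF mc f])
  also have "\<dots> \<le> (\<integral>\<^sup>+\<omega>. ennreal (1 / real k) \<partial>M)"
    by (rule nn_integral_mono) (simp add: f_def step_ratio_second_moment[OF inv kernel_meas k3 S_space])
  also have "\<dots> = ennreal (1 / real k)" by (simp add: emeasure_space_1)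
  finally have le: "(\<integral>\<^sup>+\<omega>. ennreal ((ratio n \<omega> - 1)\<^sup>2) \<partial>M) \<le> ennreal (1 / real k)" .
  show int: "integrable M (\<lambda>\<omega>. (ratio n \<omega> - 1)\<^sup>2)"
    by (rule integrableI_nonneg) (use le in \<open>auto intro: le_less_trans\<close>)
  have "ennreal (expectation (\<lambda>\<omega>. (ratio n \<omega> - 1)\<^sup>2)) \<le> ennreal (1 / real k)"
    using le nn_integral_eq_integral[OF int] by simp
  then show "expectation (\<lambda>\<omega>. (ratio n \<omega> - 1)\<^sup>2) \<le> 1 / real k" by simp
qed

lemma ratio_pos: "ratio n \<omega> > 0"
  unfolding ratio_def by (intro divide_pos_pos mult_pos_pos cosh_real_pos)

lemma ln_cosh_radius:
  assumes \<omega>: "\<omega> \<in> space M"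
  shows "ln (cosh (radius n \<omega>)) = (\<Sum>i<n. ln (cosh (step i \<omega>))) + (\<Sum>i<n. ln (ratio i \<omega>))"
proof (induction n)
  case 0
  have "cosh (hyp_dist F k origin origin) = 1"
    unfolding hyp_origin_def hyp_dist_coset(2)[OF k hyp_G_one hyp_G_one] lorentz_pairing_one by simp
  then show ?case by (simp add: radius_def start[OF \<omega>])
next
  case (Suc n)
  have "cosh (radius (Suc n) \<omega>) = cosh (radius n \<omega>) * cosh (step n \<omega>) * ratio n \<omega>"
    unfolding ratio_def by simp
  then have "ln (cosh (radius (Suc n) \<omega>)) = ln (cosh (radius n \<omega>)) + ln (cosh (step n \<omega>)) + ln (ratio n \<omega>)"
    using ratio_pos[of n \<omega>] by (simp add: ln_mult)
  then show ?case using Suc by simp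
qed

text \<open>
  Near 1 the logarithm is Lipschitz, and a distance is within \<open>ln 2\<close> of its \<open>ln cosh\<close>.
\<close>

lemma radius_approximation:
  assumes \<omega>: "\<omega> \<in> space M" and small: "\<And>i. i < n \<Longrightarrow> \<bar>ratio i \<omega> - 1\<bar> \<le> 1 / 2"
  shows "\<bar>radius n \<omega> - (\<Sum>i<n. ln (cosh (step i \<omega>)))\<bar> \<le> ln 2 + 2 * (\<Sum>i<n. \<bar>ratio i \<omega> - 1\<bar>)"
proof -
  have r: "radius n \<omega> \<ge> 0"
    unfolding radius_def by (rule hyp_dist_nonneg[OF k hyp_origin_in_space S_space[OF \<omega>]])
  have "\<bar>\<Sum>i<n. ln (ratio i \<omega>)\<bar> \<le> (\<Sum>i<n. 2 * \<bar>ratio i \<omega> - 1\<bar>)"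
    by (rule order_trans[OF sum_abs sum_mono]) (use abs_ln_le_of_near_1 small in auto)
  then have "\<bar>\<Sum>i<n. ln (ratio i \<omega>)\<bar> \<le> 2 * (\<Sum>i<n. \<bar>ratio i \<omega> - 1\<bar>)" by (simp add: sum_distrib_left)
  then show ?thesis
    using ln_cosh_radius[OF \<omega>, of n] ln_cosh_bounds[of "radius n \<omega>"] r by linarith
qed

text \<open>
  On the complement of the event that all ratios are within \<open>1/2\<close> of 1, the difference of the two
  exponentials is bounded by 2. Both cases are covered by one integrable bound \<open>G\<close> in terms of
  \<open>Q = \<Sum> (r\<^sub>i - 1)\<^sup>2\<close>, whose expectation is at most \<open>n/k\<close>.
\<close>

lemma char_radius_approximation:
  assumes k3: "3 \<le> k" and n: "n \<ge> 1"
  shows "norm (char (distr M borel (\<lambda>\<omega>. (radius n \<omega> - real n * m) / sqrt (real n))) t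
      - char (distr \<nu> borel (\<lambda>x. ln (cosh x) - m)) (t / sqrt (real n)) ^ n)
    \<le> 8 * real n / real k + \<bar>t\<bar> * (ln 2 + 2 * real n / sqrt (real k)) / sqrt (real n)"
proof -
  let ?q = "sqrt (real n)" and ?s = "sqrt (real k)"
  have q: "?q > 0" and s: "?s > 0" using n k by auto
  define Z where "Z \<omega> = (radius n \<omega> - real n * m) / ?q" for \<omega>
  define X where "X \<omega> = (\<Sum>i<n. ln (cosh (step i \<omega>)) - m) / ?q" for \<omega>
  define Q where "Q \<omega> = (\<Sum>i<n. (ratio i \<omega> - 1)\<^sup>2)" for \<omega>
  define G where "G \<omega> = 8 * Q \<omega> + \<bar>t\<bar> * (ln 2 + (?s * Q \<omega> + real n / ?s)) / ?q" for \<omega>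
  have [measurable]: "Z \<in> borel_measurable M" "X \<in> borel_measurable M" unfolding Z_def X_def by measurable
  have pointwise: "norm (iexp (t * Z \<omega>) - iexp (t * X \<omega>)) \<le> G \<omega>" if \<omega>: "\<omega> \<in> space M" for \<omega>
  proof -
    have Q0: "Q \<omega> \<ge> 0" unfolding Q_def by (simp add: sum_nonneg)
    have tail: "\<bar>t\<bar> * (ln 2 + (?s * Q \<omega> + real n / ?s)) / ?q \<ge> 0"
      using Q0 q s by (intro divide_nonneg_nonneg mult_nonneg_nonneg add_nonneg_nonneg) auto
    show ?thesis
    proof (cases "\<forall>i<n. \<bar>ratio i \<omega> - 1\<bar> \<le> 1 / 2")
      case True
      \<comment> \<open>Balanced so that both terms have expectation \<open>1 / sqrt k\<close> or less.\<close>
      have amgm: "2 * \<bar>x\<bar> \<le> ?s * x\<^sup>2 + 1 / ?s" for x :: real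
      proof -
        have "0 \<le> (?s * \<bar>x\<bar> - 1)\<^sup>2 / ?s" using s by simp
        also have "(?s * \<bar>x\<bar> - 1)\<^sup>2 / ?s = ?s * x\<^sup>2 + 1 / ?s - 2 * \<bar>x\<bar>"
          using s by (simp add: power2_diff power_mult_distrib field_simps power2_eq_square)
        finally show ?thesis by simp
      qed
      have "2 * (\<Sum>i<n. \<bar>ratio i \<omega> - 1\<bar>) \<le> (\<Sum>i<n. ?s * (ratio i \<omega> - 1)\<^sup>2 + 1 / ?s)"
        unfolding sum_distrib_left by (rule sum_mono) (rule amgm)
      also have "\<dots> = ?s * Q \<omega> + real n / ?s" by (simp add: Q_def sum.distrib sum_distrib_left)
      finally have e: "\<bar>radius n \<omega> - (\<Sum>i<n. ln (cosh (step i \<omega>)))\<bar> \<le> ln 2 + (?s * Q \<omega> + real n / ?s)"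
        using radius_approximation[OF \<omega>, of n] True by fastforce
      have "Z \<omega> - X \<omega> = (radius n \<omega> - (\<Sum>i<n. ln (cosh (step i \<omega>)))) / ?q"
        by (simp add: Z_def X_def sum_subtractf diff_divide_distrib)
      then have "\<bar>t * Z \<omega> - t * X \<omega>\<bar> = \<bar>t\<bar> * \<bar>radius n \<omega> - (\<Sum>i<n. ln (cosh (step i \<omega>)))\<bar> / ?q"
        using q by (simp add: right_diff_distrib[symmetric] abs_mult)
      also have "\<dots> \<le> \<bar>t\<bar> * (ln 2 + (?s * Q \<omega> + real n / ?s)) / ?q"
        by (intro divide_right_mono mult_left_mono e) (use q in auto)
      finally show ?thesis unfolding G_def using norm_iexp_diff_le(1)[of "t * Z \<omega>" "t * X \<omega>"] Q0 by linarith
    next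
      case False
      then obtain i where i: "i < n" "\<bar>ratio i \<omega> - 1\<bar> > 1 / 2" by force
      have "(1 / 2)\<^sup>2 \<le> \<bar>ratio i \<omega> - 1\<bar>\<^sup>2" by (rule power_mono) (use i in auto)
      also have "\<dots> \<le> Q \<omega>" unfolding Q_def power2_abs by (rule member_le_sum) (use i in auto)
      finally have "2 \<le> 8 * Q \<omega>" by (simp add: power2_eq_square)
      then show ?thesis unfolding G_def using norm_iexp_diff_le(2)[of "t * Z \<omega>" "t * X \<omega>"] tail by linarith
    qed
  qed
  note r2 = ratio_second_moment[OF k3]
  have Q_int: "integrable M Q" unfolding Q_def by (intro Bochner_Integration.integrable_sum r2)
  have "expectation Q = (\<Sum>i<n. expectation (\<lambda>\<omega>. (ratio i \<omega> - 1)\<^sup>2))"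
    unfolding Q_def by (rule Bochner_Integration.integral_sum) (rule r2)
  also have "\<dots> \<le> (\<Sum>i<n. 1 / real k)" by (intro sum_mono r2)
  finally have EQ: "expectation Q \<le> real n / real k" by simp
  have G_int: "integrable M G" unfolding G_def using Q_int by (intro Bochner_Integration.integrable_add integrable_divide integrable_mult_right) auto
  have "expectation G = 8 * expectation Q + \<bar>t\<bar> * (ln 2 + (?s * expectation Q + real n / ?s)) / ?q"
    unfolding G_def using Q_int by (simp add: prob_space)
  also have "\<dots> \<le> 8 * (real n / real k) + \<bar>t\<bar> * (ln 2 + (?s * (real n / real k) + real n / ?s)) / ?q"
    using q s by (intro add_mono mult_left_mono divide_right_mono EQ order_refl) auto
  also have "?s * (real n / real k) = real n / ?s"
    using s by (simp add: field_simps)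
  finally have EG: "expectation G \<le> 8 * real n / real k + \<bar>t\<bar> * (ln 2 + 2 * real n / ?s) / ?q" by simp
  have iexp_int: "integrable M (\<lambda>\<omega>. iexp (t * f \<omega>))" if [measurable]: "f \<in> borel_measurable M" for f
    by (rule integrable_const_bound[where B=1]) auto
  have char_X: "char (distr M borel X) t = char (distr \<nu> borel (\<lambda>x. ln (cosh x) - m)) (t / ?q) ^ n"
  proof -
    have "char (distr M borel X) t = char (distr M borel (\<lambda>\<omega>. \<Sum>i<n. ln (cosh (step i \<omega>)) - m)) (t / ?q)"
      unfolding char_def X_def by (subst (1 2) integral_distr) auto
    also have "\<dots> = char (distr \<nu> borel (\<lambda>x. ln (cosh x) - m)) (t / ?q) ^ n"
      by (rule char_sum_steps) measurable
    finally show ?thesis .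
  qed
  have "char (distr M borel Z) t - char (distr M borel X) t = expectation (\<lambda>\<omega>. iexp (t * Z \<omega>) - iexp (t * X \<omega>))"
  proof -
    have c: "char (distr M borel f) t = expectation (\<lambda>\<omega>. iexp (t * f \<omega>))" if [measurable]: "f \<in> borel_measurable M" for f
      unfolding char_def by (subst integral_distr) auto
    show ?thesis
      by (subst (1 2) c) (measurable, rule Bochner_Integration.integral_diff[OF iexp_int iexp_int, symmetric], measurable)
  qed
  then have "norm (char (distr M borel Z) t - char (distr M borel X) t) \<le> expectation (\<lambda>\<omega>. norm (iexp (t * Z \<omega>) - iexp (t * X \<omega>)))"
    by simp
  also have "\<dots> \<le> expectation G"
    by (rule integral_mono) (use pointwise iexp_int G_int in auto)
  finally show ?thesis using EG char_X unfolding Z_def by simp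
qed

end

lemma walk_associated_with_hyp_walk:
  assumes "walk_associated_with F k M S \<nu>" and k: "2 \<le> k"
  obtains \<kappa> where "hyp_walk F k M S \<nu> \<kappa>"
proof -
  from assms(1) obtain \<kappa> where "invariant_kernel F k \<kappa>" "markov_chain M (hyp_borel F k) \<kappa> S"
    "\<forall>\<omega>\<in>space M. S 0 \<omega> = hyp_coset F k (1\<^sub>m (k + 1))"
    "\<forall>n. distr M borel (\<lambda>\<omega>. hyp_dist F k (S n \<omega>) (S (Suc n) \<omega>)) = \<nu>"
    unfolding walk_associated_with_def radial_random_walk_def by blast
  then have "hyp_walk F k M S \<nu> \<kappa>"
    using k by (intro hyp_walk.intro) (auto simp: hyp_origin_def)
  then show thesis by (rule that)
qed

theorem theorem1p4:
  fixes F :: hscalar and k :: "nat \<Rightarrow> nat" and \<nu> :: "real measure"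
    and M :: "nat \<Rightarrow> 'w measure" and S :: "nat \<Rightarrow> nat \<Rightarrow> 'w \<Rightarrow> quat mat set"
  assumes k_mono: "mono_on {1..} k" and k_ge2: "\<And>n. n \<ge> 1 \<Longrightarrow> k n \<ge> 2"
    and k_growth: "(\<lambda>n. real n / real (k n)) \<longlonglongrightarrow> 0"
    and \<nu>_prob: "prob_space \<nu>" and \<nu>_sets: "sets \<nu> = sets borel" and \<nu>_nonneg: "AE x in \<nu>. x \<ge> 0"
    and \<nu>_moment: "integrable \<nu> (\<lambda>x. x\<^sup>2)"
    and walks: "\<And>d. d \<ge> 2 \<Longrightarrow> walk_associated_with F d (M d) (S d) \<nu>"
  shows "(\<forall>j\<in>{1, 2::nat}. integrable \<nu> (\<lambda>x. ln (cosh x) ^ j)) \<and>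
    weak_conv_m
      (\<lambda>n. distr (M (k n)) borel
         (\<lambda>\<omega>. (hyp_dist F (k n) (S (k n) n \<omega>) (S (k n) 0 \<omega>) - real n * lncosh_moment \<nu> 1) / sqrt (real n)))
      (centered_normal (lncosh_moment \<nu> 2 - (lncosh_moment \<nu> 1)\<^sup>2))"
proof
  interpret \<nu>: prob_space \<nu> by (rule \<nu>_prob)
  have meas_\<nu> [measurable_cong]: "sets \<nu> = sets borel" by (rule \<nu>_sets)
  have int2: "integrable \<nu> (\<lambda>x. (ln (cosh x))\<^sup>2)"
  proof (rule Bochner_Integration.integrable_bound[OF \<nu>_moment])
    show "AE x in \<nu>. norm ((ln (cosh x))\<^sup>2) \<le> norm (x\<^sup>2)"
    proof (rule AE_I2)
      fix x :: real
      have "(ln (cosh x))\<^sup>2 \<le> \<bar>x\<bar>\<^sup>2" by (rule power_mono) (rule ln_cosh_bounds)+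
      then show "norm ((ln (cosh x))\<^sup>2) \<le> norm (x\<^sup>2)" by simp
    qed
  qed measurable
  have int1: "integrable \<nu> (\<lambda>x. ln (cosh x))"
    by (rule \<nu>.square_integrable_imp_integrable[OF _ int2]) measurable
  show "\<forall>j\<in>{1, 2::nat}. integrable \<nu> (\<lambda>x. ln (cosh x) ^ j)" using int1 int2 by simp
  define m where "m = lncosh_moment \<nu> 1"
  define v where "v = lncosh_moment \<nu> 2 - m\<^sup>2"
  define \<mu> where "\<mu> = distr \<nu> borel (\<lambda>x. ln (cosh x) - m)"
  have m: "m = integral\<^sup>L \<nu> (\<lambda>x. ln (cosh x))" by (simp add: m_def lncosh_moment_def)
  have \<mu>_dist: "real_distribution \<mu>" unfolding \<mu>_def by (rule \<nu>.real_distribution_distr) measurable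
  have \<mu>_mean: "integral\<^sup>L \<mu> (\<lambda>x. x) = 0"
    unfolding \<mu>_def using int1 by (subst integral_distr) (auto simp: m \<nu>.prob_space)
  have sq_eq: "(ln (cosh x) - m)\<^sup>2 = (ln (cosh x))\<^sup>2 - 2 * m * ln (cosh x) + m\<^sup>2" for x
    by (simp add: power2_diff)
  have \<mu>_sq: "integrable \<mu> (\<lambda>x. x\<^sup>2)"
    unfolding \<mu>_def using int1 int2 by (subst integrable_distr_eq) (auto simp: sq_eq)
  have \<mu>_var: "integral\<^sup>L \<mu> (\<lambda>x. x\<^sup>2) = v"
  proof -
    have "integral\<^sup>L \<mu> (\<lambda>x. x\<^sup>2) = integral\<^sup>L \<nu> (\<lambda>x. (ln (cosh x))\<^sup>2 - 2 * m * ln (cosh x) + m\<^sup>2)"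
      unfolding \<mu>_def sq_eq[symmetric] by (subst integral_distr) auto
    also have "\<dots> = integral\<^sup>L \<nu> (\<lambda>x. (ln (cosh x))\<^sup>2) - 2 * m * m + m\<^sup>2"
      using int1 int2 by (simp add: \<nu>.prob_space m[symmetric])
    finally show ?thesis by (simp add: v_def lncosh_moment_def power2_eq_square)
  qed
  have v0: "v \<ge> 0" unfolding \<mu>_var[symmetric] by simp
  define Z where "Z n \<omega> = (hyp_dist F (k n) (S (k n) n \<omega>) (S (k n) 0 \<omega>) - real n * m) / sqrt (real n)" for n \<omega>
  define P where "P n = distr (M (k n)) borel (Z n)" for n
  have P_radius: "real_distribution (P n) \<and> (k n \<ge> 3 \<longrightarrow> norm (char (P n) t - char \<mu> (t / sqrt (real n)) ^ n)
      \<le> 8 * (real n / real (k n)) + \<bar>t\<bar> * (ln 2 / sqrt (real n) + 2 * sqrt (real n / real (k n))))"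
    if n: "n \<ge> 1" for n t
  proof -
    have k2: "2 \<le> k n" by (rule k_ge2[OF n])
    obtain \<kappa> where "hyp_walk F (k n) (M (k n)) (S (k n)) \<nu> \<kappa>"
      using walk_associated_with_hyp_walk[OF walks[OF k2] k2] .
    then interpret W: hyp_walk F "k n" "M (k n)" "S (k n)" \<nu> \<kappa> .
    have Z: "Z n \<omega> = (W.radius n \<omega> - real n * m) / sqrt (real n)" if "\<omega> \<in> space (M (k n))" for \<omega>
      unfolding Z_def W.radius_def using hyp_dist_commute[OF k2 W.S_space[OF that] hyp_origin_in_space] W.start[OF that] by simp
    have P: "P n = distr (M (k n)) borel (\<lambda>\<omega>. (W.radius n \<omega> - real n * m) / sqrt (real n))"
      unfolding P_def by (rule distr_cong) (use Z in auto)
    have "real_distribution (P n)" unfolding P by (rule W.real_distribution_distr) measurable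
    moreover have "\<bar>t\<bar> * (ln 2 + 2 * real n / sqrt (real (k n))) / sqrt (real n) =
      \<bar>t\<bar> * (ln 2 / sqrt (real n) + 2 * sqrt (real n / real (k n)))"
    proof -
      have "2 * real n / sqrt (real (k n)) / sqrt (real n) = 2 * ((real n / sqrt (real n)) / sqrt (real (k n)))" by simp
      also have "\<dots> = 2 * sqrt (real n / real (k n))" by (simp only: real_div_sqrt[OF of_nat_0_le_iff] real_sqrt_divide)
      finally have "(ln 2 + 2 * real n / sqrt (real (k n))) / sqrt (real n) = ln 2 / sqrt (real n) + 2 * sqrt (real n / real (k n))"
        by (simp only: add_divide_distrib)
      then show ?thesis by (simp only: times_divide_eq_right[symmetric])
    qed
    ultimately show ?thesis
      using W.char_radius_approximation[OF _ n, of m t] unfolding P \<mu>_def by auto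
  qed
  have k_ev: "\<forall>\<^sub>F n in sequentially. k n \<ge> 3"
  proof -
    have "\<forall>\<^sub>F n in sequentially. real n / real (k n) < 1" by (rule order_tendstoD(2)[OF k_growth]) simp
    then show ?thesis using eventually_ge_at_top[of 3]
    proof eventually_elim
      case (elim n)
      then have "k n \<ge> 2" using k_ge2 by simp
      then have "real n < real (k n)" using elim(1) by (simp add: divide_less_eq_1)
      then show ?case using elim(2) by linarith
    qed
  qed
  have char_lim: "(\<lambda>n. char (P n) t) \<longlonglongrightarrow> char (centered_normal v) t" for t
  proof -
    let ?e = "\<lambda>n. 8 * (real n / real (k n)) + \<bar>t\<bar> * (ln 2 / sqrt (real n) + 2 * sqrt (real n / real (k n)))"
    have "(\<lambda>n. ln 2 / sqrt (real n)) \<longlonglongrightarrow> 0" by real_asymp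
    moreover have "(\<lambda>n. sqrt (real n / real (k n))) \<longlonglongrightarrow> sqrt 0" by (intro tendsto_real_sqrt k_growth)
    ultimately have "?e \<longlonglongrightarrow> 8 * 0 + \<bar>t\<bar> * (0 + 2 * sqrt 0)" by (intro tendsto_intros k_growth)
    then have e: "?e \<longlonglongrightarrow> 0" by simp
    have "\<forall>\<^sub>F n in sequentially. norm (char (P n) t - char \<mu> (t / sqrt (real n)) ^ n) \<le> ?e n"
      using k_ev eventually_ge_at_top[of 1] by eventually_elim (use P_radius in blast)
    then have diff: "(\<lambda>n. char (P n) t - char \<mu> (t / sqrt (real n)) ^ n) \<longlonglongrightarrow> 0" by (rule Lim_null_comparison[OF _ e])
    have "(\<lambda>n. char \<mu> (t / sqrt (real n)) ^ n) \<longlonglongrightarrow> char (centered_normal v) t"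
      unfolding centered_normal_char(2)[OF v0] by (rule char_power_tendsto_gaussian[OF \<mu>_dist \<mu>_sq \<mu>_mean \<mu>_var])
    then show ?thesis by (rule Lim_transform[OF _ diff])
  qed
  \<comment> \<open>The index 0 is skipped: \<open>k 0\<close> is arbitrary, so \<open>P 0\<close> need not be a probability measure.\<close>
  have "weak_conv_m (\<lambda>n. P (Suc n)) (centered_normal v)"
    by (rule levy_continuity) (use P_radius centered_normal_char(1)[OF v0] LIMSEQ_Suc[OF char_lim] in auto)
  then have "weak_conv_m P (centered_normal v)"
    unfolding weak_conv_m_def weak_conv_def by (auto intro: LIMSEQ_imp_Suc)
  then show "weak_conv_m
      (\<lambda>n. distr (M (k n)) borel
         (\<lambda>\<omega>. (hyp_dist F (k n) (S (k n) n \<omega>) (S (k n) 0 \<omega>) - real n * lncosh_moment \<nu> 1) / sqrt (real n)))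
      (centered_normal (lncosh_moment \<nu> 2 - (lncosh_moment \<nu> 1)\<^sup>2))"
    unfolding P_def[abs_def] Z_def[abs_def] v_def m_def .
qed

end
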